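(* Let $$\tilde\pi=(-\Theta)^{\frac{\sigma^2}{q-1}}\,\Theta^{\sigma}\prod_{k=1}^\infty\frac{\Theta^{q^k}}{\Theta^{q^k}-\Theta^{\sigma^k}}\in\mathbb C_\infty ,$$ where $(-\Theta)^{\frac{\sigma^2}{q-1}}$ denotes a $(q-1)$-th root of $-\Theta^{\sigma^2}$. (1) The kernel of $\exp_{(2)}$ on $\mathbb C_\infty$ (with respect to the norm $|\cdot|_\eta$) is the free $\mathcal A$-module generated by $\tilde\pi$, i.e. $\ker\exp_{(2)}=\tilde\pi\,\iota(\mathcal A)$. (2) For every integer $j\ge 0$, $$\ker\exp_{(j+2)}=\tilde\pi\,\frac{\Theta^{1+\sigma+\cdots+\sigma^{j+1}}}{\sqrt[q-1]{\Theta^{\sigma^2-\sigma^{j+2}}}\cdot\Theta^{1+\sigma}}\;I_\infty^{-j},$$ where $I_\infty^{-j}$ is regarded as a fractional ideal inside $K$ via $\iota$, and $\sqrt[q-1]{\ \cdot\ }$ denotes any $(q-1)$-th root.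
   Context: Let $\mathcal K=\mathbb F_q(t)$ and let $K=\mathbb F_q(\theta)$ be its copy via $\iota:t\mapsto\theta$. Let $\rho\in\mathbb F_q[t]$ be monic irreducible of degree $N\ge 2$, $\eta$ a root of $\rho$, and $\eta^{(i)}=\eta^{q^i}$ ($i\in\mathbb Z$, depending only on $i$ mod $N$). Let $\mathcal A=H^0(\mathbb P^1-P_\rho,\mathcal O_{\mathbb P^1})$ be the ring of elements of $\mathcal K$ regular away from the place $P_\rho$ of $\rho$; it is generated over $\mathbb F_q$ by $T_i=t^i/\rho(t)$, $0\le i\le N-1$. $I_\infty$ is the ideal of $\mathcal A$ generated by $T_0,\dots,T_{N-1}$ (the prime of $\mathcal A$ corresponding to the place $t=\infty$). Let $K_\rho$ be the completion of $K$ at the place of $\rho(\theta)$, containing $\mathbb F_q(\eta)$ with $\theta-\eta$ a uniformizer, and $\mathbb C_\infty$ the completion of an algebraic closure of $K_\rho$, with absolute value $|\cdot|_\eta$ normalized by $|\theta-\eta|_\eta=q^{-1}$. Let $H=K(\eta)$ and let $\sigma\in\mathrm{Gal}(H/K)$ be $\eta\mapsto\eta^q$, $\theta\mapsto\theta$. For $x\in H^*$ and $\sum a_i\sigma^i\in\mathbb Z[\sigma]$, $x^{\sum a_i\sigma^i}=\prod\sigma^i(x)^{a_i}$. Put $\Theta=\frac1{\theta-\eta}$, so $\Theta^{\sigma^k}=\frac1{\theta-\eta^{(k)}}$. For $g\in\mathbb C_\infty(t)$, $g^{(k)}$ is obtained by raising the coefficients in $\mathbb C_\infty$ to the $q^k$-th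 power ($t$ fixed). Put $f(t)=\frac1{t-\eta}-\frac1{\theta-\eta}$, $\mathbf s_0=1$, $\mathbf s_i=f^{(0)}\cdots f^{(i-1)}$. The $\mathbf s_i$ form a $\mathbb C_\infty$-basis of $\mathcal A\otimes_{\mathbb F_q}\mathbb C_\infty=\mathbb C_\infty[\frac1{t-\eta^{(i)}}:0\le i\le N-1]$. The rank-one Drinfeld module $\Psi:\mathcal A\to\mathbb C_\infty\{\tau\}$ ($\tau c=c^q\tau$) is defined by $\Psi_a=\sum_i c_i\tau^i$ where $a=\sum_ic_i\mathbf s_i$; its coefficients lie in $H$. For $k\ge 0$, $\Psi^{(k)}$ is the Drinfeld module obtained by applying $\sigma^k$ to the coefficients of $\Psi$ (so it depends only on $k$ mod $N$), and $\exp_{(k)}$ is its exponential function: the entire $\mathbb F_q$-linear function on $\mathbb C_\infty$ with derivative $1$ at $0$ and $\Psi^{(k)}_a(\exp_{(k)}(\xi))=\exp_{(k)}(a(\theta)\xi)$ for all $a\in\mathcal A$. *)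

theory Defs
  imports "HOL-Analysis.Analysis" "HOL-Computational_Algebra.Computational_Algebra"
begin

text \<open>
  The rational function field over the finite field \<open>'k\<close> (so \<open>q = CARD('k)\<close>) is
  \<open>'k poly fract\<close>, and \<open>'c\<close> is the complete field of the analysis, whose absolute value is
  \<open>eta_abs\<close>. The embedding \<open>\<iota>\<close> sends the variable \<open>t\<close> to \<open>\<theta>\<close>; its range is \<open>K\<close>.
  The field \<open>\<complex>\<^sub>\<infinity>(t)\<close> is \<open>'c poly fract\<close>.
\<close>

text \<open>For an injective ring homomorphism \<open>h\<close> into a field, this is its unique extension to the
  fraction field.\<close>

definition extend_fract :: "('a::idom \<Rightarrow> 'b::field) \<Rightarrow> 'a fract \<Rightarrow> 'b" where
  "extend_fract h x = (THE y. \<exists>a b. b \<noteq> 0 \<and> x = Fract a b \<and> y = h a / h b)"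

definition twist :: "nat \<Rightarrow> nat \<Rightarrow> 'c::field poly fract \<Rightarrow> 'c poly fract" where
  "twist q k = extend_fract (\<lambda>p. to_fract (map_poly (\<lambda>c. c ^ (q ^ k)) p))"

definition theta :: "('k::field poly fract \<Rightarrow> 'c::field) \<Rightarrow> 'c" where
  "theta \<iota> = \<iota> (to_fract [:0, 1:])"

definition const_emb :: "('k::field poly fract \<Rightarrow> 'c::field) \<Rightarrow> 'k \<Rightarrow> 'c" where
  "const_emb \<iota> c = \<iota> (to_fract [:c:])"

text \<open>The inclusion of \<open>\<bbbF>\<^sub>q(t)\<close> into \<open>\<complex>\<^sub>\<infinity>(t)\<close>, fixing \<open>t\<close>.\<close>

definition base_change :: "('k::field poly fract \<Rightarrow> 'c::field) \<Rightarrow> 'k poly fract \<Rightarrow> 'c poly fract" where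
  "base_change \<iota> = extend_fract (\<lambda>p. to_fract (map_poly (const_emb \<iota>) p))"

definition regular_at :: "'k::field poly \<Rightarrow> 'k poly fract \<Rightarrow> bool" where
  "regular_at p x \<longleftrightarrow> (\<exists>a b. \<not> p dvd b \<and> x = Fract a b)"

definition regular_at_infinity :: "'k::field poly fract \<Rightarrow> bool" where
  "regular_at_infinity x \<longleftrightarrow> (\<exists>a b. b \<noteq> 0 \<and> degree a \<le> degree b \<and> x = Fract a b)"

definition ring_A :: "'k::field poly \<Rightarrow> 'k poly fract set" where
  "ring_A \<rho> = {x. regular_at_infinity x \<and>
     (\<forall>p. irreducible p \<and> lead_coeff p = 1 \<and> p \<noteq> \<rho> \<longrightarrow> regular_at p x)}"

definition span_over :: "'a::comm_ring_1 set \<Rightarrow> 'a set \<Rightarrow> 'a set" where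
  "span_over R S = {\<Sum>x\<in>F. c x * x | F c. finite F \<and> F \<subseteq> S \<and> c ` F \<subseteq> R}"

definition gen_T :: "'k::field poly \<Rightarrow> nat \<Rightarrow> 'k poly fract" where
  "gen_T \<rho> i = Fract (monom 1 i) \<rho>"

definition I_inf :: "'k::field poly \<Rightarrow> 'k poly fract set" where
  "I_inf \<rho> = span_over (ring_A \<rho>) (gen_T \<rho> ` {..<degree \<rho>})"

primrec ideal_power :: "'a::comm_ring_1 set \<Rightarrow> 'a set \<Rightarrow> nat \<Rightarrow> 'a set" where
  "ideal_power R I 0 = R"
| "ideal_power R I (Suc j) = span_over R {x * y | x y. x \<in> I \<and> y \<in> ideal_power R I j}"

text \<open>Since \<open>\<A>\<close> is a Dedekind domain, the inverse of the ideal \<open>I\<^sub>\<infinity>\<^sup>j\<close> is the ideal quotient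
  \<open>(\<A> : I\<^sub>\<infinity>\<^sup>j)\<close>.\<close>

definition I_inf_neg_power :: "'k::field poly \<Rightarrow> nat \<Rightarrow> 'k poly fract set" where
  "I_inf_neg_power \<rho> j =
     {x. \<forall>y \<in> ideal_power (ring_A \<rho>) (I_inf \<rho>) j. x * y \<in> ring_A \<rho>}"

definition eta_abs :: "'c::{field, metric_space} \<Rightarrow> real" where
  "eta_abs x = dist x 0"

definition K_rho :: "('k::field poly fract \<Rightarrow> 'c::{field, metric_space}) \<Rightarrow> 'c set" where
  "K_rho \<iota> = closure (range \<iota>)"

definition algebraic_over :: "'c::field set \<Rightarrow> 'c \<Rightarrow> bool" where
  "algebraic_over L x \<longleftrightarrow> (\<exists>p. p \<noteq> 0 \<and> (\<forall>i. coeff p i \<in> L) \<and> poly p x = 0)"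

definition K_rho_bar :: "('k::field poly fract \<Rightarrow> 'c::{field, metric_space}) \<Rightarrow> 'c set" where
  "K_rho_bar \<iota> = {x. algebraic_over (K_rho \<iota>) x}"

definition is_subfield :: "'c::field set \<Rightarrow> bool" where
  "is_subfield F \<longleftrightarrow> 1 \<in> F \<and> (\<forall>x\<in>F. \<forall>y\<in>F. x - y \<in> F \<and> x * y \<in> F) \<and> (\<forall>x\<in>F. inverse x \<in> F)"

definition field_H :: "('k::field poly fract \<Rightarrow> 'c::field) \<Rightarrow> 'c \<Rightarrow> 'c set" where
  "field_H \<iota> \<eta> = is_subfield hull (insert \<eta> (range \<iota>))"

text \<open>
  The normalization \<open>eta_abs (\<theta> - \<eta>) = 1 / q\<close> already forces the absolute value to be the
  \<open>\<rho>\<close>-adic one on \<open>K\<close>: elements algebraic over \<open>\<bbbF>\<^sub>q\<close> have absolute value \<open>0\<close> or \<open>1\<close>, so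
  \<open>\<rho>(\<theta>) = \<Prod>i<N. (\<theta> - \<eta>^(q^i))\<close> has absolute value \<open>1 / q\<close>. As \<open>'c\<close> is complete, the closure
  of \<open>K\<close> in it is the completion \<open>K\<^sub>\<rho>\<close>; \<open>K_rho_bar\<close> is the set of elements algebraic over it,
  and the two assumptions on that set say that it is an algebraic closure of \<open>K\<^sub>\<rho>\<close> whose completion
  is \<open>'c\<close>.

  The automorphism \<open>\<sigma>\<close> is only constrained on \<open>H\<close>; its values elsewhere are irrelevant.
\<close>

locale rho_adic_setting =
  fixes \<iota> :: "'k::{finite, field} poly fract \<Rightarrow> 'c::{field, complete_space}"
    and \<rho> :: "'k poly"
    and \<eta> :: 'c
    and \<sigma> :: "'c \<Rightarrow> 'c"
  assumes iota_one: "\<iota> 1 = 1"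
    and iota_add: "\<iota> (x + y) = \<iota> x + \<iota> y"
    and iota_mult: "\<iota> (x * y) = \<iota> x * \<iota> y"
    and rho_irreducible: "irreducible \<rho>"
    and rho_monic: "lead_coeff \<rho> = 1"
    and rho_degree: "degree \<rho> \<ge> 2"
    and eta_root: "poly (map_poly (const_emb \<iota>) \<rho>) \<eta> = 0"
    and dist_eta_abs: "dist a b = eta_abs (a - b)"
    and eta_abs_mult: "eta_abs (a * b) = eta_abs a * eta_abs b"
    and eta_abs_add: "eta_abs (a + b) \<le> max (eta_abs a) (eta_abs b)"
    and eta_abs_uniformizer: "eta_abs (theta \<iota> - \<eta>) = 1 / real CARD('k)"
    and K_rho_bar_alg_closed:
      "\<lbrakk>\<forall>i. coeff p i \<in> K_rho_bar \<iota>; degree p > 0\<rbrakk> \<Longrightarrow> \<exists>x \<in> K_rho_bar \<iota>. poly p x = 0"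
    and K_rho_bar_dense: "closure (K_rho_bar \<iota>) = UNIV"
    and sigma_bij: "bij_betw \<sigma> (field_H \<iota> \<eta>) (field_H \<iota> \<eta>)"
    and sigma_add: "\<lbrakk>a \<in> field_H \<iota> \<eta>; b \<in> field_H \<iota> \<eta>\<rbrakk> \<Longrightarrow> \<sigma> (a + b) = \<sigma> a + \<sigma> b"
    and sigma_mult: "\<lbrakk>a \<in> field_H \<iota> \<eta>; b \<in> field_H \<iota> \<eta>\<rbrakk> \<Longrightarrow> \<sigma> (a * b) = \<sigma> a * \<sigma> b"
    and sigma_fixes_K: "\<sigma> (\<iota> x) = \<iota> x"
    and sigma_eta: "\<sigma> \<eta> = \<eta> ^ CARD('k)"

definition shtuka_f :: "('k::field poly fract \<Rightarrow> 'c::field) \<Rightarrow> 'c \<Rightarrow> 'c poly fract" where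
  "shtuka_f \<iota> \<eta> = Fract 1 [:- \<eta>, 1:] - to_fract [:1 / (theta \<iota> - \<eta>):]"

definition s_basis ::
    "('k::{finite, field} poly fract \<Rightarrow> 'c::field) \<Rightarrow> 'c \<Rightarrow> nat \<Rightarrow> 'c poly fract" where
  "s_basis \<iota> \<eta> i = (\<Prod>k<i. twist CARD('k) k (shtuka_f \<iota> \<eta>))"

text \<open>
  An element \<open>\<Sum>i. c\<^sub>i \<tau>\<^sup>i\<close> of \<open>\<complex>\<^sub>\<infinity>{\<tau>}\<close> is stored as the polynomial with coefficients \<open>c\<^sub>i\<close>; only
  the additive structure of \<open>'c poly\<close> is meaningful for it. It acts on \<open>\<complex>\<^sub>\<infinity>\<close> by \<open>tau_apply\<close>.
\<close>

definition drinfeld_Psi ::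
    "('k::{finite, field} poly fract \<Rightarrow> 'c::field) \<Rightarrow> 'c \<Rightarrow> 'k poly fract \<Rightarrow> 'c poly" where
  "drinfeld_Psi \<iota> \<eta> a =
     (THE c. base_change \<iota> a = (\<Sum>i\<le>degree c. to_fract [:coeff c i:] * s_basis \<iota> \<eta> i))"

definition drinfeld_Psi_conj ::
    "('k::{finite, field} poly fract \<Rightarrow> 'c::field) \<Rightarrow> 'c \<Rightarrow> ('c \<Rightarrow> 'c) \<Rightarrow> nat \<Rightarrow>
       'k poly fract \<Rightarrow> 'c poly" where
  "drinfeld_Psi_conj \<iota> \<eta> \<sigma> k a = map_poly (\<sigma> ^^ k) (drinfeld_Psi \<iota> \<eta> a)"

definition tau_apply :: "nat \<Rightarrow> 'c::field poly \<Rightarrow> 'c \<Rightarrow> 'c" where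
  "tau_apply q c z = (\<Sum>i\<le>degree c. coeff c i * z ^ (q ^ i))"

definition entire :: "('c::{field, metric_space} \<Rightarrow> 'c) \<Rightarrow> bool" where
  "entire e \<longleftrightarrow> (\<exists>a. \<forall>z. (\<lambda>n. a n * z ^ n) sums e z)"

definition is_drinfeld_exp ::
    "('k::{finite, field} poly fract \<Rightarrow> 'c::{field, metric_space}) \<Rightarrow> 'k poly \<Rightarrow> 'c \<Rightarrow>
       ('c \<Rightarrow> 'c) \<Rightarrow> nat \<Rightarrow> ('c \<Rightarrow> 'c) \<Rightarrow> bool" where
  "is_drinfeld_exp \<iota> \<rho> \<eta> \<sigma> k e \<longleftrightarrow>
     entire e \<and>
     (\<forall>x y. e (x + y) = e x + e y) \<and>
     (\<forall>c x. e (const_emb \<iota> c * x) = const_emb \<iota> c * e x) \<and>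
     ((\<lambda>z. (e z - e 0) / z) \<longlongrightarrow> 1) (at 0) \<and>
     (\<forall>a \<in> ring_A \<rho>. \<forall>\<xi>.
        tau_apply CARD('k) (drinfeld_Psi_conj \<iota> \<eta> \<sigma> k a) (e \<xi>) = e (\<iota> a * \<xi>))"

definition drinfeld_exp ::
    "('k::{finite, field} poly fract \<Rightarrow> 'c::{field, metric_space}) \<Rightarrow> 'k poly \<Rightarrow> 'c \<Rightarrow>
       ('c \<Rightarrow> 'c) \<Rightarrow> nat \<Rightarrow> 'c \<Rightarrow> 'c" where
  "drinfeld_exp \<iota> \<rho> \<eta> \<sigma> k = (THE e. is_drinfeld_exp \<iota> \<rho> \<eta> \<sigma> k e)"

definition ker_exp ::
    "('k::{finite, field} poly fract \<Rightarrow> 'c::{field, metric_space}) \<Rightarrow> 'k poly \<Rightarrow> 'c \<Rightarrow>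
       ('c \<Rightarrow> 'c) \<Rightarrow> nat \<Rightarrow> 'c set" where
  "ker_exp \<iota> \<rho> \<eta> \<sigma> k = {\<xi>. drinfeld_exp \<iota> \<rho> \<eta> \<sigma> k \<xi> = 0}"

text \<open>\<open>Theta_conj \<iota> \<eta> \<sigma> k\<close> is \<open>\<Theta>\<close> to the power \<open>\<sigma>\<^sup>k\<close> in the exponent notation for the group
  ring.\<close>

definition Theta_conj ::
    "('k::field poly fract \<Rightarrow> 'c::field) \<Rightarrow> 'c \<Rightarrow> ('c \<Rightarrow> 'c) \<Rightarrow> nat \<Rightarrow> 'c" where
  "Theta_conj \<iota> \<eta> \<sigma> k = (\<sigma> ^^ k) (1 / (theta \<iota> - \<eta>))"

definition period_factor ::
    "('k::{finite, field} poly fract \<Rightarrow> 'c::field) \<Rightarrow> 'c \<Rightarrow> ('c \<Rightarrow> 'c) \<Rightarrow> nat \<Rightarrow> 'c" where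
  "period_factor \<iota> \<eta> \<sigma> k =
     (let u = Theta_conj \<iota> \<eta> \<sigma> 0 ^ (CARD('k) ^ k) in u / (u - Theta_conj \<iota> \<eta> \<sigma> k))"

text \<open>The parameter \<open>w\<close> stands for the chosen \<open>(q - 1)\<close>-th root of \<open>- \<sigma>\<^sup>2(\<Theta>)\<close>.\<close>

definition period_pi ::
    "('k::{finite, field} poly fract \<Rightarrow> 'c::{field, t2_space}) \<Rightarrow> 'c \<Rightarrow> ('c \<Rightarrow> 'c) \<Rightarrow> 'c \<Rightarrow> 'c" where
  "period_pi \<iota> \<eta> \<sigma> w =
     w * Theta_conj \<iota> \<eta> \<sigma> 1 * (\<Prod>k. period_factor \<iota> \<eta> \<sigma> (Suc k))"

end

theory Submission
  imports Defs
begin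

text \<open>
  Write \<open>\<eta>\<^sub>i = \<eta> ^ q ^ i\<close> and \<open>x\<^sub>n = \<theta> ^ q ^ n\<close>. Evaluating the expansion \<open>a = \<Sum> c\<^sub>i s\<^sub>i\<close> at \<open>t = x\<^sub>n\<close>
  shows that the exponential is \<open>\<Sum> z ^ q ^ n / d\<^sub>n\<close> with \<open>d\<^sub>n = s\<^sub>n(x\<^sub>n)\<close> (after applying \<open>\<sigma> ^ k\<close>).
  The function \<open>\<omega> = w \<Prod>\<^sub>i\<^sub>\<ge>\<^sub>k (t - \<eta>\<^sub>i) / \<Prod>\<^sub>i\<^sub>\<ge>\<^sub>0 (t - x\<^sub>i)\<close>, \<open>w ^ (q - 1) = - \<sigma>\<^sup>k(\<Theta>)\<close>, satisfies
  \<open>\<omega>\<^sup>(\<^sup>1\<^sup>) = f \<omega>\<close>, so its residue at \<open>x\<^sub>n\<close> is \<open>\<lambda> ^ q ^ n / d\<^sub>n\<close>, where the residue \<open>\<lambda>\<close> at \<open>\<theta>\<close> is the claimed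
  period. As \<open>\<omega>\<close> vanishes to order \<open>k\<close> at infinity, the residues of \<open>t ^ e \<omega>\<close> sum to \<open>0\<close> for
  \<open>e \<le> k - 2\<close>, which says \<open>exp(\<lambda> \<theta> ^ e) = 0\<close>. By the module structure the claimed lattice lies in the
  kernel, and Strassmann's bound on the number of zeros in discs shows that there are no other zeros.
\<close>

subsection \<open>Finite fields, Lagrange interpolation and ultrametric analysis\<close>

text \<open>The equation for \<open>\<omega>\<close> fixes every constant. After
  \<open>\<sigma> ^ k\<close> the shtuka function is
  \<open>(\<theta> - t) / ((t - eta_k) (\<theta> - eta_k))\<close>, while twisting
  \<open>\<omega>\<close> multiplies it by \<open>w ^ (q - 1) (t - \<theta>) / (t - eta_k)\<close>;
  this forces \<open>w ^ (q - 1) = - 1 / (\<theta> - eta_k)\<close>. The residue at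
  \<open>\<theta>\<close> is then \<open>w\<close> divided by the factors
  \<open>\<theta> - eta_i\<close> with \<open>0 < i < k\<close>, times the product of
  \<open>(\<theta> - eta_i) / (\<theta> - x_i)\<close> over \<open>i > 0\<close>. The function
  \<open>\<omega>\<close> itself is never constructed. Its truncations have finitely many simple
  poles, so their residue sums are top coefficients of Lagrange interpolants, and only these sums
  pass to the limit. The same interpolation weights give Strassmann's bound. The count is exact on
  the closed disc of radius \<open>|\<lambda>| q ^ m\<close>: there are
  \<open>q ^ (m N + j + 1)\<close> numerators of degree at most \<open>m N + j\<close>, and this
  number is also the last index at which a term of the exponential can be maximal. One theorem with
  \<open>k = j + 2\<close> covers both parts, since dividing \<open>w\<close> by the extra root
  moves the condition from \<open>\<sigma>^2\<close> to \<open>\<sigma>^(j+2)\<close>.\<close>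

lemma finite_field_power_card:
  fixes c :: "'k::{finite, field}"
  shows "c ^ CARD('k) = c"
proof (cases "c = 0")
  case False
  let ?U = "UNIV - {0::'k}"
  \<comment> \<open>Multiplication by \<open>c\<close> permutes the nonzero elements, so cancelling
    their product leaves \<open>c ^ (q - 1) = 1\<close>.\<close>
  have "(\<Prod>x\<in>?U. c * x) = \<Prod>?U"
    by (rule prod.reindex_bij_witness[of _ "\<lambda>x. x / c" "\<lambda>x. c * x"]) (use False in auto)
  then have "c ^ card ?U * \<Prod>?U = \<Prod>?U"
    by (simp add: prod.distrib)
  moreover have "\<Prod>?U \<noteq> 0"
    by simp
  ultimately have "c ^ card ?U = 1"
    by simp
  moreover have "CARD('k) = Suc (card ?U)"
    by (simp add: card_Diff_singleton card_gt_0_iff)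
  ultimately show ?thesis
    by (metis power_Suc mult.right_neutral)
qed (simp add: card_gt_0_iff)

text \<open>The polynomial \<open>(1 + X) ^ q - X ^ q - 1\<close> has degree below \<open>q\<close>
  but vanishes at all \<open>q\<close> field elements, so all its coefficients are zero. This makes
  the \<open>q\<close>-th power map additive without writing \<open>q\<close> as a power of the
  characteristic.\<close>

lemma of_nat_choose_card_eq_0:
  assumes "0 < i" "i < CARD('k::{finite, field})"
  shows "of_nat (CARD('k) choose i) = (0::'k)"
proof -
  let ?q = "CARD('k)"
  define p :: "'k poly" where "p = [:1, 1:] ^ ?q - monom 1 ?q - 1"
  have co: "coeff p j = of_nat (?q choose j) - (if j = ?q then 1 else 0) - (if j = 0 then 1 else 0)" for j
    by (cases "j \<le> ?q") (simp_all add: p_def coeff_linear_poly_power binomial_eq_0 coeff_eq_0 degree_linear_power)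
  have "degree p < ?q"
  proof -
    have "degree p \<le> ?q - 1"
      by (rule degree_le) (use co in \<open>auto simp: binomial_eq_0 card_gt_0_iff\<close>)
    then show ?thesis
      using zero_less_card_finite[where 'a = 'k] by linarith
  qed
  moreover have "poly p x = 0" for x
    using finite_field_power_card[of x] finite_field_power_card[of "1 + x"]
    by (simp add: p_def poly_monom)
  then have "card {x. poly p x = 0} = ?q"
    by simp
  ultimately have "p = 0"
    using card_poly_roots_bound[of p] by force
  then show ?thesis
    using co[of i] assms by simp
qed

text \<open>Compares top coefficients in the Lagrange interpolation formula for \<open>Q\<close>.
  Read as a statement about \<open>Q\<close> divided by the product of all \<open>t - u\<close>, it
  is the residue theorem on the projective line: the right-hand side is the contribution of
  infinity.\<close>

lemma sum_lagrange_eq_coeff: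
  fixes Q :: "'a::field poly"
  assumes "finite Z" "degree Q < card Z"
  shows "(\<Sum>v\<in>Z. poly Q v / (\<Prod>u\<in>Z - {v}. v - u)) = coeff Q (card Z - 1)"
proof -
  define B where "B v = (\<Prod>u\<in>Z - {v}. [:- u, 1:])" for v
  define L where "L = (\<Sum>v\<in>Z. smult (poly Q v / (\<Prod>u\<in>Z - {v}. v - u)) (B v))"
  have degB: "degree (B v) = card Z - 1" if "v \<in> Z" for v
    using that assms(1) by (simp add: B_def degree_prod_eq_sum_degree)
  have "lead_coeff (B v) = 1" for v
    by (simp add: B_def lead_coeff_prod)
  then have topB: "coeff (B v) (card Z - 1) = 1" if "v \<in> Z" for v
    using degB[OF that] by metis
  have polyB: "poly (B v) x = (if x = v then (\<Prod>u\<in>Z - {v}. v - u) else 0)" if "x \<in> Z" for x v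
    using that assms(1) by (auto simp: B_def poly_prod)
  have "degree L \<le> card Z - 1"
    unfolding L_def by (rule degree_sum_le) (use assms degB in \<open>auto intro: order.trans[OF degree_smult_le]\<close>)
  then have "degree L < card Z"
    using assms by linarith
  moreover have "poly L x = poly Q x" if "x \<in> Z" for x
  proof -
    have "poly L x = (\<Sum>v\<in>Z. if x = v then poly Q x else 0)"
      unfolding L_def poly_sum poly_smult polyB[OF that]
      by (rule sum.cong) (use assms in auto)
    then show ?thesis
      using that assms by simp
  qed
  ultimately have "L = Q"
    using assms by (intro poly_eqI_degree[of Z]) auto
  then have "coeff Q (card Z - 1) = coeff L (card Z - 1)"
    by simp
  also have "\<dots> = (\<Sum>v\<in>Z. poly Q v / (\<Prod>u\<in>Z - {v}. v - u))"
    unfolding L_def coeff_sum by (rule sum.cong) (use topB in auto)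
  finally show ?thesis ..
qed

text \<open>These are the complete homogeneous symmetric polynomials, in degree \<open>n - (card Z - 1)\<close>.\<close>

definition lagrange_power_sum :: "'a::field set \<Rightarrow> nat \<Rightarrow> 'a" where
  "lagrange_power_sum Z n = (\<Sum>v\<in>Z. v ^ n / (\<Prod>u\<in>Z - {v}. v - u))"

lemma lagrange_power_sum_small:
  assumes "finite Z" "n < card Z"
  shows "lagrange_power_sum Z n = (if n = card Z - 1 then 1 else 0)"
  using sum_lagrange_eq_coeff[of Z "monom 1 n"] assms
  by (auto simp: lagrange_power_sum_def poly_monom degree_monom_eq)

text \<open>Subtracting \<open>v\<close> times the lower sum puts a factor \<open>u - v\<close> into
  each numerator; it kills the term at \<open>v\<close> and cancels against the denominators of the
  others. The recursion allows estimates by induction on the set of nodes.\<close>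

lemma lagrange_power_sum_insert_Suc:
  assumes "finite Z" "v \<notin> Z"
  shows "lagrange_power_sum (insert v Z) (Suc n) =
    v * lagrange_power_sum (insert v Z) n + lagrange_power_sum Z n"
proof -
  let ?P = "\<lambda>u. \<Prod>x\<in>insert v Z - {u}. u - x"
  have "lagrange_power_sum (insert v Z) (Suc n) - v * lagrange_power_sum (insert v Z) n =
      (\<Sum>u\<in>insert v Z. u ^ n * (u - v) / ?P u)"
    by (simp add: lagrange_power_sum_def sum_distrib_left flip: sum_subtractf)
       (rule sum.cong, auto simp: field_simps diff_divide_distrib)
  also have "\<dots> = (\<Sum>u\<in>Z. u ^ n * (u - v) / ?P u)"
    using assms by simp
  also have "\<dots> = lagrange_power_sum Z n"
    unfolding lagrange_power_sum_def
  proof (rule sum.cong)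
    fix u assume u: "u \<in> Z"
    then have "insert v Z - {u} = insert v (Z - {u})"
      using assms by auto
    then have "?P u = (u - v) * (\<Prod>x\<in>Z - {u}. u - x)"
      using assms by simp
    moreover have "u \<noteq> v"
      using u assms by auto
    ultimately show "u ^ n * (u - v) / ?P u = u ^ n / (\<Prod>x\<in>Z - {u}. u - x)"
      by simp
  qed simp
  finally show ?thesis
    by (simp add: algebra_simps)
qed

text \<open>The sort of \<open>'c\<close> says nothing about how the metric interacts with the field
  operations. That link is \<open>dist_av\<close>, and all limit laws below are derived from it
  together with the ultrametric inequality.\<close>

locale ultrametric_field =
  fixes av :: "'c::{field, complete_space} \<Rightarrow> real"
  assumes dist_av: "dist x y = av (x - y)"
    and av_mult: "av (x * y) = av x * av y"
    and av_add_le: "av (x + y) \<le> max (av x) (av y)"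
begin

lemma av_0 [simp]: "av 0 = 0"
  using dist_av[of 0 0] by simp

lemma av_nonneg [simp]: "av x \<ge> 0"
  using dist_av[of x 0] zero_le_dist[of x 0] by simp

lemma av_eq_0_iff [simp]: "av x = 0 \<longleftrightarrow> x = 0"
  using dist_av[of x 0] dist_eq_0_iff[of x 0] by simp

lemma av_pos_iff [simp]: "av x > 0 \<longleftrightarrow> x \<noteq> 0"
  using av_nonneg[of x] av_eq_0_iff[of x] by linarith

lemma av_1 [simp]: "av 1 = 1"
  using av_mult[of 1 1] by simp

lemma av_minus [simp]: "av (- x) = av x"
  using dist_av[of 0 x] dist_av[of x 0] dist_commute[of x 0] by simp

lemma av_diff_le: "av (x - y) \<le> max (av x) (av y)"
  using av_add_le[of x "- y"] by simp

lemma av_minus_commute: "av (x - y) = av (y - x)"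
  using av_minus[of "x - y"] by simp

lemma av_power: "av (x ^ n) = av x ^ n"
  by (induction n) (auto simp: av_mult)

lemma av_divide: "av (x / y) = av x / av y"
  by (cases "y = 0") (use av_mult[of "x / y" y] in \<open>auto simp: field_simps\<close>)

lemma av_prod: "av (\<Prod>i\<in>A. f i) = (\<Prod>i\<in>A. av (f i))"
  by (induction A rule: infinite_finite_induct) (auto simp: av_mult)

lemma av_sum_le:
  assumes "B \<ge> 0" "\<And>i. i \<in> A \<Longrightarrow> av (f i) \<le> B"
  shows "av (\<Sum>i\<in>A. f i) \<le> B"
  using assms(2)
proof (induction A rule: infinite_finite_induct)
  case (insert x F)
  then show ?case
    using av_add_le[of "f x" "sum f F"] by (fastforce simp: le_max_iff_disj)
qed (use assms(1) in auto)

lemma av_sum_less: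
  assumes "B > 0" "\<And>i. i \<in> A \<Longrightarrow> av (f i) < B"
  shows "av (\<Sum>i\<in>A. f i) < B"
  using assms(2)
proof (induction A rule: infinite_finite_induct)
  case (insert x F)
  then show ?case
    using av_add_le[of "f x" "sum f F"] by (fastforce simp: le_max_iff_disj)
qed (use assms(1) in auto)

lemma av_add_eq_right:
  assumes "av x < av y"
  shows "av (x + y) = av y"
proof -
  have "av y \<le> max (av (x + y)) (av x)"
    using av_diff_le[of "x + y" x] by simp
  then show ?thesis
    using av_add_le[of x y] assms by (auto simp: max_def split: if_splits)
qed

lemma av_diff_eq_right: "av x < av y \<Longrightarrow> av (x - y) = av y"
  using av_add_eq_right[of x "- y"] by simp

lemma LIMSEQ_av: "X \<longlonglongrightarrow> L \<longleftrightarrow> (\<lambda>n. av (X n - L)) \<longlonglongrightarrow> 0"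
  by (subst tendsto_dist_iff) (simp add: dist_av)

lemma LIMSEQ_avI:
  assumes "f \<longlonglongrightarrow> 0" "\<And>n. av (X n - L) \<le> f n"
  shows "X \<longlonglongrightarrow> L"
  unfolding LIMSEQ_av by (rule tendsto_sandwich[of "\<lambda>_. 0" _ _ f]) (use assms in auto)

lemma LIMSEQ_add:
  fixes X Y :: "nat \<Rightarrow> 'c"
  assumes "X \<longlonglongrightarrow> a" "Y \<longlonglongrightarrow> b"
  shows "(\<lambda>n. X n + Y n) \<longlonglongrightarrow> a + b"
proof (rule LIMSEQ_avI)
  show "(\<lambda>n. max (av (X n - a)) (av (Y n - b))) \<longlonglongrightarrow> 0"
    using tendsto_max[OF assms[unfolded LIMSEQ_av]] by simp
  show "av (X n + Y n - (a + b)) \<le> max (av (X n - a)) (av (Y n - b))" for n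
    using av_add_le[of "X n - a" "Y n - b"] by (simp add: algebra_simps)
qed

lemma LIMSEQ_cmult:
  fixes X :: "nat \<Rightarrow> 'c"
  assumes "X \<longlonglongrightarrow> a"
  shows "(\<lambda>n. c * X n) \<longlonglongrightarrow> c * a"
  using tendsto_mult_left[OF assms[unfolded LIMSEQ_av], of "av c"]
  by (simp add: LIMSEQ_av av_mult flip: right_diff_distrib)

lemma LIMSEQ_diff:
  fixes X Y :: "nat \<Rightarrow> 'c"
  assumes "X \<longlonglongrightarrow> a" "Y \<longlonglongrightarrow> b"
  shows "(\<lambda>n. X n - Y n) \<longlonglongrightarrow> a - b"
  using LIMSEQ_add[OF assms(1) LIMSEQ_cmult[OF assms(2), of "- 1"]] by simp

lemma sums_av_add:
  fixes f g :: "nat \<Rightarrow> 'c"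
  shows "f sums a \<Longrightarrow> g sums b \<Longrightarrow> (\<lambda>n. f n + g n) sums (a + b)"
  unfolding sums_def sum.distrib by (rule LIMSEQ_add)

lemma sums_av_diff:
  fixes f g :: "nat \<Rightarrow> 'c"
  shows "f sums a \<Longrightarrow> g sums b \<Longrightarrow> (\<lambda>n. f n - g n) sums (a - b)"
  unfolding sums_def sum_subtractf by (rule LIMSEQ_diff)

lemma sums_av_cmult:
  fixes f :: "nat \<Rightarrow> 'c"
  shows "f sums a \<Longrightarrow> (\<lambda>n. c * f n) sums (c * a)"
  unfolding sums_def sum_distrib_left[symmetric] by (rule LIMSEQ_cmult)

lemma sums_av_sum:
  fixes f :: "'i \<Rightarrow> nat \<Rightarrow> 'c"
  shows "(\<And>i. i \<in> A \<Longrightarrow> f i sums a i) \<Longrightarrow> (\<lambda>n. \<Sum>i\<in>A. f i n) sums (\<Sum>i\<in>A. a i)"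
  by (induction A rule: infinite_finite_induct) (auto intro: sums_av_add)

lemma av_LIMSEQ_le:
  fixes X :: "nat \<Rightarrow> 'c"
  assumes "X \<longlonglongrightarrow> L" "\<And>n. n \<ge> n0 \<Longrightarrow> av (X n) \<le> B"
  shows "av L \<le> B"
proof (rule field_le_epsilon)
  fix e :: real assume "e > 0"
  then have "eventually (\<lambda>n. av (X n - L) < e) sequentially"
    using assms(1) unfolding LIMSEQ_av by (auto elim!: order_tendstoD)
  then obtain n1 where n1: "\<And>n. n \<ge> n1 \<Longrightarrow> av (X n - L) < e"
    by (auto simp: eventually_sequentially)
  define n where "n = max n0 n1"
  have "av L \<le> max (av (X n)) (av (X n - L))"
    using av_diff_le[of "X n" "X n - L"] by simp
  moreover have "av (X n) \<le> B" "av (X n - L) < e" "0 \<le> av (X n)"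
    using assms(2) n1 by (auto simp: n_def)
  ultimately show "av L \<le> B + e"
    using \<open>e > 0\<close> by linarith
qed

text \<open>As soon as a term is closer to the limit than \<open>B\<close>, the isosceles principle
  gives both the same absolute value.\<close>

lemma av_LIMSEQ_eq:
  fixes X :: "nat \<Rightarrow> 'c"
  assumes "X \<longlonglongrightarrow> L" "\<And>n. av (X n) = B" "B > 0"
  shows "av L = B"
proof -
  have "eventually (\<lambda>n. av (X n - L) < B) sequentially"
    using assms(1,3) unfolding LIMSEQ_av by (auto elim!: order_tendstoD)
  then obtain n where n: "av (X n - L) < B"
    by (auto simp: eventually_sequentially)
  then have "av ((X n - L) - X n) = av (X n)"
    by (intro av_diff_eq_right) (simp add: assms)
  then show ?thesis
    by (simp add: assms)
qed

text \<open>By the ultrametric inequality the distance of two terms is at most the largest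
  consecutive distance between them, so it is enough that the consecutive distances tend to
  0.\<close>

lemma convergent_if_av_diff:
  fixes X :: "nat \<Rightarrow> 'c"
  assumes "(\<lambda>n. av (X (Suc n) - X n)) \<longlonglongrightarrow> 0"
  shows "convergent X"
proof -
  have "Cauchy X"
  proof (rule metric_CauchyI)
    fix e :: real assume e: "e > 0"
    then have "eventually (\<lambda>n. av (X (Suc n) - X n) < e) sequentially"
      using assms by (auto elim!: order_tendstoD)
    then obtain n0 where n0: "\<And>n. n \<ge> n0 \<Longrightarrow> av (X (Suc n) - X n) < e"
      by (auto simp: eventually_sequentially)
    have *: "av (X (n0 + i) - X n0) < e" for i
    proof (induction i)
      case (Suc i)
      have "av (X (n0 + Suc i) - X n0) \<le> max (av (X (Suc (n0 + i)) - X (n0 + i))) (av (X (n0 + i) - X n0))"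
        using av_add_le[of "X (Suc (n0 + i)) - X (n0 + i)" "X (n0 + i) - X n0"] by simp
      then show ?case
        using Suc n0[of "n0 + i"] by simp
    qed (use e in auto)
    have "dist (X m) (X n) < e" if "m \<ge> n0" "n \<ge> n0" for m n
    proof -
      have "av (X m - X n) \<le> max (av (X m - X n0)) (av (X n - X n0))"
        using av_diff_le[of "X m - X n0" "X n - X n0"] by simp
      then show ?thesis
        using *[of "m - n0"] *[of "n - n0"] that by (simp add: dist_av)
    qed
    then show "\<exists>M. \<forall>m\<ge>M. \<forall>n\<ge>M. dist (X m) (X n) < e"
      by blast
  qed
  then show ?thesis
    by (simp add: Cauchy_convergent_iff)
qed

lemma summable_if_av:
  assumes "(\<lambda>n. av (f n)) \<longlonglongrightarrow> 0"
  shows "summable f"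
  unfolding summable_iff_convergent by (rule convergent_if_av_diff) (use assms in simp)

lemma sums_av_terms:
  assumes "f sums s"
  shows "(\<lambda>n. av (f n)) \<longlonglongrightarrow> 0"
proof -
  have "(\<lambda>n. \<Sum>i<n. f i) \<longlonglongrightarrow> s"
    using assms by (simp add: sums_def)
  from LIMSEQ_diff[OF LIMSEQ_Suc[OF this] this] show ?thesis
    by (simp add: LIMSEQ_av)
qed

text \<open>Convergence at \<open>z = 1\<close> bounds the coefficients, and the ultrametric
  inequality carries this bound over to the whole tail. It serves both for derivatives at 0 and for
  comparing leading terms in functional equations.\<close>

lemma power_series_leading_term:
  assumes f: "\<And>z. (\<lambda>n. b n * z ^ n) sums f z" and b: "\<And>n. n < m \<Longrightarrow> b n = 0"
  obtains B where "B \<ge> 0" "\<And>z. av z \<le> 1 \<Longrightarrow> av (f z - b m * z ^ m) \<le> B * av z ^ Suc m"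
proof -
  have "(\<lambda>n. av (b n)) \<longlonglongrightarrow> 0"
    using sums_av_terms[OF f[of 1]] by simp
  then have "Bseq (\<lambda>n. av (b n))"
    by (auto intro!: convergent_imp_Bseq convergentI)
  then obtain B where B: "B > 0" "\<And>n. av (b n) \<le> B"
    by (auto simp: Bseq_def)
  have "av (f z - b m * z ^ m) \<le> B * av z ^ Suc m" if z: "av z \<le> 1" for z
  proof (rule av_LIMSEQ_le)
    show "(\<lambda>N. (\<Sum>n<N. b n * z ^ n) - b m * z ^ m) \<longlonglongrightarrow> f z - b m * z ^ m"
      using f[of z] by (intro LIMSEQ_diff) (auto simp: sums_def)
    fix N assume N: "N \<ge> Suc m"
    have "(\<Sum>n<N. b n * z ^ n) - b m * z ^ m = (\<Sum>n\<in>{..<N} - {m}. b n * z ^ n)"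
      using N by (simp add: sum_diff1)
    also have "av \<dots> \<le> B * av z ^ Suc m"
    proof (rule av_sum_le)
      fix n assume n: "n \<in> {..<N} - {m}"
      show "av (b n * z ^ n) \<le> B * av z ^ Suc m"
      proof (cases "n < m")
        case False
        with n have "av z ^ n \<le> av z ^ Suc m"
          using z by (intro power_decreasing) auto
        then show ?thesis
          using B by (auto simp: av_mult av_power simp del: power_Suc intro!: mult_mono)
      qed (use b B in auto)
    qed (use B in auto)
    finally show "av ((\<Sum>n<N. b n * z ^ n) - b m * z ^ m) \<le> B * av z ^ Suc m" .
  qed
  then show ?thesis
    using B(1) that[of B] by simp
qed

text \<open>A homogeneous polynomial of degree \<open>n - (card Z - 1)\<close> with integer
  coefficients is bounded by the corresponding power of \<open>r\<close>. The exponent is moved to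
  the left so that \<open>n < card Z - 1\<close> causes no truncated subtraction.\<close>

lemma av_lagrange_power_sum_le:
  assumes "finite Z" "Z \<noteq> {}" "\<And>v. v \<in> Z \<Longrightarrow> av v \<le> r"
  shows "av (lagrange_power_sum Z n) * r ^ (card Z - 1) \<le> r ^ n"
  using assms
proof (induction Z arbitrary: n rule: finite_ne_induct)
  case (singleton v)
  then show ?case
    by (simp add: lagrange_power_sum_def av_power power_mono)
next
  case (insert v Z)
  have r: "r \<ge> 0"
    using insert.prems[of v] av_nonneg[of v] by (auto intro: order.trans[OF av_nonneg])
  obtain d where d: "card Z = Suc d"
    using insert.hyps by (cases "card Z") auto
  show ?case
  proof (induction n)
    case 0
    have "lagrange_power_sum (insert v Z) 0 = 0"
      using insert.hyps d by (subst lagrange_power_sum_small) auto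
    then show ?case
      by simp
  next
    case (Suc n)
    let ?H = "av (lagrange_power_sum (insert v Z) n)" and ?G = "av (lagrange_power_sum Z n)"
    have "av (lagrange_power_sum (insert v Z) (Suc n)) \<le> max (av v * ?H) ?G"
      using av_add_le[of "v * lagrange_power_sum (insert v Z) n" "lagrange_power_sum Z n"] insert.hyps
      by (simp add: lagrange_power_sum_insert_Suc av_mult)
    then have "av (lagrange_power_sum (insert v Z) (Suc n)) * r ^ Suc d \<le> max (av v * ?H) ?G * r ^ Suc d"
      using r by (intro mult_right_mono) auto
    also have "\<dots> \<le> r ^ Suc n"
    proof -
      have "av v * (?H * r ^ Suc d) \<le> r * r ^ n"
        using Suc.IH insert.prems[of v] insert.hyps d r by (intro mult_mono) auto
      moreover have "r * (?G * r ^ d) \<le> r * r ^ n"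
        using insert.IH[of n] insert.prems d r by (intro mult_left_mono) auto
      ultimately show ?thesis
        by (auto simp: max_def algebra_simps)
    qed
    finally show ?case
      using insert.hyps d by simp
  qed
qed

text \<open>Strassmann's bound: summing the vanishing values against the Lagrange weights isolates the
  coefficient \<open>a j\<close> up to terms that are strictly smaller.\<close>

theorem card_zeros_le_dominant_index:
  assumes "finite Z" and zero: "\<And>z. z \<in> Z \<Longrightarrow> (\<lambda>n. a n * z ^ n) sums 0"
    and r: "\<And>z. z \<in> Z \<Longrightarrow> av z \<le> r" "r > 0"
    and dom: "\<And>n. n > j \<Longrightarrow> av (a n) * r ^ n < av (a j) * r ^ j"
  shows "card Z \<le> j"
proof (rule ccontr)
  assume "\<not> card Z \<le> j"
  then have "Suc j \<le> card Z"
    by simp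
  \<comment> \<open>With exactly \<open>j + 1\<close> nodes the weighted power sums vanish for
    exponents below \<open>j\<close> and equal 1 at \<open>j\<close>.\<close>
  then obtain Y where Y: "Y \<subseteq> Z" "card Y = Suc j" "finite Y"
    by (rule obtain_subset_with_card_n)
  then have "Y \<noteq> {}"
    by auto
  let ?h = "lagrange_power_sum Y"
  have pos: "av (a j) > 0"
    using dom[of "Suc j"] r(2) by (smt (verit) av_nonneg mult_nonneg_nonneg mult_eq_0_iff zero_le_power lessI)
  have h0: "?h n = (if n = j then 1 else 0)" if "n \<le> j" for n
    using lagrange_power_sum_small[of Y n] Y that by simp
  have "(\<lambda>n. \<Sum>v\<in>Y. (1 / (\<Prod>u\<in>Y - {v}. v - u)) * (a n * v ^ n)) sums
      (\<Sum>v\<in>Y. (1 / (\<Prod>u\<in>Y - {v}. v - u)) * 0)"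
    by (intro sums_av_sum sums_av_cmult zero) (use Y in auto)
  also have "(\<lambda>n. \<Sum>v\<in>Y. (1 / (\<Prod>u\<in>Y - {v}. v - u)) * (a n * v ^ n)) = (\<lambda>n. a n * ?h n)"
    by (simp add: fun_eq_iff lagrange_power_sum_def sum_distrib_left field_simps)
  finally have lim: "(\<lambda>N. \<Sum>n<N. a n * ?h n) \<longlonglongrightarrow> 0"
    by (simp add: sums_def)
  have small: "av (a n * ?h n) < av (a j)" if "n > j" for n
  proof -
    have "av (a n * ?h n) * r ^ j \<le> av (a n) * r ^ n"
      using av_lagrange_power_sum_le[of Y r n] Y r(1) \<open>Y \<noteq> {}\<close>
      by (auto simp: av_mult mult.assoc subset_iff intro!: mult_left_mono)
    also have "\<dots> < av (a j) * r ^ j"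
      using dom that by blast
    finally show ?thesis
      using r(2) by simp
  qed
  have big: "av (\<Sum>n<N. a n * ?h n) = av (a j)" if N: "N > j" for N
  proof -
    have "(\<Sum>n<N. a n * ?h n) = (\<Sum>n\<in>{..<N} - {j}. a n * ?h n) + a j"
      using N h0[of j] by (subst sum.remove[of _ j]) (auto simp: add.commute)
    moreover have "av (\<Sum>n\<in>{..<N} - {j}. a n * ?h n) < av (a j)"
    proof (rule av_sum_less)
      fix n assume "n \<in> {..<N} - {j}"
      then show "av (a n * ?h n) < av (a j)"
        using small[of n] h0[of n] pos by (cases "n < j") auto
    qed (rule pos)
    ultimately show ?thesis
      by (simp add: av_add_eq_right)
  qed
  have "eventually (\<lambda>N. av (\<Sum>n<N. a n * ?h n) < av (a j)) sequentially"
    using lim pos unfolding LIMSEQ_av by (auto elim!: order_tendstoD)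
  then obtain N0 where "\<And>N. N \<ge> N0 \<Longrightarrow> av (\<Sum>n<N. a n * ?h n) < av (a j)"
    by (auto simp: eventually_sequentially)
  from this[of "max N0 (Suc j)"] big[of "max N0 (Suc j)"] show False
    by simp
qed

end

subsection \<open>Fractional ideals of functions with poles at \<open>\<rho>\<close> and infinity\<close>

lemma extend_fract_Fract:
  assumes "\<And>x y. h (x * y) = h x * h y" "\<And>x. h x = 0 \<longleftrightarrow> x = 0" "b \<noteq> 0"
  shows "extend_fract h (Fract a b) = h a / h b"
  unfolding extend_fract_def
proof (rule the_equality)
  fix y assume "\<exists>a' b'. b' \<noteq> 0 \<and> Fract a b = Fract a' b' \<and> y = h a' / h b'"
  then obtain a' b' where *: "b' \<noteq> 0" "Fract a b = Fract a' b'" "y = h a' / h b'"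
    by blast
  then have "h a * h b' = h a' * h b"
    using assms(1,3) by (metis eq_fract(1))
  then show "y = h a / h b"
    using *(1,3) assms(2,3) by (simp add: frac_eq_eq)
qed (use assms(3) in auto)

lemma exists_monic_irreducible_dvd:
  fixes b :: "'k::field poly"
  assumes "degree b > 0"
  shows "\<exists>p. irreducible p \<and> lead_coeff p = 1 \<and> p dvd b"
  using assms
proof (induction "degree b" arbitrary: b rule: less_induct)
  case less
  show ?case
  proof (cases "irreducible b")
    case True
    let ?p = "smult (inverse (lead_coeff b)) b"
    have nz: "lead_coeff b \<noteq> 0"
      using less.prems by auto
    have "irreducible ([:inverse (lead_coeff b):] * b)"
      using True nz by (subst irreducible_mult_unit_left) (auto simp: is_unit_poly_iff dvd_field_iff)
    then have "irreducible ?p"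
      by simp
    moreover have "?p dvd b"
      using nz by (simp add: smult_dvd_iff)
    ultimately show ?thesis
      using nz by (intro exI[of _ ?p]) auto
  next
    case False
    have "b \<noteq> 0"
      using less.prems by auto
    then have "\<not> b dvd 1"
      using less.prems is_unit_iff_degree[of b] by simp
    have "\<exists>x y. b = x * y \<and> \<not> x dvd 1 \<and> \<not> y dvd 1"
    proof (rule ccontr)
      assume *: "\<not> ?thesis"
      have "irreducible b"
        by (rule irreducibleI) (use * \<open>b \<noteq> 0\<close> \<open>\<not> b dvd 1\<close> in blast)+
      with False show False
        by simp
    qed
    then obtain x y where xy: "b = x * y" "\<not> x dvd 1" "\<not> y dvd 1"
      by blast
    then have nz: "x \<noteq> 0" "y \<noteq> 0"
      using \<open>b \<noteq> 0\<close> by auto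
    with xy have "degree x > 0" "degree y > 0"
      by (metis is_unit_iff_degree neq0_conv)+
    with less.hyps[of x] xy nz show ?thesis
      by (auto simp: degree_mult_eq)
  qed
qed

lemma regular_at_infinity_Fract:
  assumes "b \<noteq> 0"
  shows "regular_at_infinity (Fract a b) \<longleftrightarrow> degree a \<le> degree b"
proof
  assume "regular_at_infinity (Fract a b)"
  then obtain a' b' where *: "b' \<noteq> 0" "degree a' \<le> degree b'" "a * b' = a' * b"
    using assms by (auto simp: regular_at_infinity_def eq_fract)
  show "degree a \<le> degree b"
  proof (cases "a = 0")
    case False
    then have "degree a + degree b' = degree a' + degree b"
      using * assms by (metis degree_mult_eq mult_eq_0_iff)
    then show ?thesis
      using * by simp
  qed auto
qed (use assms in \<open>auto simp: regular_at_infinity_def\<close>)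

text \<open>Induction on the degree of the denominator, removing one monic irreducible factor
  \<open>p\<close>. If \<open>p = \<rho>\<close>, it goes into the power of \<open>\<rho>\<close>;
  otherwise regularity at \<open>p\<close> forces \<open>p\<close> to divide the numerator too, and
  it cancels.\<close>

lemma regular_away_imp_power_denominator:
  fixes \<rho> :: "'k::field poly"
  assumes \<rho>: "irreducible \<rho>"
    and reg: "\<And>p. irreducible p \<Longrightarrow> lead_coeff p = 1 \<Longrightarrow> p \<noteq> \<rho> \<Longrightarrow> regular_at p x"
  shows "\<exists>a m. x = Fract a (\<rho> ^ m)"
proof -
  obtain a b where "x = Fract a b" "b \<noteq> 0"
    by (cases x) auto
  then show ?thesis
    using reg
  proof (induction "degree b" arbitrary: a b x rule: less_induct)
    case less
    have \<rho>0: "\<rho> \<noteq> 0"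
      using \<rho> by auto
    show ?case
    proof (cases "degree b = 0")
      case True
      then obtain c where c: "b = [:c:]" "c \<noteq> 0"
        using less.prems by (metis degree_eq_zeroE pCons_0_0)
      then have "x = Fract (smult (inverse c) a) (\<rho> ^ 0)"
        using less.prems by (simp add: eq_fract)
      then show ?thesis
        by blast
    next
      case False
      then obtain p where p: "irreducible p" "lead_coeff p = 1" "p dvd b"
        using exists_monic_irreducible_dvd by blast
      then obtain b' where b': "b = p * b'"
        by blast
      have nz: "p \<noteq> 0" "b' \<noteq> 0"
        using b' less.prems by auto
      have "\<not> p dvd 1"
        using p by (simp add: irreducible_def)
      then have "degree p > 0"
        using is_unit_iff_degree[OF nz(1)] by simp
      then have deg: "degree b' < degree b"
        using b' nz by (simp add: degree_mult_eq)
      show ?thesis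
      proof (cases "p = \<rho>")
        case True
        \<comment> \<open>This fraction is \<open>\<rho> x\<close>, which has the same regularity
          away from \<open>\<rho>\<close> and a smaller denominator.\<close>
        have "regular_at q (Fract a b')" if q: "irreducible q" "lead_coeff q = 1" "q \<noteq> \<rho>" for q
        proof -
          obtain c d where cd: "\<not> q dvd d" "x = Fract c d"
            using less.prems(3)[OF q] by (auto simp: regular_at_def)
          then have "d \<noteq> 0" by auto
          with cd less.prems b' nz True have "\<rho> * (a * d) = \<rho> * (c * \<rho> * b')"
            by (auto simp: eq_fract algebra_simps)
          then have "Fract a b' = Fract (c * \<rho>) d"
            using \<rho>0 nz \<open>d \<noteq> 0\<close> by (simp add: eq_fract)
          then show ?thesis
            using cd by (auto simp: regular_at_def)
        qed
        from less.hyps[OF deg refl nz(2) this] obtain a' m where "Fract a b' = Fract a' (\<rho> ^ m)"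
          by blast
        then have "a * \<rho> ^ m = a' * b'"
          using nz \<rho>0 by (simp add: eq_fract)
        then have "x = Fract a' (\<rho> ^ Suc m)"
          using less.prems b' nz \<rho>0 True by (simp add: eq_fract algebra_simps)
        then show ?thesis
          by blast
      next
        case False
        then obtain c d where cd: "\<not> p dvd d" "x = Fract c d"
          using less.prems(3)[OF p(1,2)] by (auto simp: regular_at_def)
        then have "d \<noteq> 0" by auto
        with cd less.prems b' have *: "a * d = p * (c * b')"
          by (auto simp: eq_fract algebra_simps)
        then have "p dvd a * d"
          by (metis dvd_triv_left)
        then have "p dvd a"
          using field_poly_irreducible_imp_prime[OF p(1)] cd by (simp add: prime_elem_dvd_mult_iff)
        then obtain a1 where "a = p * a1"
          by blast
        then have "x = Fract a1 b'"
          using less.prems b' nz by (simp add: eq_fract)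
        then show ?thesis
          using less.hyps[OF deg _ nz(2)] less.prems(3) by blast
      qed
    qed
  qed
qed

text \<open>The pole order of \<open>P / \<rho> ^ m\<close> at infinity is
  \<open>degree P - m N\<close>. So this is the space of functions with arbitrary poles at
  \<open>\<rho>\<close> and a pole of order at most \<open>j\<close> at infinity, a concrete form of
  the fractional ideal \<open>I_\<infinity> ^ (- j)\<close>. Negative \<open>j\<close> describes
  zeros at infinity, as for the powers of \<open>I_inf\<close>.\<close>

definition pole_space :: "'k::field poly \<Rightarrow> int \<Rightarrow> 'k poly fract set" where
  "pole_space \<rho> j = {Fract P (\<rho> ^ m) | P m. int (degree P) \<le> int (m * degree \<rho>) + j}"

lemma pole_spaceI: "int (degree P) \<le> int (m * degree \<rho>) + j \<Longrightarrow> Fract P (\<rho> ^ m) \<in> pole_space \<rho> j"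
  by (auto simp: pole_space_def)

lemma pole_space_mult:
  assumes "x \<in> pole_space \<rho> i" "y \<in> pole_space \<rho> j"
  shows "x * y \<in> pole_space \<rho> (i + j)"
proof -
  obtain P m Q n where *: "x = Fract P (\<rho> ^ m)" "y = Fract Q (\<rho> ^ n)"
    "int (degree P) \<le> int (m * degree \<rho>) + i" "int (degree Q) \<le> int (n * degree \<rho>) + j"
    using assms by (auto simp: pole_space_def)
  then have "x * y = Fract (P * Q) (\<rho> ^ (m + n))"
    by (simp add: power_add)
  moreover have "int (degree (P * Q)) \<le> int ((m + n) * degree \<rho>) + (i + j)"
    using * degree_mult_le[of P Q] by (simp add: algebra_simps)
  ultimately show ?thesis
    using pole_spaceI by metis
qed

lemma pole_space_add:
  assumes "\<rho> \<noteq> 0" "x \<in> pole_space \<rho> j" "y \<in> pole_space \<rho> j"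
  shows "x + y \<in> pole_space \<rho> j"
proof -
  obtain P m Q n where *: "x = Fract P (\<rho> ^ m)" "y = Fract Q (\<rho> ^ n)"
    "int (degree P) \<le> int (m * degree \<rho>) + j" "int (degree Q) \<le> int (n * degree \<rho>) + j"
    using assms by (auto simp: pole_space_def)
  then have "x + y = Fract (P * \<rho> ^ n + Q * \<rho> ^ m) (\<rho> ^ (m + n))"
    using assms by (simp add: power_add)
  moreover have "int (degree (P * \<rho> ^ n + Q * \<rho> ^ m)) \<le> int ((m + n) * degree \<rho>) + j"
  proof -
    have "degree (P * \<rho> ^ n) \<le> degree P + n * degree \<rho>"
      "degree (Q * \<rho> ^ m) \<le> degree Q + m * degree \<rho>"
      using degree_mult_le[of P "\<rho> ^ n"] degree_mult_le[of Q "\<rho> ^ m"] assms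
      by (auto simp: degree_power_eq)
    then have "int (degree (P * \<rho> ^ n)) \<le> int ((m + n) * degree \<rho>) + j"
      "int (degree (Q * \<rho> ^ m)) \<le> int ((m + n) * degree \<rho>) + j"
      using *(3,4) unfolding add_mult_distrib by linarith+
    then show ?thesis
      using degree_add_le_max[of "P * \<rho> ^ n" "Q * \<rho> ^ m"] by (auto simp: max_def split: if_splits)
  qed
  ultimately show ?thesis
    using pole_spaceI by metis
qed

text \<open>The convention \<open>degree 0 = 0\<close> makes this nontrivial for negative
  \<open>j\<close>: the numerator 0 needs a denominator with \<open>m N \<ge> - j\<close>, and
  \<open>m = |j|\<close> is large enough.\<close>

lemma zero_in_pole_space:
  assumes "degree \<rho> > 0"
  shows "0 \<in> pole_space \<rho> j"
proof -
  have "nat \<bar>j\<bar> * 1 \<le> nat \<bar>j\<bar> * degree \<rho>"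
    using assms by (intro mult_le_mono) auto
  then have "int (nat \<bar>j\<bar>) \<le> int (nat \<bar>j\<bar> * degree \<rho>)"
    by (simp only: of_nat_le_iff mult_1_right)
  then have "int (degree 0) \<le> int (nat \<bar>j\<bar> * degree \<rho>) + j"
    by simp
  from pole_spaceI[OF this] show ?thesis
    by (simp add: fract_collapse)
qed

lemma span_over_pole_space:
  assumes "degree \<rho> > 0" "R \<subseteq> pole_space \<rho> 0" "S \<subseteq> pole_space \<rho> j"
  shows "span_over R S \<subseteq> pole_space \<rho> j"
proof
  fix y assume "y \<in> span_over R S"
  then obtain F c where y: "y = (\<Sum>x\<in>F. c x * x)" "finite F" "F \<subseteq> S" "c ` F \<subseteq> R"
    by (auto simp: span_over_def)
  have "\<rho> \<noteq> 0"
    using assms by auto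
  have "c x * x \<in> pole_space \<rho> j" if "x \<in> F" for x
    using pole_space_mult[of "c x" \<rho> 0 x j] y that assms by auto
  with y(2) show "y \<in> pole_space \<rho> j"
    unfolding y(1)
    by (induction F rule: finite_induct)
       (auto intro!: zero_in_pole_space pole_space_add assms \<open>\<rho> \<noteq> 0\<close>)
qed

lemma scaled_in_span_over: "x \<in> S \<Longrightarrow> r \<in> R \<Longrightarrow> r * x \<in> span_over R S"
  unfolding span_over_def by (rule CollectI, rule exI[of _ "{x}"], rule exI[of _ "\<lambda>_. r"]) auto

lemma ring_A_eq_pole_space:
  fixes \<rho> :: "'k::field poly"
  assumes "irreducible \<rho>" "lead_coeff \<rho> = 1"
  shows "ring_A \<rho> = pole_space \<rho> 0"
proof
  have nz: "\<rho> \<noteq> 0"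
    using assms by auto
  show "ring_A \<rho> \<subseteq> pole_space \<rho> 0"
  proof
    fix x assume x: "x \<in> ring_A \<rho>"
    then obtain a m where a: "x = Fract a (\<rho> ^ m)"
      using regular_away_imp_power_denominator[OF assms(1), of x] by (auto simp: ring_A_def)
    then have "degree a \<le> degree (\<rho> ^ m)"
      using x nz by (simp add: ring_A_def regular_at_infinity_Fract)
    then have "int (degree a) \<le> int (m * degree \<rho>) + 0"
      using nz by (simp add: degree_power_eq flip: of_nat_mult)
    from pole_spaceI[OF this] show "x \<in> pole_space \<rho> 0"
      by (simp add: a)
  qed
  show "pole_space \<rho> 0 \<subseteq> ring_A \<rho>"
  proof
    fix x assume "x \<in> pole_space \<rho> 0"
    then obtain P m where P: "x = Fract P (\<rho> ^ m)" "degree P \<le> m * degree \<rho>"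
      unfolding pole_space_def add_0_right of_nat_le_iff by blast
    have "regular_at p x" if p: "irreducible p" "lead_coeff p = 1" "p \<noteq> \<rho>" for p
    proof -
      have "\<not> p dvd \<rho> ^ m"
      proof
        assume "p dvd \<rho> ^ m"
        then have "p dvd \<rho>"
          using field_poly_irreducible_imp_prime[OF p(1)] prime_elem_dvd_power by blast
        then obtain u where u: "\<rho> = p * u"
          by blast
        have "\<not> p dvd 1"
          using p by (simp add: irreducible_def)
        with u have "u dvd 1"
          using assms(1) by (auto simp: irreducible_def)
        then obtain c where c: "u = [:c:]"
          by (auto simp: is_unit_poly_iff)
        \<comment> \<open>Both polynomials are monic, so an associate of \<open>\<rho>\<close>
          different from \<open>\<rho>\<close> is excluded.\<close>
        then have "c = 1"
          using u assms(2) p(2) by (cases "c = 0") (auto simp: lead_coeff_mult)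
        then show False
          using u c p by simp
      qed
      then show ?thesis
        using P by (auto simp: regular_at_def)
    qed
    moreover have "regular_at_infinity x"
      using P nz by (simp add: regular_at_infinity_Fract degree_power_eq)
    ultimately show "x \<in> ring_A \<rho>"
      by (simp add: ring_A_def)
  qed
qed

text \<open>One inclusion is additivity of pole orders. For the other, two test elements of
  \<open>I_\<infinity> ^ j\<close> are enough: \<open>T_0 ^ j\<close> controls the poles at finite
  places and \<open>T_(N-1) ^ j\<close> the pole at infinity.\<close>

lemma I_inf_neg_power_eq_pole_space:
  fixes \<rho> :: "'k::field poly"
  assumes irr: "irreducible \<rho>" and monic: "lead_coeff \<rho> = 1"
  shows "I_inf_neg_power \<rho> j = pole_space \<rho> (int j)"
proof
  have nz: "\<rho> \<noteq> 0"
    using assms by auto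
  have "\<not> \<rho> dvd 1"
    using irr by (simp add: irreducible_def)
  then have deg: "degree \<rho> > 0"
    using is_unit_iff_degree[OF nz] by simp
  note A = ring_A_eq_pole_space[OF assms]
  have one: "1 \<in> ring_A \<rho>"
    unfolding A using pole_spaceI[of 1 0 \<rho> 0] by (simp add: fract_collapse)
  have "gen_T \<rho> i \<in> pole_space \<rho> (- 1)" if "i < degree \<rho>" for i
    unfolding gen_T_def using that pole_spaceI[of "monom 1 i" 1 \<rho> "- 1"] by (simp add: degree_monom_eq)
  then have I: "I_inf \<rho> \<subseteq> pole_space \<rho> (- 1)"
    unfolding I_inf_def by (intro span_over_pole_space deg) (auto simp: A)
  have pow: "ideal_power (ring_A \<rho>) (I_inf \<rho>) j \<subseteq> pole_space \<rho> (- int j)" for j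
  proof (induction j)
    case (Suc j)
    have "span_over (ring_A \<rho>) {x * y | x y. x \<in> I_inf \<rho> \<and> y \<in> ideal_power (ring_A \<rho>) (I_inf \<rho>) j}
        \<subseteq> pole_space \<rho> (- int (Suc j))"
    proof (rule span_over_pole_space[OF deg])
      show "{x * y | x y. x \<in> I_inf \<rho> \<and> y \<in> ideal_power (ring_A \<rho>) (I_inf \<rho>) j} \<subseteq> pole_space \<rho> (- int (Suc j))"
        using pole_space_mult[of _ \<rho> "- 1" _ "- int j"] I Suc by auto
    qed (simp add: A)
    then show ?case
      by simp
  qed (simp add: A)
  have genpow: "gen_T \<rho> i ^ j \<in> ideal_power (ring_A \<rho>) (I_inf \<rho>) j" if "i < degree \<rho>" for i j
  proof (induction j)
    case (Suc j)
    have "gen_T \<rho> i \<in> I_inf \<rho>"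
      using scaled_in_span_over[of "gen_T \<rho> i" "gen_T \<rho> ` {..<degree \<rho>}" 1 "ring_A \<rho>"] that one
      by (auto simp: I_inf_def)
    with Suc show ?case
      using scaled_in_span_over[OF _ one, of "gen_T \<rho> i * gen_T \<rho> i ^ j"
          "{x * y | x y. x \<in> I_inf \<rho> \<and> y \<in> ideal_power (ring_A \<rho>) (I_inf \<rho>) j}"]
      unfolding ideal_power.simps power_Suc mult_1_left by blast
  qed (simp add: one)
  have gen_pow_eq: "gen_T \<rho> i ^ j = Fract (monom 1 (i * j)) (\<rho> ^ j)" for i j
    by (induction j) (auto simp: gen_T_def monom_0 One_fract_def mult_monom add.commute one_pCons)
  show "pole_space \<rho> (int j) \<subseteq> I_inf_neg_power \<rho> j"
    using pole_space_mult[of _ \<rho> "int j" _ "- int j"] pow[of j] by (auto simp: I_inf_neg_power_def A)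
  show "I_inf_neg_power \<rho> j \<subseteq> pole_space \<rho> (int j)"
  proof
    fix x assume "x \<in> I_inf_neg_power \<rho> j"
    then have x: "x * gen_T \<rho> i ^ j \<in> ring_A \<rho>" if "i < degree \<rho>" for i
      using genpow that by (auto simp: I_inf_neg_power_def)
    \<comment> \<open>\<open>T_0 ^ j = 1 / \<rho> ^ j\<close>, so up to powers of
      \<open>\<rho>\<close> the denominator of \<open>x\<close> is trivial.\<close>
    obtain P m where P: "x * Fract 1 (\<rho> ^ j) = Fract P (\<rho> ^ m)"
      using x[OF deg] unfolding gen_pow_eq A by (auto simp: pole_space_def monom_0 one_pCons)
    have "Fract 1 (\<rho> ^ j) * Fract (\<rho> ^ j) 1 = 1"
      using nz by (simp add: One_fract_def eq_fract)
    then have "x = x * Fract 1 (\<rho> ^ j) * Fract (\<rho> ^ j) 1"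
      by (simp only: mult.assoc mult_1_right)
    also have "\<dots> = Fract (P * \<rho> ^ j) (\<rho> ^ m)"
      by (simp only: P mult_fract mult_1_right)
    finally have x_eq: "x = Fract (P * \<rho> ^ j) (\<rho> ^ m)" .
    \<comment> \<open>\<open>T_(N-1) ^ j\<close> has a zero of order exactly \<open>j\<close> at
      infinity, the smallest possible order, so the pole of \<open>x\<close> there has order at most
      \<open>j\<close>.\<close>
    let ?i = "degree \<rho> - 1"
    have "Fract (P * \<rho> ^ j * monom 1 (?i * j)) (\<rho> ^ m * \<rho> ^ j) \<in> ring_A \<rho>"
      using x[of ?i] deg unfolding gen_pow_eq by (simp only: x_eq mult_fract)
    then have le: "degree (P * \<rho> ^ j * monom 1 (?i * j)) \<le> degree (\<rho> ^ m * \<rho> ^ j)"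
      using nz by (simp add: ring_A_def regular_at_infinity_Fract)
    have "degree (P * \<rho> ^ j) \<le> m * degree \<rho> + j"
    proof (cases "P = 0")
      case False
      then have "degree (P * \<rho> ^ j) + ?i * j \<le> m * degree \<rho> + j * degree \<rho>"
        using le nz by (simp add: degree_mult_eq degree_monom_eq degree_power_eq monom_eq_0_iff)
      moreover have "j * degree \<rho> = ?i * j + j"
        using deg by (cases "degree \<rho>") (auto simp: algebra_simps)
      ultimately show ?thesis
        by linarith
    qed auto
    then show "x \<in> pole_space \<rho> (int j)"
      unfolding x_eq by (intro pole_spaceI) linarith
  qed
qed

subsection \<open>The conjugates of \<open>\<eta>\<close> and absolute values\<close>

lemma map_poly_mult_hom:
  assumes "h 0 = 0" "\<And>a b. h (a + b) = h a + h b" "\<And>a b. h (a * b) = h a * h b"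
  shows "map_poly h (p * q) = map_poly h p * map_poly h (q :: 'a::comm_ring_1 poly)"
proof (rule poly_eqI)
  fix n
  have sum: "h (sum f A) = (\<Sum>i\<in>A. h (f i))" for f and A :: "nat set"
    by (induction A rule: infinite_finite_induct) (auto simp: assms)
  show "coeff (map_poly h (p * q)) n = coeff (map_poly h p * map_poly h q) n"
    by (simp add: coeff_map_poly coeff_mult assms sum)
qed

lemma card_degree_less:
  assumes "n > 0"
  shows "finite {P :: 'k::{finite, field} poly. degree P < n}"
    and "card {P :: 'k poly. degree P < n} = CARD('k) ^ n"
proof -
  let ?L = "{xs :: 'k list. set xs \<subseteq> UNIV \<and> length xs = n}"
  have bij: "bij_betw Poly ?L {P. degree P < n}"
  proof (rule bij_betw_byWitness[where f' = "\<lambda>P. map (coeff P) [0..<n]"])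
    show "\<forall>xs\<in>?L. map (coeff (Poly xs)) [0..<n] = xs"
      by (auto intro!: nth_equalityI simp: nth_default_def)
    show "\<forall>P\<in>{P :: 'k poly. degree P < n}. Poly (map (coeff P) [0..<n]) = P"
      by (auto intro!: poly_eqI simp: nth_default_def coeff_eq_0)
    show "Poly ` ?L \<subseteq> {P. degree P < n}"
    proof safe
      fix xs :: "'k list" assume "n = length xs"
      then have "degree (Poly xs) \<le> n - 1"
        by (intro degree_le) (auto simp: nth_default_def)
      with assms show "degree (Poly xs) < length xs"
        unfolding \<open>n = length xs\<close> by linarith
    qed
  qed auto
  then show "finite {P :: 'k poly. degree P < n}"
    using finite_lists_length_eq[of "UNIV :: 'k set" n] bij_betw_finite[OF bij] by simp
  show "card {P :: 'k poly. degree P < n} = CARD('k) ^ n"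
    using bij_betw_same_card[OF bij] card_lists_length_eq[of "UNIV :: 'k set" n] by simp
qed

lemma card_field_ge_2: "CARD('k::{finite, field}) \<ge> 2"
proof -
  have "card {0, 1 :: 'k} \<le> CARD('k)"
    by (intro card_mono) auto
  then show ?thesis
    by simp
qed

context rho_adic_setting
begin

sublocale ultrametric_field "eta_abs :: 'c \<Rightarrow> real"
  by unfold_locales (rule dist_eta_abs eta_abs_mult eta_abs_add)+

abbreviation N :: nat where "N \<equiv> degree \<rho>"
abbreviation \<theta> :: 'c where "\<theta> \<equiv> theta \<iota>"

section \<open>Frobenius powers, evaluation of polynomials over the finite field, and the field
  generated by \<open>\<eta>\<close>\<close>

definition etaF :: "nat \<Rightarrow> 'c" where "etaF i = \<eta> ^ (CARD('k) ^ i)"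
definition thetaF :: "nat \<Rightarrow> 'c" where "thetaF n = \<theta> ^ (CARD('k) ^ n)"
definition ev :: "'k poly \<Rightarrow> 'c \<Rightarrow> 'c" where "ev P z = poly (map_poly (const_emb \<iota>) P) z"

lemma q_ge_2: "CARD('k) \<ge> 2"
  by (rule card_field_ge_2)

lemma rho_nz: "\<rho> \<noteq> 0"
  using rho_degree by auto

lemma iota_0 [simp]: "\<iota> 0 = 0"
  by (rule add_left_imp_eq[of "\<iota> 0"]) (simp flip: iota_add)

lemma iota_minus: "\<iota> (- x) = - \<iota> x"
  using iota_add[of x "- x"] by (simp add: eq_neg_iff_add_eq_0 add.commute)

lemma iota_eq_0_iff [simp]: "\<iota> x = 0 \<longleftrightarrow> x = 0"
proof
  assume "\<iota> x = 0"
  then show "x = 0"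
    using iota_mult[of x "inverse x"] iota_one by (cases "x = 0") auto
qed simp

lemma iota_divide: "\<iota> (x / y) = \<iota> x / \<iota> y"
  by (cases "y = 0") (use iota_mult[of "x / y" y] in \<open>auto simp: field_simps\<close>)

lemma iota_inj: "\<iota> x = \<iota> y \<Longrightarrow> x = y"
  using iota_add[of x "- y"] iota_eq_0_iff[of "x - y"] by (simp add: iota_minus)

lemma const_emb_add: "const_emb \<iota> (a + b) = const_emb \<iota> a + const_emb \<iota> b"
  using iota_add[of "to_fract [:a:]" "to_fract [:b:]"] by (simp add: const_emb_def flip: to_fract_add)

lemma const_emb_mult: "const_emb \<iota> (a * b) = const_emb \<iota> a * const_emb \<iota> b"
  using iota_mult[of "to_fract [:a:]" "to_fract [:b:]"] by (simp add: const_emb_def mult.commute flip: to_fract_mult)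

lemma const_emb_0 [simp]: "const_emb \<iota> 0 = 0"
  by (simp add: const_emb_def)

lemma const_emb_1 [simp]: "const_emb \<iota> 1 = 1"
  by (simp add: const_emb_def iota_one flip: one_pCons)

lemma const_emb_eq_0_iff [simp]: "const_emb \<iota> a = 0 \<longleftrightarrow> a = 0"
  by (simp add: const_emb_def)

lemma const_emb_power: "const_emb \<iota> (a ^ n) = const_emb \<iota> a ^ n"
  by (induction n) (auto simp: const_emb_mult)

lemma const_emb_of_nat: "const_emb \<iota> (of_nat n) = of_nat n"
  by (induction n) (auto simp: const_emb_add)

lemma const_emb_frob: "const_emb \<iota> a ^ (CARD('k) ^ n) = const_emb \<iota> a"
proof (induction n)
  case (Suc n)
  have "const_emb \<iota> a ^ (CARD('k) ^ Suc n) = (const_emb \<iota> a ^ CARD('k)) ^ (CARD('k) ^ n)"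
    by (simp flip: power_mult)
  then show ?case
    using Suc by (simp add: finite_field_power_card flip: const_emb_power)
qed simp

lemma frob_add_1: "(a + b :: 'c) ^ CARD('k) = a ^ CARD('k) + b ^ CARD('k)"
proof -
  have "(a + b) ^ CARD('k) = (\<Sum>i\<le>CARD('k). of_nat (CARD('k) choose i) * a ^ i * b ^ (CARD('k) - i))"
    by (rule binomial_ring)
  also have "\<dots> = (\<Sum>i\<in>{0, CARD('k)}. of_nat (CARD('k) choose i) * a ^ i * b ^ (CARD('k) - i))"
  proof (rule sum.mono_neutral_right)
    show "\<forall>i\<in>{..CARD('k)} - {0, CARD('k)}. of_nat (CARD('k) choose i) * a ^ i * b ^ (CARD('k) - i) = 0"
    proof
      fix i assume i: "i \<in> {..CARD('k)} - {0, CARD('k)}"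
      then have "of_nat (CARD('k) choose i) = (0::'k)"
        by (intro of_nat_choose_card_eq_0) auto
      then have "of_nat (CARD('k) choose i) = (0::'c)"
        by (metis const_emb_of_nat const_emb_0)
      then show "of_nat (CARD('k) choose i) * a ^ i * b ^ (CARD('k) - i) = 0"
        by simp
    qed
  qed auto
  finally show ?thesis
    using q_ge_2 by (simp add: add.commute)
qed

lemma frob_add: "(a + b :: 'c) ^ (CARD('k) ^ n) = a ^ (CARD('k) ^ n) + b ^ (CARD('k) ^ n)"
proof (induction n arbitrary: a b)
  case (Suc n)
  have "(a + b) ^ (CARD('k) ^ Suc n) = ((a + b) ^ CARD('k)) ^ (CARD('k) ^ n)"
    by (simp flip: power_mult)
  then show ?case
    by (simp add: frob_add_1 Suc flip: power_mult)
qed simp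

lemma frob_0 [simp]: "(0 :: 'c) ^ (CARD('k) ^ n) = 0"
  using q_ge_2 by (simp add: power_0_left)

lemma frob_minus: "(- a :: 'c) ^ (CARD('k) ^ n) = - (a ^ (CARD('k) ^ n))"
  using frob_add[of a "- a" n] by (simp add: eq_neg_iff_add_eq_0 add.commute)

lemma frob_diff: "(a - b :: 'c) ^ (CARD('k) ^ n) = a ^ (CARD('k) ^ n) - b ^ (CARD('k) ^ n)"
  using frob_add[of a "- b" n] by (simp add: frob_minus)

lemma frob_sum: "(\<Sum>i\<in>A. f i :: 'c) ^ (CARD('k) ^ n) = (\<Sum>i\<in>A. f i ^ (CARD('k) ^ n))"
  by (induction A rule: infinite_finite_induct) (auto simp: frob_add)

lemma ev_0 [simp]: "ev 0 z = 0"
  by (simp add: ev_def)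

lemma ev_pCons: "ev (pCons a P) z = const_emb \<iota> a + z * ev P z"
  by (simp add: ev_def map_poly_pCons)

lemma ev_add: "ev (P + Q) z = ev P z + ev Q z"
proof -
  have "map_poly (const_emb \<iota>) (P + Q) = map_poly (const_emb \<iota>) P + map_poly (const_emb \<iota>) Q"
    by (rule poly_eqI) (simp add: coeff_map_poly const_emb_add)
  then show ?thesis
    by (simp add: ev_def)
qed

lemma map_poly_const_emb_mult:
  "map_poly (const_emb \<iota>) (P * Q) = map_poly (const_emb \<iota>) P * map_poly (const_emb \<iota>) Q"
  by (rule map_poly_mult_hom) (auto simp: const_emb_add const_emb_mult)

lemma ev_mult: "ev (P * Q) z = ev P z * ev Q z"
  by (simp add: ev_def map_poly_const_emb_mult)

lemma ev_1 [simp]: "ev 1 z = 1"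
  by (simp add: one_pCons ev_pCons)

lemma ev_power: "ev (P ^ n) z = ev P z ^ n"
  by (induction n) (auto simp: ev_mult)

lemma ev_monom: "ev (monom c n) z = const_emb \<iota> c * z ^ n"
  by (induction n) (auto simp: monom_0 monom_Suc ev_pCons)

lemma ev_diff: "ev (P - Q) z = ev P z - ev Q z"
  using ev_add[of "P - Q" Q z] by simp

lemma ev_frob: "ev P (z ^ (CARD('k) ^ n)) = ev P z ^ (CARD('k) ^ n)"
  by (induction P) (auto simp: ev_pCons frob_add power_mult_distrib const_emb_frob)

lemma iota_to_fract: "\<iota> (to_fract P) = ev P \<theta>"
proof (induction P)
  case (pCons a P)
  have "to_fract (pCons a P) = to_fract [:a:] + to_fract [:0, 1:] * to_fract P"
    by (simp flip: to_fract_add to_fract_mult)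
  then show ?case
    by (simp add: iota_add iota_mult pCons ev_pCons const_emb_def theta_def)
qed simp

lemma iota_Fract: "\<iota> (Fract P Q) = ev P \<theta> / ev Q \<theta>"
  by (simp add: Fract_conv_to_fract iota_divide iota_to_fract)

lemma ev_theta_eq_0_iff: "ev P \<theta> = 0 \<longleftrightarrow> P = 0"
  by (simp flip: iota_to_fract)

text \<open>A nonzero polynomial of least degree vanishing at \<open>\<eta>\<close> divides
  \<open>\<rho>\<close>, by division with remainder. A degree below \<open>N\<close> would
  contradict irreducibility, so \<open>\<rho>\<close> is the minimal polynomial of
  \<open>\<eta>\<close>.\<close>

lemma ev_eta_nonzero:
  assumes "P \<noteq> 0" "degree P < N"
  shows "ev P \<eta> \<noteq> 0"
proof
  assume "ev P \<eta> = 0"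
  then have "\<exists>P. P \<noteq> 0 \<and> degree P < N \<and> ev P \<eta> = 0"
    using assms by blast
  then obtain m where m: "m \<noteq> 0" "degree m < N" "ev m \<eta> = 0"
    and min: "\<And>Q. Q \<noteq> 0 \<and> degree Q < N \<and> ev Q \<eta> = 0 \<Longrightarrow> degree m \<le> degree Q"
    using ex_has_least_nat[of "\<lambda>P. P \<noteq> 0 \<and> degree P < N \<and> ev P \<eta> = 0" _ degree] by blast
  have "ev \<rho> \<eta> = 0"
    using eta_root by (simp add: ev_def)
  moreover have "\<rho> = \<rho> div m * m + \<rho> mod m"
    by simp
  ultimately have "ev (\<rho> mod m) \<eta> = 0"
    using m(3) by (metis ev_add ev_mult mult_zero_right add_0)
  then have "\<rho> mod m = 0"
    using min[of "\<rho> mod m"] degree_mod_less[OF m(1), of \<rho>] m(2) by force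
  then obtain u where u: "\<rho> = m * u"
    by (auto simp: mod_eq_0_iff_dvd)
  then have "u \<noteq> 0"
    using rho_nz by auto
  from u rho_irreducible have "m dvd 1 \<or> u dvd 1"
    using irreducibleD by blast
  then show False
  proof
    assume "m dvd 1"
    then obtain c where "m = [:c:]" "c \<noteq> 0"
      using m(1) by (auto simp: is_unit_poly_iff)
    then show False
      using m(3) by (simp add: ev_pCons)
  next
    assume "u dvd 1"
    then have "degree u = 0"
      using is_unit_iff_degree[OF \<open>u \<noteq> 0\<close>] by simp
    then show False
      using u m \<open>u \<noteq> 0\<close> by (simp add: degree_mult_eq)
  qed
qed

lemma ev_eta_inj: "inj_on (\<lambda>P. ev P \<eta>) {P. degree P < N}"
proof (rule inj_onI)
  fix P Q assume *: "P \<in> {P. degree P < N}" "Q \<in> {P. degree P < N}" "ev P \<eta> = ev Q \<eta>"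
  then have "degree (P - Q) < N" "ev (P - Q) \<eta> = 0"
    by (auto simp: ev_diff intro: degree_diff_less)
  then show "P = Q"
    using ev_eta_nonzero[of "P - Q"] by auto
qed

text \<open>This is the finite field generated by \<open>\<eta>\<close> over the constants;
  remainders modulo \<open>\<rho>\<close> represent its elements uniquely, which gives the
  cardinality \<open>q ^ N\<close>.\<close>

definition residue_field :: "'c set" where
  "residue_field = (\<lambda>P. ev P \<eta>) ` {P. degree P < N}"

lemma residue_field_finite: "finite residue_field" and card_residue_field: "card residue_field = CARD('k) ^ N"
  using card_degree_less[where 'k = 'k, of N] rho_degree ev_eta_inj
  by (auto simp: residue_field_def card_image)

lemma eta_nz: "\<eta> \<noteq> 0"
  using ev_eta_nonzero[of "[:0, 1:]"] rho_degree by (auto simp: ev_pCons)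

lemma eta_mult_residue_field:
  assumes "x \<in> residue_field"
  shows "\<eta> * x \<in> residue_field"
proof -
  obtain P where P: "x = ev P \<eta>"
    using assms by (auto simp: residue_field_def)
  let ?Q = "pCons 0 P"
  have "ev \<rho> \<eta> = 0"
    using eta_root by (simp add: ev_def)
  moreover have "?Q = ?Q div \<rho> * \<rho> + ?Q mod \<rho>"
    by simp
  ultimately have "ev ?Q \<eta> = ev (?Q mod \<rho>) \<eta>"
    by (metis ev_add ev_mult mult_zero_right add_0)
  moreover have "degree (?Q mod \<rho>) < N"
    using degree_mod_less[OF rho_nz, of ?Q] rho_degree by auto
  ultimately show ?thesis
    unfolding P residue_field_def by (auto simp: ev_pCons)
qed

text \<open>Multiplication by \<open>\<eta>\<close> permutes the \<open>q ^ N - 1\<close> nonzero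
  elements of the residue field, so cancelling their product gives
  \<open>\<eta> ^ (q ^ N - 1) = 1\<close>.\<close>

lemma eta_frob_N: "\<eta> ^ (CARD('k) ^ N) = \<eta>"
proof -
  let ?F = "residue_field - {0}"
  have "(\<lambda>x. \<eta> * x) ` ?F = ?F"
    by (rule endo_inj_surj) (auto simp: residue_field_finite eta_nz eta_mult_residue_field inj_on_def)
  then have "(\<Prod>x\<in>?F. \<eta> * x) = \<Prod>?F"
    using prod.reindex[of "\<lambda>x. \<eta> * x" ?F "\<lambda>x. x"] by (simp add: inj_on_def eta_nz)
  then have "\<eta> ^ card ?F * \<Prod>?F = \<Prod>?F"
    by (simp add: prod.distrib)
  moreover have "\<Prod>?F \<noteq> 0"
    using residue_field_finite by simp
  ultimately have 1: "\<eta> ^ card ?F = 1"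
    by simp
  have "0 \<in> residue_field"
    using rho_degree by (auto simp: residue_field_def image_iff intro!: exI[of _ "0 :: 'k poly"])
  then have "CARD('k) ^ N = Suc (card ?F)"
    using residue_field_finite card_residue_field by (metis card_Suc_Diff1)
  then show ?thesis
    using 1 by (metis power_Suc mult.right_neutral)
qed

lemma etaF_0 [simp]: "etaF 0 = \<eta>" and thetaF_0 [simp]: "thetaF 0 = \<theta>"
  by (simp_all add: etaF_def thetaF_def)

lemma etaF_add: "etaF (i + j) = etaF i ^ (CARD('k) ^ j)" and thetaF_add: "thetaF (i + j) = thetaF i ^ (CARD('k) ^ j)"
  by (simp_all add: etaF_def thetaF_def power_add flip: power_mult)

lemma etaF_add_N [simp]: "etaF (i + N) = etaF i"
proof -
  have "etaF (i + N) = (\<eta> ^ (CARD('k) ^ N)) ^ (CARD('k) ^ i)"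
    by (simp add: etaF_def power_add mult.commute flip: power_mult)
  then show ?thesis
    by (simp add: eta_frob_N etaF_def)
qed

lemma etaF_add_mult_N: "etaF (i + k * N) = etaF i"
proof (induction k)
  case (Suc k)
  have "i + Suc k * N = (i + k * N) + N"
    by simp
  with Suc show ?case
    by (metis etaF_add_N)
qed simp

text \<open>If \<open>\<eta> ^ q ^ b = \<eta>\<close> held with \<open>0 < b < N\<close>, then all
  \<open>q ^ N\<close> elements of the residue field would be roots of \<open>X ^ q ^ b - X\<close>,
  which has at most \<open>q ^ b\<close> roots.\<close>

lemma etaF_eq_eta_iff: "etaF i = \<eta> \<longleftrightarrow> N dvd i"
proof
  assume "N dvd i"
  then obtain k where "i = 0 + k * N"
    by (metis dvdE mult.commute add_0)
  then show "etaF i = \<eta>"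
    by (metis etaF_add_mult_N etaF_0)
next
  assume eq: "etaF i = \<eta>"
  define b where "b = i mod N"
  have "i = b + i div N * N"
    by (simp add: b_def)
  then have b: "\<eta> ^ (CARD('k) ^ b) = \<eta>"
    using eq by (metis etaF_add_mult_N etaF_def)
  have "b < N"
    using rho_degree by (simp add: b_def)
  have "b = 0"
  proof (rule ccontr)
    assume "b \<noteq> 0"
    then have "CARD('k) ^ 1 \<le> CARD('k) ^ b"
      using q_ge_2 by (intro power_increasing) auto
    then have qb: "CARD('k) ^ b \<ge> 2"
      using q_ge_2 by simp
    define p :: "'c poly" where "p = monom 1 (CARD('k) ^ b) - [:0, 1:]"
    have "coeff p 1 = - 1"
      using qb q_ge_2 \<open>b \<noteq> 0\<close> by (simp add: p_def)
    then have "p \<noteq> 0"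
      by auto
    have "degree p \<le> CARD('k) ^ b"
      unfolding p_def using qb by (intro degree_diff_le) (auto simp: degree_monom_le)
    have "residue_field \<subseteq> {x. poly p x = 0}"
    proof
      fix x assume "x \<in> residue_field"
      then obtain P where "x = ev P \<eta>"
        by (auto simp: residue_field_def)
      then have "x ^ (CARD('k) ^ b) = x"
        using ev_frob[of P \<eta> b] b by simp
      then show "x \<in> {x. poly p x = 0}"
        by (simp add: p_def poly_monom)
    qed
    then have "CARD('k) ^ N \<le> card {x. poly p x = 0}"
      using card_mono[OF poly_roots_finite[OF \<open>p \<noteq> 0\<close>]] card_residue_field by metis
    also have "\<dots> \<le> CARD('k) ^ b"
      using card_poly_roots_bound[OF \<open>p \<noteq> 0\<close>] \<open>degree p \<le> CARD('k) ^ b\<close> by simp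
    finally show False
      using \<open>b < N\<close> q_ge_2 by (simp add: power_le_imp_le_exp linorder_not_le[symmetric])
  qed
  then show "N dvd i"
    by (simp add: b_def dvd_eq_mod_eq_0)
qed

text \<open>Such an \<open>x\<close> satisfies \<open>x ^ (q ^ N - 1) = 1\<close>. The hypothesis is
  stable under differences, so the lemma applies to constants, to the conjugates of
  \<open>\<eta>\<close> and to differences of conjugates.\<close>

lemma eta_abs_root_of_unity:
  fixes x :: 'c
  assumes "x \<noteq> 0" "x ^ (CARD('k) ^ N) = x"
  shows "eta_abs x = 1"
proof (rule ccontr)
  assume ne: "eta_abs x \<noteq> 1"
  have "CARD('k) ^ 1 \<le> CARD('k) ^ N"
    using q_ge_2 rho_degree by (intro power_increasing) auto
  then obtain m where m: "CARD('k) ^ N = Suc (Suc m)"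
    using q_ge_2 by (metis Suc_le_D add_2_eq_Suc le_Suc_ex order.trans power_one_right)
  have "eta_abs x ^ (CARD('k) ^ N) = eta_abs x"
    using assms(2) by (metis av_power)
  then have "eta_abs x * eta_abs x ^ Suc m = eta_abs x * 1"
    using m by simp
  then have "eta_abs x ^ Suc m = 1"
    using assms(1) by (metis av_eq_0_iff mult_cancel_left)
  then show False
    using ne power_eq_1_iff[of "eta_abs x" "Suc m"] by simp
qed

lemma etaF_frob_N: "etaF i ^ (CARD('k) ^ N) = etaF i"
  by (simp flip: etaF_add)

lemma eta_abs_etaF [simp]: "eta_abs (etaF i) = 1"
proof (rule eta_abs_root_of_unity)
  show "etaF i \<noteq> 0"
    using eta_nz by (simp add: etaF_def)
qed (rule etaF_frob_N)

lemma eta_abs_etaF_diff_eta: "eta_abs (etaF i - \<eta>) = (if N dvd i then 0 else 1)"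
proof (cases "N dvd i")
  case False
  then have "etaF i - \<eta> \<noteq> 0"
    by (simp add: etaF_eq_eta_iff)
  moreover have "(etaF i - \<eta>) ^ (CARD('k) ^ N) = etaF i - \<eta>"
    by (simp add: frob_diff etaF_frob_N eta_frob_N)
  ultimately show ?thesis
    using False eta_abs_root_of_unity by simp
qed (simp add: etaF_eq_eta_iff)

section \<open>Absolute values of differences between the points \<open>\<theta>\<close>,
  \<open>x_n\<close> and \<open>eta_i\<close>\<close>

lemma q_inv: "1 / real CARD('k) > 0" "1 / real CARD('k) < 1"
  using q_ge_2 by auto

lemma eta_abs_theta_etaF: "eta_abs (\<theta> - etaF i) = (if N dvd i then 1 / real CARD('k) else 1)"
proof (cases "N dvd i")
  case True
  then have "etaF i = \<eta>"
    by (simp add: etaF_eq_eta_iff)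
  then show ?thesis
    using eta_abs_uniformizer True by simp
next
  case False
  then have "eta_abs ((\<theta> - \<eta>) - (etaF i - \<eta>)) = eta_abs (etaF i - \<eta>)"
    using q_inv eta_abs_uniformizer by (intro av_diff_eq_right) (simp add: eta_abs_etaF_diff_eta)
  then show ?thesis
    using False by (simp add: eta_abs_etaF_diff_eta)
qed

lemma eta_abs_theta_le: "eta_abs \<theta> \<le> 1"
  using av_add_le[of "\<theta> - \<eta>" \<eta>] eta_abs_etaF[of 0] eta_abs_uniformizer q_inv by simp

lemma theta_etaF_nz: "\<theta> - etaF i \<noteq> 0"
  using eta_abs_theta_etaF[of i] q_inv by (metis av_0 less_irrefl zero_neq_one)

lemma eta_abs_thetaF_etaF_same: "eta_abs (thetaF m - etaF m) = (1 / real CARD('k)) ^ (CARD('k) ^ m)"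
proof -
  have "thetaF m - etaF m = (\<theta> - \<eta>) ^ (CARD('k) ^ m)"
    by (simp add: thetaF_def etaF_def frob_diff)
  then show ?thesis
    by (simp add: av_power eta_abs_uniformizer)
qed

lemma q_inv_power_less: "m > 0 \<Longrightarrow> (1 / real CARD('k)) ^ (CARD('k) ^ m) < 1 / real CARD('k)"
proof -
  assume "m > 0"
  then have "CARD('k) ^ 1 \<le> CARD('k) ^ m"
    using q_ge_2 by (intro power_increasing) auto
  then have "(1 / real CARD('k)) ^ (CARD('k) ^ m) < (1 / real CARD('k)) ^ 1"
    using q_ge_2 by (intro power_strict_decreasing) auto
  then show ?thesis
    by simp
qed

lemma eta_abs_thetaF_eta: "eta_abs (thetaF m - \<eta>) = (if N dvd m then (1 / real CARD('k)) ^ (CARD('k) ^ m) else 1)"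
proof (cases "N dvd m")
  case True
  then have "etaF m = \<eta>"
    by (simp add: etaF_eq_eta_iff)
  then show ?thesis
    using eta_abs_thetaF_etaF_same[of m] True by simp
next
  case False
  then have "m > 0"
    by (auto intro: Nat.gr0I)
  have "eta_abs ((thetaF m - etaF m) + (etaF m - \<eta>)) = eta_abs (etaF m - \<eta>)"
    using less_trans[OF q_inv_power_less[OF \<open>m > 0\<close>] q_inv(2)] False
    by (intro av_add_eq_right) (simp add: eta_abs_etaF_diff_eta eta_abs_thetaF_etaF_same)
  then show ?thesis
    using False by (simp add: eta_abs_etaF_diff_eta)
qed

text \<open>The point \<open>x_m\<close> is within \<open>q ^ (- q ^ m)\<close> of
  \<open>eta_m\<close>, strictly less than \<open>1 / q\<close>, while \<open>\<theta>\<close> is at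
  distance at least \<open>1 / q\<close> from every conjugate. Hence all factors of the infinite
  product have absolute value 1.\<close>

lemma eta_abs_theta_thetaF:
  assumes "m > 0"
  shows "eta_abs (\<theta> - thetaF m) = eta_abs (\<theta> - etaF m)"
proof -
  have "eta_abs ((thetaF m - etaF m) - (\<theta> - etaF m)) = eta_abs (\<theta> - etaF m)"
    using q_inv_power_less[OF assms] less_trans[OF q_inv_power_less[OF assms] q_inv(2)]
    by (intro av_diff_eq_right) (simp add: eta_abs_theta_etaF eta_abs_thetaF_etaF_same)
  then show ?thesis
    by (simp add: av_minus_commute)
qed

lemma theta_thetaF_nz: "m > 0 \<Longrightarrow> \<theta> - thetaF m \<noteq> 0"
  using eta_abs_theta_thetaF[of m] theta_etaF_nz[of m] by (metis av_eq_0_iff)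

lemma thetaF_diff: "i < n \<Longrightarrow> thetaF i - thetaF n = (\<theta> - thetaF (n - i)) ^ (CARD('k) ^ i)"
  by (simp add: frob_diff flip: thetaF_add) (simp add: thetaF_def)

lemma thetaF_etaF_diff: "i \<le> n \<Longrightarrow> thetaF n - etaF i = (thetaF (n - i) - \<eta>) ^ (CARD('k) ^ i)"
  by (simp add: frob_diff flip: thetaF_add) (simp add: etaF_def)

lemma thetaF_etaF_diff': "n \<le> i \<Longrightarrow> thetaF n - etaF i = (\<theta> - etaF (i - n)) ^ (CARD('k) ^ n)"
  by (simp add: frob_diff flip: etaF_add) (simp add: thetaF_def)

text \<open>Since \<open>q ^ (n - i) q ^ i = q ^ n\<close>, the nontrivial value does not depend on
  \<open>i\<close>. Estimating products of these factors thus becomes counting the indices congruent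
  to \<open>n\<close> modulo \<open>N\<close>.\<close>

lemma eta_abs_thetaF_etaF:
  "i \<le> n \<Longrightarrow> eta_abs (thetaF n - etaF i) = (if N dvd n - i then (1 / real CARD('k)) ^ (CARD('k) ^ n) else 1)"
  by (simp add: thetaF_etaF_diff av_power eta_abs_thetaF_eta flip: power_mult power_add)

lemma thetaF_etaF_nz: "thetaF n - etaF i \<noteq> 0"
proof (cases "i \<le> n")
  case True
  then show ?thesis
    using eta_abs_thetaF_etaF[OF True] q_ge_2 by (metis av_0 zero_neq_one power_not_zero q_inv(1) less_irrefl)
qed (use theta_etaF_nz[of "i - n"] in \<open>simp add: thetaF_etaF_diff'\<close>)

lemma thetaF_inj: "thetaF i = thetaF n \<longleftrightarrow> i = n"
  using thetaF_diff[of i n] thetaF_diff[of n i] theta_thetaF_nz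
  by (cases i n rule: linorder_cases) auto

lemma eta_abs_thetaF_diff_ge:
  assumes "i < n"
  shows "eta_abs (thetaF n - thetaF i) \<ge> (1 / real CARD('k)) ^ (CARD('k) ^ i)" "eta_abs (thetaF n - thetaF i) \<le> 1"
proof -
  have "eta_abs (thetaF n - thetaF i) = eta_abs (\<theta> - etaF (n - i)) ^ (CARD('k) ^ i)"
    using assms by (subst av_minus_commute) (simp add: thetaF_diff av_power eta_abs_theta_thetaF)
  then show "eta_abs (thetaF n - thetaF i) \<ge> (1 / real CARD('k)) ^ (CARD('k) ^ i)" "eta_abs (thetaF n - thetaF i) \<le> 1"
    using q_inv by (auto simp: eta_abs_theta_etaF power_le_one)
qed

lemma eta_abs_ev_theta_le: "eta_abs (ev P \<theta>) \<le> 1"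
proof (induction P)
  case (pCons a P)
  have "eta_abs (const_emb \<iota> a) \<le> 1"
    using eta_abs_root_of_unity[of "const_emb \<iota> a"] const_emb_frob[of a N] by (cases "a = 0") auto
  moreover have "eta_abs (\<theta> * ev P \<theta>) \<le> 1"
    using pCons eta_abs_theta_le by (simp add: av_mult mult_le_one)
  ultimately show ?case
    using av_add_le[of "const_emb \<iota> a" "\<theta> * ev P \<theta>"] by (simp add: ev_pCons)
qed simp

text \<open>Frobenius permutes the roots of \<open>\<rho>\<close>, so the first \<open>N\<close>
  conjugates are distinct roots; two monic polynomials of degree \<open>N\<close> with
  \<open>N\<close> common roots agree.\<close>

lemma map_poly_rho_eq: "map_poly (const_emb \<iota>) \<rho> = (\<Prod>i<N. [:- etaF i, 1:])" (is "?R = ?P")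
proof -
  have inj: "inj_on etaF {..<N}"
  proof -
    have False if "i < j" "j < N" "etaF i = etaF j" for i j
    proof -
      have "etaF (j - i) ^ (CARD('k) ^ i) = \<eta> ^ (CARD('k) ^ i)"
        using that etaF_add[of "j - i" i] by (simp add: etaF_def[of i])
      then have "(etaF (j - i) - \<eta>) ^ (CARD('k) ^ i) = 0"
        by (simp add: frob_diff)
      then have "N dvd j - i"
        by (simp add: etaF_eq_eta_iff)
      then show False
        using that by (auto dest: dvd_imp_le)
    qed
    then show ?thesis
      by (auto simp: inj_on_def) (metis linorder_neqE_nat)
  qed
  have degR: "degree ?R = N" and lcR: "coeff ?R N = 1"
    using rho_monic by (auto simp: coeff_map_poly degree_map_poly)
  have degP: "degree ?P = N"
    by (simp add: degree_prod_eq_sum_degree)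
  have lcP: "coeff ?P N = 1"
    using lead_coeff_prod[of "\<lambda>i. [:- etaF i, 1:]" "{..<N}"] degP by simp
  have "degree (?R - ?P) < N"
  proof -
    have "coeff (?R - ?P) i = 0" if "i > N - 1" for i
      using that degR degP lcR lcP by (cases "i = N") (auto simp: coeff_eq_0)
    then have "degree (?R - ?P) \<le> N - 1"
      by (intro degree_le) blast
    then show ?thesis
      using rho_degree by linarith
  qed
  moreover have "etaF ` {..<N} \<subseteq> {x. poly (?R - ?P) x = 0}"
  proof -
    have "poly ?R (etaF i) = 0" for i
      using ev_frob[of \<rho> \<eta> i] eta_root by (simp add: ev_def etaF_def)
    then show ?thesis
      by (auto simp: poly_prod)
  qed
  moreover have "card (etaF ` {..<N}) = N"
    using card_image[OF inj] by simp
  ultimately have "?R - ?P = 0"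
    using poly_eqI_degree[of "etaF ` {..<N}" "?R - ?P" 0] rho_degree by auto
  then show ?thesis
    by simp
qed

end

subsection \<open>The Drinfeld module\<close>

text \<open>A relation, because a fraction may have a pole at \<open>z\<close> and its value must be
  read off from a representative whose denominator does not vanish there. Uniqueness turns
  identities of rational functions into identities of values.\<close>

definition value_at :: "'a::field \<Rightarrow> 'a poly fract \<Rightarrow> 'a \<Rightarrow> bool" where
  "value_at z x y \<longleftrightarrow> (\<exists>a b. x = Fract a b \<and> poly b z \<noteq> 0 \<and> y = poly a z / poly b z)"

lemma value_at_unique:
  assumes "value_at z x y" "value_at z x y'"
  shows "y = y'"
proof -
  obtain a b a' b' where *: "x = Fract a b" "poly b z \<noteq> 0" "y = poly a z / poly b z"
    "x = Fract a' b'" "poly b' z \<noteq> 0" "y' = poly a' z / poly b' z"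
    using assms unfolding value_at_def by blast
  then have "b \<noteq> 0" "b' \<noteq> 0"
    by auto
  with * have "a * b' = a' * b"
    by (metis eq_fract(1))
  then have "poly a z * poly b' z = poly a' z * poly b z"
    by (metis poly_mult)
  with * show ?thesis
    by (simp add: frac_eq_eq)
qed

lemma value_at_Fract: "poly b z \<noteq> 0 \<Longrightarrow> value_at z (Fract a b) (poly a z / poly b z)"
  by (auto simp: value_at_def)

lemma value_at_const: "value_at z (to_fract [:c:]) c"
  unfolding value_at_def to_fract_def by (intro exI[of _ "[:c:]"] exI[of _ 1]) auto

lemma value_at_0: "value_at z 0 0"
  using value_at_const[of z 0] by simp

lemma value_at_1: "value_at z 1 1"
  using value_at_const[of z 1] by (simp flip: one_pCons)

lemma value_at_add:
  assumes "value_at z x y" "value_at z x' y'"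
  shows "value_at z (x + x') (y + y')"
proof -
  obtain a b a' b' where *: "x = Fract a b" "poly b z \<noteq> 0" "y = poly a z / poly b z"
    "x' = Fract a' b'" "poly b' z \<noteq> 0" "y' = poly a' z / poly b' z"
    using assms by (auto simp: value_at_def)
  then have "b \<noteq> 0" "b' \<noteq> 0"
    by auto
  with * show ?thesis
    unfolding value_at_def
    by (intro exI[of _ "a * b' + a' * b"] exI[of _ "b * b'"]) (simp add: add_frac_eq)
qed

lemma value_at_mult:
  assumes "value_at z x y" "value_at z x' y'"
  shows "value_at z (x * x') (y * y')"
proof -
  obtain a b a' b' where *: "x = Fract a b" "poly b z \<noteq> 0" "y = poly a z / poly b z"
    "x' = Fract a' b'" "poly b' z \<noteq> 0" "y' = poly a' z / poly b' z"
    using assms by (auto simp: value_at_def)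
  then show ?thesis
    unfolding value_at_def
    by (intro exI[of _ "a * a'"] exI[of _ "b * b'"]) simp
qed

lemma value_at_sum:
  assumes "\<And>i. i \<in> I \<Longrightarrow> value_at z (x i) (y i)"
  shows "value_at z (\<Sum>i\<in>I. x i) (\<Sum>i\<in>I. y i)"
  using assms by (induction I rule: infinite_finite_induct) (auto intro: value_at_add value_at_0)

lemma value_at_prod:
  assumes "\<And>i. i \<in> I \<Longrightarrow> value_at z (x i) (y i)"
  shows "value_at z (\<Prod>i\<in>I. x i) (\<Prod>i\<in>I. y i)"
  using assms by (induction I rule: infinite_finite_induct) (auto intro: value_at_mult value_at_1)

context rho_adic_setting
begin

lemma twist_Fract:
  assumes "b \<noteq> 0"
  shows "twist CARD('k) n (Fract a b) =
    Fract (map_poly (\<lambda>c. c ^ (CARD('k) ^ n)) a) (map_poly (\<lambda>c :: 'c. c ^ (CARD('k) ^ n)) b)"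
  unfolding twist_def Fract_conv_to_fract[of "map_poly _ _"]
proof (rule extend_fract_Fract)
  let ?h = "\<lambda>c :: 'c. c ^ (CARD('k) ^ n)"
  fix x y :: "'c poly"
  have "map_poly ?h (x * y) = map_poly ?h x * map_poly ?h y"
    by (rule map_poly_mult_hom) (auto simp: frob_add power_mult_distrib)
  then show "to_fract (map_poly ?h (x * y)) = to_fract (map_poly ?h x) * to_fract (map_poly ?h y)"
    by simp
  show "to_fract (map_poly ?h x) = 0 \<longleftrightarrow> x = 0"
    by (auto simp: poly_eq_iff coeff_map_poly)
qed (rule assms)

lemma twist_shtuka_f:
  "twist CARD('k) l (shtuka_f \<iota> \<eta>) =
    Fract (1 - smult (1 / (thetaF l - etaF l)) [:- etaF l, 1:]) [:- etaF l, 1:]"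
proof -
  have "shtuka_f \<iota> \<eta> = Fract (1 - smult (1 / (\<theta> - \<eta>)) [:- \<eta>, 1:]) [:- \<eta>, 1:]"
    by (simp add: shtuka_f_def to_fract_def)
  then have "twist CARD('k) l (shtuka_f \<iota> \<eta>) =
      Fract (map_poly (\<lambda>c. c ^ (CARD('k) ^ l)) (1 - smult (1 / (\<theta> - \<eta>)) [:- \<eta>, 1:]))
        (map_poly (\<lambda>c. c ^ (CARD('k) ^ l)) [:- \<eta>, 1:])"
    by (simp add: twist_Fract)
  moreover have "map_poly (\<lambda>c. c ^ (CARD('k) ^ l)) [:- \<eta>, 1:] = [:- etaF l, 1:]"
    by (simp add: map_poly_pCons frob_minus etaF_def)
  moreover have "map_poly (\<lambda>c. c ^ (CARD('k) ^ l)) (1 - smult (1 / (\<theta> - \<eta>)) [:- \<eta>, 1:]) =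
      1 - smult (1 / (thetaF l - etaF l)) [:- etaF l, 1:]"
    by (simp add: one_pCons map_poly_pCons frob_minus frob_add frob_diff etaF_def thetaF_def
        power_divide power_mult_distrib)
  ultimately show ?thesis
    by simp
qed

lemma s_basis_eq_Fract:
  "s_basis \<iota> \<eta> i = Fract (\<Prod>l<i. 1 - smult (1 / (thetaF l - etaF l)) [:- etaF l, 1:]) (\<Prod>l<i. [:- etaF l, 1:])"
  unfolding s_basis_def twist_shtuka_f
  by (induction i) (simp_all add: One_fract_def)

text \<open>\<open>shtuka_value k l n\<close> is the value at \<open>t = \<theta> ^ q ^ n\<close> of the \<open>l\<close>-th twist of the function
  obtained from \<open>f\<close> by applying \<open>\<sigma> ^ k\<close> to its coefficients.\<close>

definition shtuka_value :: "nat \<Rightarrow> nat \<Rightarrow> nat \<Rightarrow> 'c" where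
  "shtuka_value k l n = 1 / (thetaF n - etaF (l + k)) - 1 / (thetaF l - etaF (l + k))"

lemma shtuka_value_eq:
  "shtuka_value k l n =
    (thetaF l - thetaF n) / ((thetaF n - etaF (l + k)) * (thetaF l - etaF (l + k)))"
  using thetaF_etaF_nz[of n "l + k"] thetaF_etaF_nz[of l "l + k"]
  by (simp add: shtuka_value_def field_simps)

text \<open>The numerator \<open>x_l - x_n\<close> decides. So the \<open>i\<close>-th basis
  function vanishes at \<open>x_n\<close> precisely for \<open>i > n\<close>, and evaluating an
  expansion at the points \<open>x_n\<close> gives a triangular system.\<close>

lemma shtuka_value_eq_0_iff: "shtuka_value k l n = 0 \<longleftrightarrow> l = n"
  using thetaF_etaF_nz[of n "l + k"] thetaF_etaF_nz[of l "l + k"]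
  by (simp add: shtuka_value_eq thetaF_inj)

lemma shtuka_value_frob:
  "shtuka_value k (l + i) (n + i) = shtuka_value k l n ^ (CARD('k) ^ i)"
proof -
  have "l + i + k = (l + k) + i"
    by simp
  then show ?thesis
    by (simp only: shtuka_value_def frob_diff power_divide power_one etaF_add thetaF_add)
qed

lemma prod_shtuka_value_eq_0: "n < i \<Longrightarrow> (\<Prod>l<i. shtuka_value k l n) = 0"
  by (auto simp: shtuka_value_eq_0_iff)

lemma value_at_s_basis:
  "value_at (thetaF n) (s_basis \<iota> \<eta> i) (\<Prod>l<i. shtuka_value 0 l n)"
  unfolding s_basis_def
proof (rule value_at_prod)
  fix l
  let ?u = "1 - smult (1 / (thetaF l - etaF l)) [:- etaF l, 1:]" and ?v = "[:- etaF l, 1:]"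
  have nz: "thetaF n - etaF l \<noteq> 0"
    by (rule thetaF_etaF_nz)
  have "value_at (thetaF n) (Fract ?u ?v) (poly ?u (thetaF n) / poly ?v (thetaF n))"
    by (rule value_at_Fract) (use nz in simp)
  moreover have "poly ?u (thetaF n) / poly ?v (thetaF n) = shtuka_value 0 l n"
  proof -
    have "poly ?v (thetaF n) = thetaF n - etaF l"
      by simp
    moreover have "poly ?u (thetaF n) = 1 - 1 / (thetaF l - etaF l) * poly ?v (thetaF n)"
      by (simp only: poly_diff poly_smult poly_1)
    moreover have "(1 - 1 / A * B) / B = 1 / B - 1 / A" if "B \<noteq> 0" for A B :: 'c
      using that by (simp add: diff_divide_distrib)
    ultimately show ?thesis
      using nz by (simp only: shtuka_value_def add_0_right)
  qed
  ultimately show "value_at (thetaF n) (twist CARD('k) l (shtuka_f \<iota> \<eta>)) (shtuka_value 0 l n)"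
    by (simp add: twist_shtuka_f)
qed

lemma base_change_Fract:
  assumes "b \<noteq> 0"
  shows "base_change \<iota> (Fract a b) = Fract (map_poly (const_emb \<iota>) a) (map_poly (const_emb \<iota>) b)"
  unfolding base_change_def Fract_conv_to_fract[of "map_poly _ _"]
proof (rule extend_fract_Fract)
  show "to_fract (map_poly (const_emb \<iota>) x) = 0 \<longleftrightarrow> x = 0" for x
    by (auto simp: poly_eq_iff coeff_map_poly)
qed (use assms in \<open>auto simp: map_poly_const_emb_mult\<close>)

text \<open>The coefficients of \<open>x\<close> are fixed by Frobenius, so substituting
  \<open>\<theta> ^ q ^ n\<close> for \<open>t\<close> raises the value at \<open>\<theta>\<close>
  to the power \<open>q ^ n\<close>.\<close>

lemma value_at_base_change: "value_at (thetaF n) (base_change \<iota> x) (\<iota> x ^ (CARD('k) ^ n))"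
proof (cases x)
  case (Fract a b)
  have nz: "ev b (thetaF n) \<noteq> 0"
    using Fract by (simp add: thetaF_def ev_frob ev_theta_eq_0_iff)
  then have "value_at (thetaF n) (base_change \<iota> x) (ev a (thetaF n) / ev b (thetaF n))"
    using Fract by (auto simp: base_change_Fract ev_def intro!: value_at_Fract)
  then show ?thesis
    using Fract by (simp add: iota_Fract power_divide thetaF_def ev_frob)
qed

lemma ring_A_eq: "ring_A \<rho> = pole_space \<rho> 0"
  using ring_A_eq_pole_space rho_irreducible rho_monic by blast

text \<open>Subtracting a multiple of the last basis function lowers the pole order at its last pole.\<close>

lemma expansion_exists:
  assumes "degree P \<le> n"
  shows "\<exists>c. P = (\<Sum>i\<le>n. smult (c i) ((\<Prod>l<i. 1 - smult (1 / (thetaF l - etaF l)) [:- etaF l, 1:]) *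
    (\<Prod>l\<in>{i..<n}. [:- etaF l, 1:])))"
  using assms
proof (induction n arbitrary: P)
  case 0
  then obtain c where "P = [:c:]"
    by (metis degree_eq_zeroE le_zero_eq)
  then show ?case
    by (intro exI[of _ "\<lambda>_. c"]) simp
next
  case (Suc n)
  let ?S = "\<lambda>i. \<Prod>l<i. 1 - smult (1 / (thetaF l - etaF l)) [:- etaF l, 1:]"
  \<comment> \<open>The \<open>l\<close>-th factor has its only zero at \<open>thetaF l\<close>,
    which is never a conjugate of \<open>\<eta>\<close>.\<close>
  have nz: "poly (?S (Suc n)) (etaF n) \<noteq> 0"
  proof -
    have "poly (1 - smult (1 / (thetaF l - etaF l)) [:- etaF l, 1:]) (etaF n) \<noteq> 0" for l
    proof
      assume "poly (1 - smult (1 / (thetaF l - etaF l)) [:- etaF l, 1:]) (etaF n) = 0"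
      then have "1 - 1 / (thetaF l - etaF l) * (poly [:- etaF l, 1:] (etaF n)) = 0"
        by (simp only: poly_diff poly_smult poly_1)
      then have "thetaF l - etaF l = etaF n - etaF l"
        using thetaF_etaF_nz[of l l] by (simp add: field_simps)
      then show False
        using thetaF_etaF_nz[of l n] by simp
    qed
    then show ?thesis
      by (simp only: poly_prod prod_zero_iff finite_lessThan) blast
  qed
  \<comment> \<open>Over the common denominator, every summand except the last contains the factor
    \<open>t - eta_n\<close>; hence the coefficient of the last one is determined by the value at
    \<open>eta_n\<close>.\<close>
  define c where "c = poly P (etaF n) / poly (?S (Suc n)) (etaF n)"
  have "poly (P - smult c (?S (Suc n))) (etaF n) = 0"
    using nz by (simp add: c_def)
  then have "[:- etaF n, 1:] dvd P - smult c (?S (Suc n))"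
    by (simp only: poly_eq_0_iff_dvd)
  then obtain Q where Q: "P - smult c (?S (Suc n)) = [:- etaF n, 1:] * Q"
    by (rule dvdE)
  have "degree (?S (Suc n)) \<le> (\<Sum>l<Suc n. degree (1 - smult (1 / (thetaF l - etaF l)) [:- etaF l, 1:]))"
    using degree_prod_sum_le[of "{..<Suc n}" "\<lambda>l. 1 - smult (1 / (thetaF l - etaF l)) [:- etaF l, 1:]"]
    by (simp only: o_def finite_lessThan)
  also have "\<dots> \<le> (\<Sum>l<Suc n. 1)"
    by (rule sum_mono) (auto simp: one_pCons)
  finally have "degree (?S (Suc n)) \<le> Suc n"
    by simp
  then have "degree ([:- etaF n, 1:] * Q) \<le> Suc n"
    unfolding Q[symmetric] using Suc.prems by (intro degree_diff_le order.trans[OF degree_smult_le]) auto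
  then have "degree Q \<le> n"
    using degree_mult_eq[of "[:- etaF n, 1:]" Q] by (cases "Q = 0") (auto simp del: mult_pCons_left)
  from Suc.IH[OF this] obtain d where
    d: "Q = (\<Sum>i\<le>n. smult (d i) (?S i * (\<Prod>l\<in>{i..<n}. [:- etaF l, 1:])))"
    by blast
  define c' where "c' i = (if i = Suc n then c else d i)" for i
  have "P = smult c (?S (Suc n)) + [:- etaF n, 1:] * Q"
    using Q by (simp add: algebra_simps)
  also have "[:- etaF n, 1:] * Q = (\<Sum>i\<le>n. smult (c' i) (?S i * (\<Prod>l\<in>{i..<Suc n}. [:- etaF l, 1:])))"
    unfolding d sum_distrib_left
    by (rule sum.cong) (auto simp: c'_def prod.atLeastLessThan_Suc mult_ac simp del: mult_pCons_left mult_pCons_right)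
  finally have "P = (\<Sum>i\<le>Suc n. smult (c' i) (?S i * (\<Prod>l\<in>{i..<Suc n}. [:- etaF l, 1:])))"
    by (simp add: c'_def add.commute del: prod.lessThan_Suc)
  then show ?case
    by blast
qed

text \<open>The conjugates repeat with period \<open>N\<close>, and each full period multiplies to
  \<open>\<rho>\<close>. This identifies the denominator of the basis function of index
  \<open>m N\<close>.\<close>

lemma prod_etaF_eq_rho_power:
  "(\<Prod>l<m * N. [:- etaF l, 1:]) = map_poly (const_emb \<iota>) (\<rho> ^ m)"
proof (induction m)
  case (Suc m)
  have "(\<Prod>l<Suc m * N. [:- etaF l, 1:]) =
      (\<Prod>l\<in>{0..<m * N}. [:- etaF l, 1:]) * (\<Prod>l\<in>{m * N..<m * N + N}. [:- etaF l, 1:])"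
    by (subst prod.atLeastLessThan_concat) (auto simp: lessThan_atLeast0 add.commute)
  also have "(\<Prod>l\<in>{m * N..<m * N + N}. [:- etaF l, 1:]) = (\<Prod>l\<in>{0..<N}. [:- etaF (l + m * N), 1:])"
    using prod.shift_bounds_nat_ivl[of "\<lambda>l. [:- etaF l, 1:]" 0 "m * N" N] by (simp add: add.commute)
  also have "\<dots> = map_poly (const_emb \<iota>) \<rho>"
    by (simp add: etaF_add_mult_N map_poly_rho_eq lessThan_atLeast0)
  finally show ?case
    using Suc by (simp add: lessThan_atLeast0 map_poly_const_emb_mult mult.commute)
qed (simp add: one_pCons map_poly_pCons)

lemma ring_A_expansion_exists:
  assumes "a \<in> ring_A \<rho>"
  shows "\<exists>c. base_change \<iota> a = (\<Sum>i\<le>degree c. to_fract [:coeff c i:] * s_basis \<iota> \<eta> i)"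
proof -
  obtain P m where P: "a = Fract P (\<rho> ^ m)" "int (degree P) \<le> int (m * N)"
    using assms by (auto simp: ring_A_eq pole_space_def)
  define n where "n = m * N"
  let ?S = "\<lambda>i. \<Prod>l<i. 1 - smult (1 / (thetaF l - etaF l)) [:- etaF l, 1:]"
  let ?W = "\<lambda>i. \<Prod>l<i. [:- etaF l, 1:]"
  have "degree (map_poly (const_emb \<iota>) P) \<le> n"
    using P(2) map_poly_degree_leq[of "const_emb \<iota>" P] unfolding n_def of_nat_le_iff by linarith
  from expansion_exists[OF this] obtain c where
    c: "map_poly (const_emb \<iota>) P = (\<Sum>i\<le>n. smult (c i) (?S i * (\<Prod>l\<in>{i..<n}. [:- etaF l, 1:])))"
    by blast
  have nz: "?W i \<noteq> 0" "(\<Prod>l\<in>{i..<n}. [:- etaF l, 1:]) \<noteq> 0" for i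
    by auto
  have "base_change \<iota> a = Fract (map_poly (const_emb \<iota>) P) (?W n)"
    unfolding P(1) n_def prod_etaF_eq_rho_power using rho_nz by (simp add: base_change_Fract)
  also have "\<dots> = to_fract (map_poly (const_emb \<iota>) P) / to_fract (?W n)"
    by (rule Fract_conv_to_fract)
  also have "\<dots> = (\<Sum>i\<le>n. to_fract [:c i:] * s_basis \<iota> \<eta> i)"
    unfolding c to_fract_sum sum_divide_distrib
  proof (rule sum.cong)
    fix i assume i: "i \<in> {..n}"
    let ?V = "\<Prod>l\<in>{i..<n}. [:- etaF l, 1:]"
    have "?W n = ?W i * ?V"
      using i by (simp add: lessThan_atLeast0 prod.atLeastLessThan_concat)
    then have "Fract (smult (c i) (?S i * ?V)) (?W n) = Fract (smult (c i) (?S i)) (?W i)"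
      using nz(1)[of i] nz(2)[of i] by (simp add: eq_fract mult_ac)
    then show "to_fract (smult (c i) (?S i * ?V)) / to_fract (?W n) = to_fract [:c i:] * s_basis \<iota> \<eta> i"
      by (simp add: s_basis_eq_Fract to_fract_def flip: Fract_conv_to_fract)
  qed simp
  \<comment> \<open>The coefficient list is stored as a polynomial; trailing zero coefficients may
    lower its degree below \<open>n\<close> without changing the sum.\<close>
  also have "\<dots> = (\<Sum>i\<le>degree (Poly (map c [0..<Suc n])).
      to_fract [:coeff (Poly (map c [0..<Suc n])) i:] * s_basis \<iota> \<eta> i)"
  proof -
    let ?c = "Poly (map c [0..<Suc n])"
    have co: "coeff ?c i = (if i \<le> n then c i else 0)" for i
      by (simp add: nth_default_def nth_append del: upt_Suc)
    have "degree ?c \<le> n"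
      by (rule degree_le) (simp add: co del: coeff_Poly_eq upt_Suc)
    then have "(\<Sum>i\<le>degree ?c. to_fract [:coeff ?c i:] * s_basis \<iota> \<eta> i) =
        (\<Sum>i\<le>n. to_fract [:coeff ?c i:] * s_basis \<iota> \<eta> i)"
      by (intro sum.mono_neutral_left) (auto simp: coeff_eq_0 simp del: coeff_Poly_eq upt_Suc)
    then show ?thesis
      by (simp add: co del: coeff_Poly_eq upt_Suc)
  qed
  finally show ?thesis
    by blast
qed

lemma expansion_eval:
  assumes "base_change \<iota> a = (\<Sum>i\<le>degree c. to_fract [:coeff c i:] * s_basis \<iota> \<eta> i)"
  shows "\<iota> a ^ (CARD('k) ^ n) = (\<Sum>i\<le>degree c. coeff c i * (\<Prod>l<i. shtuka_value 0 l n))"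
proof (rule value_at_unique)
  show "value_at (thetaF n) (base_change \<iota> a) (\<iota> a ^ (CARD('k) ^ n))"
    by (rule value_at_base_change)
  show "value_at (thetaF n) (base_change \<iota> a) (\<Sum>i\<le>degree c. coeff c i * (\<Prod>l<i. shtuka_value 0 l n))"
    unfolding assms by (intro value_at_sum value_at_mult value_at_const value_at_s_basis)
qed

text \<open>The values of \<open>a\<close> at the points \<open>\<theta> ^ q ^ n\<close> determine the coefficients recursively, since
  the later basis functions vanish there.\<close>

lemma expansion_coeff:
  assumes "base_change \<iota> a = (\<Sum>i\<le>degree c. to_fract [:coeff c i:] * s_basis \<iota> \<eta> i)"
  shows "coeff c n = (\<iota> a ^ (CARD('k) ^ n) - (\<Sum>i<n. coeff c i * (\<Prod>l<i. shtuka_value 0 l n))) /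
    (\<Prod>l<n. shtuka_value 0 l n)"
proof -
  have "\<iota> a ^ (CARD('k) ^ n) = (\<Sum>i\<le>degree c. coeff c i * (\<Prod>l<i. shtuka_value 0 l n))"
    by (rule expansion_eval[OF assms])
  also have "\<dots> = (\<Sum>i\<le>max n (degree c). coeff c i * (\<Prod>l<i. shtuka_value 0 l n))"
    by (intro sum.mono_neutral_left) (auto simp: coeff_eq_0)
  also have "\<dots> = (\<Sum>i\<le>n. coeff c i * (\<Prod>l<i. shtuka_value 0 l n))"
    by (intro sum.mono_neutral_right) (auto simp: prod_shtuka_value_eq_0)
  also have "\<dots> = (\<Sum>i<n. coeff c i * (\<Prod>l<i. shtuka_value 0 l n)) + coeff c n * (\<Prod>l<n. shtuka_value 0 l n)"
    by (simp add: lessThan_Suc_atMost[symmetric])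
  finally show ?thesis
    by (simp add: shtuka_value_eq_0_iff)
qed

text \<open>Existence comes from removing poles one at a time and uniqueness from the recursion
  \<open>expansion_coeff\<close>; together they justify the definite description in
  \<open>drinfeld_Psi\<close>.\<close>

lemma drinfeld_Psi_expansion:
  assumes "a \<in> ring_A \<rho>"
  shows "base_change \<iota> a = (\<Sum>i\<le>degree (drinfeld_Psi \<iota> \<eta> a).
    to_fract [:coeff (drinfeld_Psi \<iota> \<eta> a) i:] * s_basis \<iota> \<eta> i)"
  unfolding drinfeld_Psi_def
proof (rule theI')
  let ?E = "\<lambda>c. base_change \<iota> a = (\<Sum>i\<le>degree c. to_fract [:coeff c i:] * s_basis \<iota> \<eta> i)"
  have "c = c'" if c: "?E c" "?E c'" for c c'
  proof (rule poly_eqI)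
    fix n show "coeff c n = coeff c' n"
    proof (induction n rule: less_induct)
      case (less n)
      then show ?case
        by (simp add: expansion_coeff[OF c(1), of n] expansion_coeff[OF c(2), of n])
    qed
  qed
  then show "\<exists>!c. ?E c"
    using ring_A_expansion_exists[OF assms] by blast
qed

section \<open>The field \<open>H\<close> and the action of \<open>\<sigma>\<close> on
  coefficients\<close>

abbreviation H :: "'c set" where "H \<equiv> field_H \<iota> \<eta>"

lemma H_subfield: "is_subfield H"
  unfolding field_H_def by (rule hull_in) (auto simp: is_subfield_def)

lemma H_iota [simp]: "\<iota> x \<in> H" and H_eta [simp]: "\<eta> \<in> H"
  using hull_subset[of "insert \<eta> (range \<iota>)" is_subfield] by (auto simp: field_H_def)

lemma H_0 [simp]: "0 \<in> H" and H_1 [simp]: "1 \<in> H"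
  using H_iota[of 0] H_iota[of 1] by (simp_all add: iota_one)

lemma H_diff [simp]: "x \<in> H \<Longrightarrow> y \<in> H \<Longrightarrow> x - y \<in> H"
  and H_mult [simp]: "x \<in> H \<Longrightarrow> y \<in> H \<Longrightarrow> x * y \<in> H"
  and H_inverse [simp]: "x \<in> H \<Longrightarrow> inverse x \<in> H"
  using H_subfield by (auto simp: is_subfield_def)

lemma H_add [simp]: "x \<in> H \<Longrightarrow> y \<in> H \<Longrightarrow> x + y \<in> H"
  using H_diff[OF _ H_diff[OF H_0], of x y] by simp

lemma H_divide [simp]: "x \<in> H \<Longrightarrow> y \<in> H \<Longrightarrow> x / y \<in> H"
  by (simp add: divide_inverse)

lemma H_power [simp]: "x \<in> H \<Longrightarrow> x ^ n \<in> H"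
  by (induction n) auto

lemma H_sum: "(\<And>i. i \<in> I \<Longrightarrow> f i \<in> H) \<Longrightarrow> (\<Sum>i\<in>I. f i) \<in> H"
  and H_prod: "(\<And>i. i \<in> I \<Longrightarrow> f i \<in> H) \<Longrightarrow> (\<Prod>i\<in>I. f i) \<in> H"
  by (induction I rule: infinite_finite_induct) auto

lemma H_theta [simp]: "\<theta> \<in> H"
  by (simp add: theta_def)

lemma H_thetaF [simp]: "thetaF n \<in> H" and H_etaF [simp]: "etaF n \<in> H"
  by (simp_all add: thetaF_def etaF_def)

lemma H_shtuka_value [simp]: "shtuka_value k l n \<in> H"
  by (simp add: shtuka_value_def)

lemma sigma_pow_H [simp]: "x \<in> H \<Longrightarrow> (\<sigma> ^^ k) x \<in> H"
  using sigma_bij by (induction k) (auto simp: bij_betw_def)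

lemma sigma_pow_add: "x \<in> H \<Longrightarrow> y \<in> H \<Longrightarrow> (\<sigma> ^^ k) (x + y) = (\<sigma> ^^ k) x + (\<sigma> ^^ k) y"
  by (induction k) (auto simp: sigma_add)

lemma sigma_pow_mult: "x \<in> H \<Longrightarrow> y \<in> H \<Longrightarrow> (\<sigma> ^^ k) (x * y) = (\<sigma> ^^ k) x * (\<sigma> ^^ k) y"
  by (induction k) (auto simp: sigma_mult)

lemma sigma_pow_iota [simp]: "(\<sigma> ^^ k) (\<iota> x) = \<iota> x"
  by (induction k) (auto simp: sigma_fixes_K)

lemma sigma_pow_0 [simp]: "(\<sigma> ^^ k) 0 = 0" and sigma_pow_1 [simp]: "(\<sigma> ^^ k) 1 = 1"
  using sigma_pow_iota[of k 0] sigma_pow_iota[of k 1] by (simp_all add: iota_one)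

lemma sigma_pow_diff: "x \<in> H \<Longrightarrow> y \<in> H \<Longrightarrow> (\<sigma> ^^ k) (x - y) = (\<sigma> ^^ k) x - (\<sigma> ^^ k) y"
  using sigma_pow_add[of "x - y" y k] by simp

lemma sigma_pow_divide: "x \<in> H \<Longrightarrow> y \<in> H \<Longrightarrow> y \<noteq> 0 \<Longrightarrow> (\<sigma> ^^ k) (x / y) = (\<sigma> ^^ k) x / (\<sigma> ^^ k) y"
  using sigma_pow_mult[of "x / y" y k] sigma_pow_mult[of "inverse y" y k]
  by (cases "(\<sigma> ^^ k) y = 0") (auto simp: field_simps)

lemma sigma_pow_power: "x \<in> H \<Longrightarrow> (\<sigma> ^^ k) (x ^ n) = (\<sigma> ^^ k) x ^ n"
  by (induction n) (auto simp: sigma_pow_mult)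

lemma sigma_pow_sum:
  "(\<And>i. i \<in> I \<Longrightarrow> f i \<in> H) \<Longrightarrow> (\<sigma> ^^ k) (\<Sum>i\<in>I. f i) = (\<Sum>i\<in>I. (\<sigma> ^^ k) (f i))"
  by (induction I rule: infinite_finite_induct) (auto simp: sigma_pow_add H_sum)

lemma sigma_pow_prod:
  "(\<And>i. i \<in> I \<Longrightarrow> f i \<in> H) \<Longrightarrow> (\<sigma> ^^ k) (\<Prod>i\<in>I. f i) = (\<Prod>i\<in>I. (\<sigma> ^^ k) (f i))"
  by (induction I rule: infinite_finite_induct) (auto simp: sigma_pow_mult H_prod)

lemma sigma_pow_etaF: "(\<sigma> ^^ k) (etaF n) = etaF (n + k)"
proof (induction k)
  case (Suc k)
  have "\<sigma> (\<eta> ^ m) = (\<eta> ^ CARD('k)) ^ m" for m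
    using sigma_pow_power[of \<eta> 1 m] by (simp add: sigma_eta)
  then have "\<sigma> (etaF (n + k)) = etaF (Suc (n + k))"
    by (simp add: etaF_def flip: power_mult)
  with Suc show ?case
    by simp
qed simp

lemma sigma_pow_thetaF: "(\<sigma> ^^ k) (thetaF n) = thetaF n"
  by (simp add: thetaF_def sigma_pow_power) (simp add: theta_def)

lemma sigma_pow_shtuka_value: "(\<sigma> ^^ k) (shtuka_value 0 l n) = shtuka_value k l n"
  using thetaF_etaF_nz[of n l] thetaF_etaF_nz[of l l]
  by (simp add: shtuka_value_def sigma_pow_diff sigma_pow_divide sigma_pow_thetaF sigma_pow_etaF)

lemma Theta_conj_eq: "Theta_conj \<iota> \<eta> \<sigma> k = 1 / (\<theta> - etaF k)"
  using theta_etaF_nz[of 0] sigma_pow_etaF[of k 0] sigma_pow_thetaF[of k 0]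
  by (simp add: Theta_conj_def sigma_pow_divide sigma_pow_diff)

text \<open>The recursion for the coefficients stays inside \<open>H\<close>. This is essential
  because \<open>\<sigma>\<close> is a homomorphism only there.\<close>

lemma coeff_drinfeld_Psi_in_H:
  assumes "a \<in> ring_A \<rho>"
  shows "coeff (drinfeld_Psi \<iota> \<eta> a) n \<in> H"
proof (induction n rule: less_induct)
  case (less n)
  then show ?case
    by (subst expansion_coeff[OF drinfeld_Psi_expansion[OF assms]])
       (intro H_divide H_diff H_sum H_mult H_prod H_power; simp)
qed

text \<open>Applies \<open>\<sigma> ^ k\<close> to the evaluated expansion: the left side is
  conjugated term by term, and the value in \<open>K\<close> is fixed. In this form the conjugated
  module enters the functional equation of the exponential.\<close>

lemma drinfeld_Psi_conj_eval:
  assumes "a \<in> ring_A \<rho>"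
  shows "(\<Sum>i\<le>degree (drinfeld_Psi \<iota> \<eta> a). (\<sigma> ^^ k) (coeff (drinfeld_Psi \<iota> \<eta> a) i) *
    (\<Prod>l<i. shtuka_value k l n)) = \<iota> a ^ (CARD('k) ^ n)"
proof -
  let ?c = "drinfeld_Psi \<iota> \<eta> a"
  have "\<iota> a ^ (CARD('k) ^ n) = (\<sigma> ^^ k) (\<iota> a ^ (CARD('k) ^ n))"
    by (simp add: sigma_pow_power)
  also have "\<dots> = (\<sigma> ^^ k) (\<Sum>i\<le>degree ?c. coeff ?c i * (\<Prod>l<i. shtuka_value 0 l n))"
    using expansion_eval[OF drinfeld_Psi_expansion[OF assms]] by simp
  also have "\<dots> = (\<Sum>i\<le>degree ?c. (\<sigma> ^^ k) (coeff ?c i * (\<Prod>l<i. shtuka_value 0 l n)))"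
    by (intro sigma_pow_sum H_mult H_prod coeff_drinfeld_Psi_in_H assms H_shtuka_value)
  also have "\<dots> = (\<Sum>i\<le>degree ?c. (\<sigma> ^^ k) (coeff ?c i) * (\<Prod>l<i. shtuka_value k l n))"
    by (simp add: sigma_pow_mult sigma_pow_prod sigma_pow_shtuka_value H_prod coeff_drinfeld_Psi_in_H assms)
  finally show ?thesis ..
qed

lemma tau_apply_Psi_conj:
  "tau_apply CARD('k) (drinfeld_Psi_conj \<iota> \<eta> \<sigma> k a) z =
    (\<Sum>i\<le>degree (drinfeld_Psi \<iota> \<eta> a). (\<sigma> ^^ k) (coeff (drinfeld_Psi \<iota> \<eta> a) i) * z ^ (CARD('k) ^ i))"
  unfolding tau_apply_def drinfeld_Psi_conj_def
proof -
  let ?c = "drinfeld_Psi \<iota> \<eta> a"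
  let ?d = "map_poly (\<sigma> ^^ k) ?c"
  have "(\<Sum>i\<le>degree ?d. coeff ?d i * z ^ (CARD('k) ^ i)) = (\<Sum>i\<le>degree ?c. coeff ?d i * z ^ (CARD('k) ^ i))"
    by (intro sum.mono_neutral_left) (auto simp: map_poly_degree_leq coeff_eq_0)
  then show "(\<Sum>i\<le>degree ?d. coeff ?d i * z ^ (CARD('k) ^ i)) =
      (\<Sum>i\<le>degree ?c. (\<sigma> ^^ k) (coeff ?c i) * z ^ (CARD('k) ^ i))"
    by (simp add: coeff_map_poly)
qed

subsection \<open>The exponential function\<close>

lemma LIMSEQ_frob:
  fixes X :: "nat \<Rightarrow> 'c"
  assumes "X \<longlonglongrightarrow> L"
  shows "(\<lambda>n. X n ^ (CARD('k) ^ i)) \<longlonglongrightarrow> L ^ (CARD('k) ^ i)"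
proof -
  have "(\<lambda>n. eta_abs (X n - L) ^ (CARD('k) ^ i)) \<longlonglongrightarrow> 0 ^ (CARD('k) ^ i)"
    using assms unfolding LIMSEQ_av by (rule tendsto_power)
  then show ?thesis
    using q_ge_2 by (simp add: LIMSEQ_av av_power power_0_left flip: frob_diff)
qed

lemma sums_frob:
  fixes f :: "nat \<Rightarrow> 'c"
  assumes "f sums s"
  shows "(\<lambda>n. f n ^ (CARD('k) ^ i)) sums (s ^ (CARD('k) ^ i))"
  using LIMSEQ_frob[OF assms[unfolded sums_def], of i] by (simp add: sums_def frob_sum)

lemma eta_abs_uniformizer_power: "eta_abs ((\<theta> - \<eta>) ^ n) = (1 / real CARD('k)) ^ n"
  by (simp add: av_power eta_abs_uniformizer)

lemma uniformizer_nz: "\<theta> - \<eta> \<noteq> 0"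
  using theta_etaF_nz[of 0] by simp

text \<open>Powers of the uniformizer supply nonzero arguments of arbitrarily small absolute
  value.\<close>

lemma le_mult_eta_abs_imp_zero:
  fixes x :: 'c
  assumes "\<And>n. n \<ge> n0 \<Longrightarrow> eta_abs x \<le> K * eta_abs ((\<theta> - \<eta>) ^ n)"
  shows "x = 0"
proof -
  have "(\<lambda>n. (1 / real CARD('k)) ^ n) \<longlonglongrightarrow> 0"
    by (rule LIMSEQ_power_zero) (use q_inv in auto)
  then have "(\<lambda>n. K * eta_abs ((\<theta> - \<eta>) ^ n)) \<longlonglongrightarrow> K * 0"
    unfolding eta_abs_uniformizer_power by (rule tendsto_mult_left)
  then have "eta_abs x \<le> K * 0"
    using assms by (intro LIMSEQ_le_const) auto
  then show ?thesis
    using av_nonneg[of x] by (simp add: antisym)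
qed

lemma eta_abs_ev_rho: "eta_abs (ev \<rho> \<theta>) = 1 / real CARD('k)"
proof -
  have "ev \<rho> \<theta> = (\<Prod>i<N. \<theta> - etaF i)"
    by (simp add: ev_def map_poly_rho_eq poly_prod)
  then have "eta_abs (ev \<rho> \<theta>) = (\<Prod>i<N. if N dvd i then 1 / real CARD('k) else 1)"
    by (simp add: av_prod eta_abs_theta_etaF)
  also have "\<dots> = (\<Prod>i\<in>{0}. if N dvd i then 1 / real CARD('k) else 1)"
    using rho_degree by (intro prod.mono_neutral_right) (auto dest: dvd_imp_le)
  finally show ?thesis
    by simp
qed

lemma is_drinfeld_exp_series:
  assumes "is_drinfeld_exp \<iota> \<rho> \<eta> \<sigma> k e"
  obtains a where "\<And>z. (\<lambda>n. a n * z ^ n) sums e z" "a 0 = 0" "a 1 = 1"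
proof -
  obtain a where a: "\<And>z. (\<lambda>n. a n * z ^ n) sums e z"
    using assms by (auto simp: is_drinfeld_exp_def entire_def)
  have add: "e (x + y) = e x + e y" for x y
    using assms by (simp add: is_drinfeld_exp_def)
  have e0: "e 0 = 0"
    using add[of 0 0] by (metis add_0 add_right_cancel)
  have "(\<lambda>n. a n * 0 ^ n) sums a 0"
    using sums_finite[of "{0}" "\<lambda>n. a n * 0 ^ n"] by (simp add: power_0_left)
  then have a0: "a 0 = 0"
    using sums_unique2[OF a[of 0]] e0 by simp
  obtain B where B: "B \<ge> 0" "\<And>z. eta_abs z \<le> 1 \<Longrightarrow> eta_abs (e z - a 1 * z ^ 1) \<le> B * eta_abs z ^ Suc 1"
    using power_series_leading_term[of a e 1] a a0 by (metis less_one)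
  have "a 1 - 1 = 0"
  proof (rule ccontr)
    assume ne: "a 1 - 1 \<noteq> 0"
    define r where "r = eta_abs (a 1 - 1)"
    have "r > 0"
      using ne by (simp add: r_def)
    have "((\<lambda>z. (e z - e 0) / z) \<longlongrightarrow> 1) (at 0)"
      using assms by (simp add: is_drinfeld_exp_def)
    from metric_LIM_D[OF this \<open>r > 0\<close>] obtain s where
      s: "s > 0" "\<And>x. x \<noteq> 0 \<Longrightarrow> dist x 0 < s \<Longrightarrow> dist ((e x - e 0) / x) 1 < r"
      by auto
    \<comment> \<open>For nonzero \<open>x\<close> with \<open>|x| < b\<close> the difference
      quotient is within \<open>r\<close> of 1 by the limit, and within \<open>r\<close> of
      \<open>a 1\<close> by the power series; together these would give
      \<open>|a 1 - 1| < r = |a 1 - 1|\<close>.\<close>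
    define b where "b = min s (r / (B + 1))"
    have "b > 0"
      using s(1) \<open>r > 0\<close> B(1) by (simp add: b_def)
    then obtain n where n: "(1 / real CARD('k)) ^ n < b"
      using real_arch_pow_inv[of b "1 / real CARD('k)"] q_inv by auto
    define x where "x = (\<theta> - \<eta>) ^ n"
    have x: "x \<noteq> 0" "eta_abs x < b" "eta_abs x \<le> 1"
      using n uniformizer_nz q_inv by (auto simp: x_def eta_abs_uniformizer_power power_le_one)
    have "eta_abs (e x / x - 1) < r"
      using s(2)[OF x(1)] x(2) e0 by (simp add: dist_av b_def)
    moreover have "eta_abs (a 1 - e x / x) < r"
    proof -
      have "a 1 - e x / x = - ((e x - a 1 * x ^ 1) / x)"
        using x(1) by (simp add: field_simps)
      then have "eta_abs (a 1 - e x / x) = eta_abs (e x - a 1 * x ^ 1) / eta_abs x"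
        by (simp only: av_minus av_divide)
      also have "\<dots> \<le> B * eta_abs x ^ Suc 1 / eta_abs x"
        using B(2)[OF x(3)] by (intro divide_right_mono) auto
      also have "\<dots> = B * eta_abs x"
        using x(1) by simp
      also have "\<dots> \<le> (B + 1) * eta_abs x"
        by (intro mult_right_mono) auto
      also have "\<dots> < r"
        using x(2) B(1) by (simp add: b_def field_simps)
      finally show ?thesis .
    qed
    ultimately have "eta_abs ((a 1 - e x / x) + (e x / x - 1)) < r"
      using av_add_le[of "a 1 - e x / x" "e x / x - 1"] by linarith
    then show False
      by (simp add: r_def)
  qed
  then have "a 1 = 1"
    by simp
  with a a0 show ?thesis
    by (rule that)
qed

text \<open>The leading term \<open>b z ^ m\<close> of the difference of two exponentials has \<open>m \<ge> 2\<close>; comparing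
  leading terms in the functional equation for \<open>a = 1 / \<rho>\<close> gives \<open>b (\<alpha> ^ m - \<alpha>) = 0\<close> with
  \<open>\<alpha> = 1 / \<rho>(\<theta>)\<close> of absolute value \<open>q > 1\<close>.\<close>

lemma is_drinfeld_exp_unique:
  assumes e: "is_drinfeld_exp \<iota> \<rho> \<eta> \<sigma> k e" and e': "is_drinfeld_exp \<iota> \<rho> \<eta> \<sigma> k e'"
  shows "e = e'"
proof -
  obtain a where a: "\<And>z. (\<lambda>n. a n * z ^ n) sums e z" "a 0 = 0" "a 1 = 1"
    using is_drinfeld_exp_series[OF e] by blast
  obtain a' where a': "\<And>z. (\<lambda>n. a' n * z ^ n) sums e' z" "a' 0 = 0" "a' 1 = 1"
    using is_drinfeld_exp_series[OF e'] by blast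
  define b where "b n = a n - a' n" for n
  define d where "d z = e z - e' z" for z
  have d: "(\<lambda>n. b n * z ^ n) sums d z" for z
    using sums_av_diff[OF a(1) a'(1)] by (simp add: b_def d_def left_diff_distrib)
  define T where "T = Fract 1 (\<rho> ^ 1)"
  have T: "T \<in> ring_A \<rho>"
    unfolding T_def ring_A_eq by (rule pole_spaceI) simp
  define \<alpha> where "\<alpha> = \<iota> T"
  have abs_\<alpha>: "eta_abs \<alpha> = real CARD('k)"
    using eta_abs_ev_rho by (simp add: \<alpha>_def T_def iota_Fract av_divide)
  define D where "D = degree (drinfeld_Psi \<iota> \<eta> T)"
  define c where "c i = (\<sigma> ^^ k) (coeff (drinfeld_Psi \<iota> \<eta> T) i)" for i
  have fe: "d (\<alpha> * z) = (\<Sum>i\<le>D. c i * d z ^ (CARD('k) ^ i))" for z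
  proof -
    have "e (\<alpha> * z) = (\<Sum>i\<le>D. c i * e z ^ (CARD('k) ^ i))"
      "e' (\<alpha> * z) = (\<Sum>i\<le>D. c i * e' z ^ (CARD('k) ^ i))"
      using e e' T tau_apply_Psi_conj[of k T]
      unfolding is_drinfeld_exp_def \<alpha>_def c_def D_def by metis+
    then show ?thesis
      by (simp add: d_def frob_diff right_diff_distrib flip: sum_subtractf)
  qed
  \<comment> \<open>At \<open>n = 0\<close> all basis values of positive index vanish, so only the
    constant coefficient survives.\<close>
  have c0: "c 0 = \<alpha>"
  proof -
    have "(\<Sum>i\<le>D. c i * (\<Prod>l<i. shtuka_value k l 0)) = \<alpha>"
      using drinfeld_Psi_conj_eval[OF T, of k 0] by (simp add: c_def D_def \<alpha>_def)
    moreover have "(\<Sum>i\<le>D. c i * (\<Prod>l<i. shtuka_value k l 0)) = (\<Sum>i\<in>{0}. c i * (\<Prod>l<i. shtuka_value k l 0))"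
      by (rule sum.mono_neutral_right) (auto simp: prod_shtuka_value_eq_0)
    ultimately show ?thesis
      by simp
  qed
  have "b n = 0" for n
  proof (rule ccontr)
    assume "b n \<noteq> 0"
    define m where "m = (LEAST n. b n \<noteq> 0)"
    have bm: "b m \<noteq> 0"
      unfolding m_def by (rule LeastI) fact
    have bl: "b i = 0" if "i < m" for i
      using not_less_Least[of i "\<lambda>n. b n \<noteq> 0"] that by (auto simp: m_def)
    have "b 0 = 0" "b 1 = 0"
      using a a' by (auto simp: b_def)
    with bm have m: "m \<ge> 2"
      by (metis One_nat_def less_2_cases not_le)
    obtain B where B: "B \<ge> 0" "\<And>z. eta_abs z \<le> 1 \<Longrightarrow> eta_abs (d z - b m * z ^ m) \<le> B * eta_abs z ^ Suc m"
      using power_series_leading_term[of b d m] d bl by blast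
    define C where "C = max (eta_abs (b m)) B"
    define S where "S = (\<Sum>i\<le>D. eta_abs (c i))"
    \<comment> \<open>The three entries bound the three errors of order \<open>|z| ^ (m + 1)\<close>
      below: the remainder at \<open>\<alpha> z\<close>, \<open>\<alpha>\<close> times the remainder
      at \<open>z\<close>, and the higher Frobenius terms, which are at most of order
      \<open>|z| ^ (2 m)\<close> because \<open>q \<ge> 2\<close>.\<close>
    define K where "K = max (max (B * real CARD('k) ^ Suc m) (real CARD('k) * B)) (S * C ^ 2)"
    have "C \<ge> 0" "S \<ge> 0"
      by (auto simp: C_def S_def sum_nonneg le_max_iff_disj)
    have bound: "eta_abs (b m * (\<alpha> ^ m - \<alpha>)) \<le> K * eta_abs z"
      if z: "z \<noteq> 0" "eta_abs z \<le> 1 / real CARD('k)" "C * eta_abs z \<le> 1" for z :: 'c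
    proof -
      have z1: "eta_abs z \<le> 1" "eta_abs (\<alpha> * z) \<le> 1"
        using z(2) q_inv(2) q_ge_2 by (linarith, simp add: av_mult abs_\<alpha> field_simps)
      have dz: "eta_abs (d z) \<le> C * eta_abs z ^ m"
      proof -
        have "eta_abs (b m * z ^ m) \<le> C * eta_abs z ^ m"
          by (simp add: av_mult av_power C_def mult_right_mono)
        moreover have "B * eta_abs z ^ Suc m \<le> C * eta_abs z ^ m"
          using z1(1) B(1) by (intro mult_mono power_decreasing) (auto simp: C_def)
        ultimately show ?thesis
          using av_add_le[of "d z - b m * z ^ m" "b m * z ^ m"] B(2)[OF z1(1)] by simp
      qed
      have dz1: "eta_abs (d z) \<le> 1"
      proof -
        have "C * eta_abs z ^ m \<le> C * eta_abs z ^ 1"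
          using z1(1) m \<open>C \<ge> 0\<close> by (intro mult_left_mono power_decreasing) auto
        then show ?thesis
          using dz z(3) by simp
      qed
      have 1: "eta_abs (b m * (\<alpha> * z) ^ m - d (\<alpha> * z)) \<le> K * eta_abs z ^ Suc m"
      proof -
        have "eta_abs (b m * (\<alpha> * z) ^ m - d (\<alpha> * z)) \<le> B * eta_abs (\<alpha> * z) ^ Suc m"
          using B(2)[OF z1(2)] by (subst av_minus_commute)
        also have "\<dots> = (B * real CARD('k) ^ Suc m) * eta_abs z ^ Suc m"
          by (simp add: av_mult abs_\<alpha> power_mult_distrib)
        also have "\<dots> \<le> K * eta_abs z ^ Suc m"
          by (intro mult_right_mono) (auto simp: K_def)
        finally show ?thesis .
      qed
      have 2: "eta_abs (\<alpha> * (d z - b m * z ^ m)) \<le> K * eta_abs z ^ Suc m"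
      proof -
        have "eta_abs (\<alpha> * (d z - b m * z ^ m)) \<le> real CARD('k) * (B * eta_abs z ^ Suc m)"
          unfolding av_mult abs_\<alpha> using B(2)[OF z1(1)] by (intro mult_left_mono) auto
        also have "\<dots> = (real CARD('k) * B) * eta_abs z ^ Suc m"
          by simp
        also have "\<dots> \<le> K * eta_abs z ^ Suc m"
          by (intro mult_right_mono) (auto simp: K_def)
        finally show ?thesis .
      qed
      have 3: "eta_abs (\<Sum>i\<in>{1..D}. c i * d z ^ (CARD('k) ^ i)) \<le> K * eta_abs z ^ Suc m"
      proof (rule av_sum_le)
        have "K \<ge> 0"
          using B(1) by (simp add: K_def le_max_iff_disj)
        then show "0 \<le> K * eta_abs z ^ Suc m"
          by simp
        fix i assume i: "i \<in> {1..D}"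
        have "eta_abs (c i) \<le> S"
          unfolding S_def using i by (intro member_le_sum) auto
        moreover have "eta_abs (d z ^ (CARD('k) ^ i)) \<le> C ^ 2 * eta_abs z ^ Suc m"
        proof -
          have "CARD('k) ^ 1 \<le> CARD('k) ^ i"
            using i q_ge_2 by (intro power_increasing) auto
          then have "eta_abs (d z) ^ (CARD('k) ^ i) \<le> eta_abs (d z) ^ 2"
            using dz1 q_ge_2 by (intro power_decreasing) auto
          also have "\<dots> \<le> (C * eta_abs z ^ m) ^ 2"
            using dz by (intro power_mono) auto
          also have "\<dots> = C ^ 2 * eta_abs z ^ (m * 2)"
            by (simp add: power_mult_distrib flip: power_mult)
          also have "\<dots> \<le> C ^ 2 * eta_abs z ^ Suc m"
            using z1(1) m by (intro mult_left_mono power_decreasing) auto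
          finally show ?thesis
            by (simp only: av_power)
        qed
        ultimately have "eta_abs (c i * d z ^ (CARD('k) ^ i)) \<le> S * (C ^ 2 * eta_abs z ^ Suc m)"
          unfolding av_mult using \<open>S \<ge> 0\<close> by (intro mult_mono) auto
        also have "\<dots> \<le> K * eta_abs z ^ Suc m"
          unfolding mult.assoc[symmetric] by (intro mult_right_mono) (auto simp: K_def)
        finally show "eta_abs (c i * d z ^ (CARD('k) ^ i)) \<le> K * eta_abs z ^ Suc m" .
      qed
      have "{..D} = insert 0 {1..D}"
        by auto
      then have split: "d (\<alpha> * z) = \<alpha> * d z + (\<Sum>i\<in>{1..D}. c i * d z ^ (CARD('k) ^ i))"
        using fe[of z] c0 by simp
      have "b m * (\<alpha> ^ m - \<alpha>) * z ^ m = (b m * (\<alpha> * z) ^ m - d (\<alpha> * z)) +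
          (\<alpha> * (d z - b m * z ^ m) + (\<Sum>i\<in>{1..D}. c i * d z ^ (CARD('k) ^ i)))"
        unfolding split by (simp add: algebra_simps power_mult_distrib)
      also have "eta_abs \<dots> \<le> K * eta_abs z ^ Suc m"
        by (intro order.trans[OF av_add_le] max.boundedI 1 2 3)
      finally have "eta_abs (b m * (\<alpha> ^ m - \<alpha>) * z ^ m) \<le> K * eta_abs z ^ Suc m" .
      then have "eta_abs (b m * (\<alpha> ^ m - \<alpha>)) * eta_abs z ^ m \<le> (K * eta_abs z) * eta_abs z ^ m"
        by (simp add: av_mult av_power mult_ac)
      then show ?thesis
        using z(1) by simp
    qed
    have "b m * (\<alpha> ^ m - \<alpha>) = 0"
    proof -
      have "1 / (C + 1) > 0"
        using \<open>C \<ge> 0\<close> by simp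
      then obtain n0 where n0: "(1 / real CARD('k)) ^ n0 < 1 / (C + 1)"
        using real_arch_pow_inv[of "1 / (C + 1)" "1 / real CARD('k)"] q_inv by auto
      show ?thesis
      proof (rule le_mult_eta_abs_imp_zero)
        fix n assume n: "n \<ge> max n0 1"
        let ?z = "(\<theta> - \<eta>) ^ n"
        have z1: "eta_abs ?z \<le> (1 / real CARD('k)) ^ 1"
          unfolding eta_abs_uniformizer_power using n q_inv by (intro power_decreasing) auto
        have "eta_abs ?z \<le> (1 / real CARD('k)) ^ n0"
          unfolding eta_abs_uniformizer_power using n q_inv by (intro power_decreasing) auto
        then have "(C + 1) * eta_abs ?z \<le> (C + 1) * (1 / (C + 1))"
          using n0 \<open>C \<ge> 0\<close> by (intro mult_left_mono) auto
        moreover have "C * eta_abs ?z \<le> (C + 1) * eta_abs ?z"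
          by (intro mult_right_mono) auto
        ultimately have "C * eta_abs ?z \<le> 1"
          using \<open>C \<ge> 0\<close> by simp
        with z1 show "eta_abs (b m * (\<alpha> ^ m - \<alpha>)) \<le> K * eta_abs ?z"
          using uniformizer_nz by (intro bound) auto
      qed
    qed
    with bm have "\<alpha> ^ m = \<alpha>"
      by simp
    then have "real CARD('k) ^ m = real CARD('k) ^ 1"
      using abs_\<alpha> by (metis av_power power_one_right)
    then show False
      using m q_ge_2 by (subst (asm) power_inject_exp) auto
  qed
  then have "(\<lambda>n. 0) sums d z" for z
    using d[of z] by simp
  then have "d z = 0" for z
    using sums_unique2 sums_zero by metis
  then show ?thesis
    by (auto simp: d_def fun_eq_iff)
qed

section \<open>Construction of the exponential series\<close>

definition exp_denom :: "nat \<Rightarrow> nat \<Rightarrow> 'c" where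
  "exp_denom k n = (\<Prod>l<n. shtuka_value k l n)"

lemma exp_denom_nz [simp]: "exp_denom k n \<noteq> 0"
  by (auto simp: exp_denom_def shtuka_value_eq_0_iff)

text \<open>Frobenius shifts both indices of \<open>shtuka_value\<close>, so the last
  \<open>n - i\<close> factors form a Frobenius power of a smaller denominator. This matches the
  \<open>n\<close>-th term of the exponential with \<open>\<tau> ^ i\<close> applied to its
  \<open>(n - i)\<close>-th term.\<close>

lemma exp_denom_split:
  assumes "i \<le> n"
  shows "exp_denom k n = (\<Prod>l<i. shtuka_value k l n) * exp_denom k (n - i) ^ (CARD('k) ^ i)"
proof -
  have "exp_denom k n = (\<Prod>l<i. shtuka_value k l n) * (\<Prod>l\<in>{i..<n}. shtuka_value k l n)"
    using assms by (simp add: exp_denom_def lessThan_atLeast0 prod.atLeastLessThan_concat)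
  also have "(\<Prod>l\<in>{i..<n}. shtuka_value k l n) = (\<Prod>l\<in>{0..<n - i}. shtuka_value k (l + i) n)"
    using prod.shift_bounds_nat_ivl[of "\<lambda>l. shtuka_value k l n" 0 i "n - i"] assms by simp
  also have "\<dots> = exp_denom k (n - i) ^ (CARD('k) ^ i)"
    using shtuka_value_frob[of k _ i "n - i"] assms
    by (simp add: exp_denom_def lessThan_atLeast0 prod_power_distrib)
  finally show ?thesis .
qed

text \<open>The exponential as an ordinary power series over all exponents, which is the form that
  \<open>entire\<close> and Strassmann's bound refer to.\<close>

definition exp_coeff :: "nat \<Rightarrow> nat \<Rightarrow> 'c" where
  "exp_coeff k m = (if m \<in> range (\<lambda>n. CARD('k) ^ n)
    then 1 / exp_denom k (inv (\<lambda>n. CARD('k) ^ n) m) else 0)"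

lemma strict_mono_q_power: "strict_mono (\<lambda>n. CARD('k) ^ n)"
  using q_ge_2 by (intro strict_monoI power_strict_increasing) auto

lemma exp_coeff_q_power: "exp_coeff k (CARD('k) ^ n) = 1 / exp_denom k n"
  using inv_f_f[OF strict_mono_imp_inj_on[OF strict_mono_q_power], of n] by (simp add: exp_coeff_def)

text \<open>Convergence is a hypothesis at this point; the size of the denominators is read off from
  residues later, in \<open>exp_terms_LIMSEQ\<close>. In the functional equation, the part of degree
  \<open>q ^ n\<close> coming from \<open>c i \<tau> ^ i\<close> is the \<open>n\<close>-th term of
  the exponential times \<open>c i\<close> times the \<open>i\<close>-th basis value at
  \<open>x_n\<close>; by \<open>drinfeld_Psi_conj_eval\<close> these factors add up to
  \<open>\<iota> a ^ q ^ n\<close>.\<close>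

lemma drinfeld_exp_exists:
  assumes conv: "\<And>z. (\<lambda>n. eta_abs (z ^ (CARD('k) ^ n) / exp_denom k n)) \<longlonglongrightarrow> 0"
  shows is_drinfeld_exp_drinfeld_exp: "is_drinfeld_exp \<iota> \<rho> \<eta> \<sigma> k (drinfeld_exp \<iota> \<rho> \<eta> \<sigma> k)"
    and drinfeld_exp_sums: "(\<lambda>n. z ^ (CARD('k) ^ n) / exp_denom k n) sums drinfeld_exp \<iota> \<rho> \<eta> \<sigma> k z"
    and drinfeld_exp_series: "(\<lambda>n. exp_coeff k n * z ^ n) sums drinfeld_exp \<iota> \<rho> \<eta> \<sigma> k z"
proof -
  define e where "e z = (\<Sum>n. z ^ (CARD('k) ^ n) / exp_denom k n)" for z
  have e: "(\<lambda>n. z ^ (CARD('k) ^ n) / exp_denom k n) sums e z" for z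
    unfolding e_def by (rule summable_sums) (intro summable_if_av conv)
  have series: "(\<lambda>n. exp_coeff k n * z ^ n) sums e z" for z
  proof -
    have "(\<lambda>n. exp_coeff k (CARD('k) ^ n) * z ^ (CARD('k) ^ n)) sums e z"
      using e[of z] by (simp only: exp_coeff_q_power) (simp add: divide_inverse mult.commute)
    then show ?thesis
      by (subst (asm) sums_mono_reindex[of "\<lambda>n. CARD('k) ^ n" "\<lambda>n. exp_coeff k n * z ^ n", OF strict_mono_q_power])
         (auto simp: exp_coeff_def)
  qed
  have add: "e (x + y) = e x + e y" for x y
    using sums_unique2[OF e[of "x + y"]] sums_av_add[OF e[of x] e[of y]]
    by (simp add: frob_add add_divide_distrib)
  have lin: "e (const_emb \<iota> c * x) = const_emb \<iota> c * e x" for c x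
    using sums_unique2[OF e[of "const_emb \<iota> c * x"]] sums_av_cmult[OF e[of x], of "const_emb \<iota> c"]
    by (simp add: power_mult_distrib const_emb_frob)
  have e0: "e 0 = 0"
    using add[of 0 0] by (metis add_0 add_right_cancel)
  have b0: "exp_coeff k 0 = 0"
    by (auto simp: exp_coeff_def)
  have b1: "exp_coeff k 1 = 1"
    using exp_coeff_q_power[of k 0] by (simp add: exp_denom_def)
  obtain B where B: "B \<ge> 0" "\<And>z. eta_abs z \<le> 1 \<Longrightarrow> eta_abs (e z - exp_coeff k 1 * z ^ 1) \<le> B * eta_abs z ^ Suc 1"
    using power_series_leading_term[of "exp_coeff k" e 1] series b0 by (metis less_one)
  have deriv: "((\<lambda>z. (e z - e 0) / z) \<longlongrightarrow> 1) (at 0)"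
  proof (rule metric_LIM_I)
    fix r :: real assume "r > 0"
    define s where "s = min 1 (r / (B + 1))"
    have "s > 0"
      using \<open>r > 0\<close> B(1) by (simp add: s_def)
    moreover have "dist ((e x - e 0) / x) 1 < r" if x: "x \<noteq> 0" "dist x 0 < s" for x
    proof -
      have xs: "eta_abs x < s"
        using x(2) by (simp add: dist_av)
      then have x1: "eta_abs x \<le> 1"
        by (simp add: s_def)
      have "(e x - e 0) / x - 1 = (e x - exp_coeff k 1 * x ^ 1) / x"
        using x(1) e0 b1 by (simp add: field_simps)
      then have "eta_abs ((e x - e 0) / x - 1) = eta_abs (e x - exp_coeff k 1 * x ^ 1) / eta_abs x"
        by (simp only: av_divide)
      also have "\<dots> \<le> B * eta_abs x ^ Suc 1 / eta_abs x"
        using B(2)[OF x1] by (intro divide_right_mono) auto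
      also have "\<dots> = B * eta_abs x"
        using x(1) by simp
      also have "\<dots> \<le> (B + 1) * eta_abs x"
        by (intro mult_right_mono) auto
      also have "\<dots> < r"
        using xs B(1) by (simp add: s_def field_simps)
      finally show ?thesis
        by (simp add: dist_av)
    qed
    ultimately show "\<exists>s>0. \<forall>x. x \<noteq> 0 \<and> dist x 0 < s \<longrightarrow> dist ((e x - e 0) / x) 1 < r"
      by blast
  qed
  have fe: "tau_apply CARD('k) (drinfeld_Psi_conj \<iota> \<eta> \<sigma> k a) (e \<xi>) = e (\<iota> a * \<xi>)"
    if a: "a \<in> ring_A \<rho>" for a \<xi>
  proof -
    define D where "D = degree (drinfeld_Psi \<iota> \<eta> a)"
    define c where "c i = (\<sigma> ^^ k) (coeff (drinfeld_Psi \<iota> \<eta> a) i)" for i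
    \<comment> \<open>The contribution of \<open>c i \<tau> ^ i\<close> to degree
      \<open>q ^ n\<close>. The zeros for \<open>n < i\<close> let all these series share one
      index.\<close>
    define G where "G i n = (if n < i then 0 else
      c i * (\<xi> ^ (CARD('k) ^ (n - i)) / exp_denom k (n - i)) ^ (CARD('k) ^ i))" for i n
    have G: "G i sums (c i * e \<xi> ^ (CARD('k) ^ i))" for i
    proof -
      have "(\<lambda>n. G i (n + i)) sums (c i * e \<xi> ^ (CARD('k) ^ i))"
        using sums_av_cmult[OF sums_frob[OF e[of \<xi>]]] by (simp add: G_def)
      moreover have "strict_mono (\<lambda>n. n + i)"
        by (auto simp: strict_mono_def)
      moreover have "G i n = 0" if "n \<notin> range (\<lambda>n. n + i)" for n
      proof -
        have "n < i"
          using that by (metis le_add_diff_inverse2 not_le rangeI)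
        then show ?thesis
          by (simp add: G_def)
      qed
      ultimately show ?thesis
        using sums_mono_reindex[of "\<lambda>n. n + i" "G i"] by blast
    qed
    \<comment> \<open>The formula also holds for \<open>n < i\<close>, since the product of basis
      values then contains the zero at \<open>l = n\<close>.\<close>
    have G_eq: "G i n = \<xi> ^ (CARD('k) ^ n) / exp_denom k n * (c i * (\<Prod>l<i. shtuka_value k l n))" for i n
    proof (cases "n < i")
      case True
      then show ?thesis
        by (simp add: G_def prod_shtuka_value_eq_0 del: prod_zero_iff)
    next
      case False
      then have *: "exp_denom k n = (\<Prod>l<i. shtuka_value k l n) * exp_denom k (n - i) ^ (CARD('k) ^ i)"
        by (intro exp_denom_split) simp
      have nz: "(\<Prod>l<i. shtuka_value k l n) \<noteq> 0"
        using False by (auto simp: shtuka_value_eq_0_iff)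
      have "(\<xi> ^ (CARD('k) ^ (n - i))) ^ (CARD('k) ^ i) = \<xi> ^ (CARD('k) ^ n)"
        using False by (simp flip: power_mult power_add)
      then show ?thesis
        using False nz by (simp add: G_def * power_divide)
    qed
    have "(\<lambda>n. \<Sum>i\<le>D. G i n) sums (\<Sum>i\<le>D. c i * e \<xi> ^ (CARD('k) ^ i))"
      by (intro sums_av_sum G)
    also have "(\<lambda>n. \<Sum>i\<le>D. G i n) = (\<lambda>n. (\<iota> a * \<xi>) ^ (CARD('k) ^ n) / exp_denom k n)"
    proof
      fix n
      have "(\<Sum>i\<le>D. G i n) = \<xi> ^ (CARD('k) ^ n) / exp_denom k n * \<iota> a ^ (CARD('k) ^ n)"
        unfolding G_eq sum_distrib_left[symmetric]
        using drinfeld_Psi_conj_eval[OF a, of k n] by (simp add: c_def D_def)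
      then show "(\<Sum>i\<le>D. G i n) = (\<iota> a * \<xi>) ^ (CARD('k) ^ n) / exp_denom k n"
        by (simp add: power_mult_distrib mult.commute)
    qed
    finally show ?thesis
      unfolding tau_apply_Psi_conj using sums_unique2[OF e] by (simp add: c_def D_def)
  qed
  have exp: "is_drinfeld_exp \<iota> \<rho> \<eta> \<sigma> k e"
    unfolding is_drinfeld_exp_def entire_def using series add lin deriv fe by blast
  then have "drinfeld_exp \<iota> \<rho> \<eta> \<sigma> k = e"
    unfolding drinfeld_exp_def using is_drinfeld_exp_unique by (intro the_equality) auto
  with exp e series show
    "is_drinfeld_exp \<iota> \<rho> \<eta> \<sigma> k (drinfeld_exp \<iota> \<rho> \<eta> \<sigma> k)"
    "(\<lambda>n. z ^ (CARD('k) ^ n) / exp_denom k n) sums drinfeld_exp \<iota> \<rho> \<eta> \<sigma> k z"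
    "(\<lambda>n. exp_coeff k n * z ^ n) sums drinfeld_exp \<iota> \<rho> \<eta> \<sigma> k z"
    by simp_all
qed

subsection \<open>The period and the kernel\<close>

lemma period_factor_eq:
  assumes "i > 0"
  shows "period_factor \<iota> \<eta> \<sigma> i = (\<theta> - etaF i) / (\<theta> - thetaF i)"
proof -
  have "(1 / a) / (1 / a - 1 / b) = b / (b - a)" if "a \<noteq> 0" "b \<noteq> 0" for a b :: 'c
    using that by (cases "a = b") (auto simp: field_simps)
  from this[OF thetaF_etaF_nz[of i i] theta_etaF_nz[of i]] show ?thesis
    by (simp add: period_factor_def Let_def Theta_conj_eq power_divide frob_diff etaF_def thetaF_def)
qed

lemma eta_abs_period_factor: "i > 0 \<Longrightarrow> eta_abs (period_factor \<iota> \<eta> \<sigma> i) = 1"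
  using theta_etaF_nz[of i] by (simp add: period_factor_eq av_divide eta_abs_theta_thetaF)

definition partial_period :: "nat \<Rightarrow> 'c" where
  "partial_period L = (\<Prod>i<L. period_factor \<iota> \<eta> \<sigma> (Suc i))"

lemma eta_abs_partial_period: "eta_abs (partial_period L) = 1"
  by (simp add: partial_period_def av_prod eta_abs_period_factor)

lemma q_power_gt: "n < CARD('k) ^ n"
  using q_ge_2 less_exp[of n] power_mono[of 2 "CARD('k)" n] by linarith

text \<open>The \<open>i\<close>-th factor differs from 1 by
  \<open>(x_i - eta_i) / (\<theta> - x_i)\<close>, of absolute value at most
  \<open>q ^ (1 - q ^ i)\<close>. All partial products have absolute value 1, so the limit is
  nonzero, as \<open>convergent_prod\<close> demands.\<close>

lemma partial_period_LIMSEQ: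
  shows "convergent_prod (\<lambda>i. period_factor \<iota> \<eta> \<sigma> (Suc i))" (is "convergent_prod ?f")
    and "partial_period \<longlonglongrightarrow> (\<Prod>i. period_factor \<iota> \<eta> \<sigma> (Suc i))"
    and "eta_abs (\<Prod>i. period_factor \<iota> \<eta> \<sigma> (Suc i)) = 1"
proof -
  have "(\<lambda>L. eta_abs (partial_period (Suc L) - partial_period L)) \<longlonglongrightarrow> 0"
  proof (rule tendsto_sandwich[of "\<lambda>_. 0" _ _ "\<lambda>L. (1 / real CARD('k)) ^ L"])
    show "\<forall>\<^sub>F L in sequentially. eta_abs (partial_period (Suc L) - partial_period L) \<le> (1 / real CARD('k)) ^ L"
    proof (rule always_eventually, rule allI)
      fix L
      let ?i = "Suc L"
      have "partial_period ?i - partial_period L = partial_period L * (period_factor \<iota> \<eta> \<sigma> ?i - 1)"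
        by (simp add: partial_period_def algebra_simps)
      moreover have "period_factor \<iota> \<eta> \<sigma> ?i - 1 = (thetaF ?i - etaF ?i) / (\<theta> - thetaF ?i)"
        using theta_thetaF_nz[of ?i] by (simp add: period_factor_eq field_simps)
      ultimately have "eta_abs (partial_period ?i - partial_period L) =
          (1 / real CARD('k)) ^ (CARD('k) ^ ?i) / eta_abs (\<theta> - etaF ?i)"
        by (simp add: av_mult av_divide eta_abs_partial_period eta_abs_thetaF_etaF_same eta_abs_theta_thetaF)
      also have "\<dots> \<le> (1 / real CARD('k)) ^ (CARD('k) ^ ?i) / (1 / real CARD('k))"
        using q_inv by (intro divide_left_mono) (auto simp: eta_abs_theta_etaF)
      also have "\<dots> \<le> (1 / real CARD('k)) ^ Suc L / (1 / real CARD('k))"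
        using q_inv q_power_gt[of ?i] by (intro divide_right_mono power_decreasing) auto
      also have "\<dots> = (1 / real CARD('k)) ^ L"
        by simp
      finally show "eta_abs (partial_period ?i - partial_period L) \<le> (1 / real CARD('k)) ^ L" .
    qed
    show "(\<lambda>L. (1 / real CARD('k)) ^ L) \<longlonglongrightarrow> 0"
      by (rule LIMSEQ_power_zero) (use q_inv in auto)
  qed auto
  then have "convergent partial_period"
    by (rule convergent_if_av_diff)
  then obtain p where p: "partial_period \<longlonglongrightarrow> p"
    by (auto simp: convergent_def)
  then have abs_p: "eta_abs p = 1"
    by (rule av_LIMSEQ_eq) (auto simp: eta_abs_partial_period)
  have "(\<lambda>n. \<Prod>i\<le>n. ?f (i + 0)) \<longlonglongrightarrow> p"
    using LIMSEQ_Suc[OF p] by (simp add: partial_period_def lessThan_Suc_atMost)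
  then have raw: "raw_has_prod ?f 0 p"
    using abs_p by (auto simp: raw_has_prod_def)
  then show "convergent_prod ?f"
    by (auto simp: convergent_prod_def)
  have "prodinf ?f = p"
    using raw by (intro has_prod_unique[symmetric]) (simp add: has_prod_def)
  with p abs_p show "partial_period \<longlonglongrightarrow> prodinf ?f" "eta_abs (prodinf ?f) = 1"
    by simp_all
qed

text \<open>A dominated convergence argument for passing from vanishing truncated sums to a
  vanishing series. The error has finitely many terms that tend to 0 one by one, and a tail made
  small uniformly by the bound \<open>B\<close>; the ultrametric inequality replaces their sum by a
  maximum.\<close>

lemma dominated_convolution_sums:
  fixes a u :: "nat \<Rightarrow> 'c"
  assumes a: "(\<lambda>n. eta_abs (a n) * B ^ (CARD('k) ^ n)) \<longlonglongrightarrow> 0"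
    and u: "u \<longlonglongrightarrow> v" "\<And>n. eta_abs (u n) \<le> B"
    and zero: "\<And>L. L \<ge> L0 \<Longrightarrow> (\<Sum>n\<le>L. a n * u (L - n) ^ (CARD('k) ^ n)) = 0"
  shows "(\<lambda>n. a n * v ^ (CARD('k) ^ n)) sums 0"
proof -
  have v: "eta_abs v \<le> B"
    by (rule av_LIMSEQ_le[OF u(1)]) (rule u(2))
  have "(\<lambda>L. \<Sum>n\<le>L. a n * v ^ (CARD('k) ^ n)) \<longlonglongrightarrow> 0"
    unfolding LIMSEQ_av diff_0_right
  proof (rule order_tendstoI)
    fix r :: real assume "r < 0"
    then show "\<forall>\<^sub>F L in sequentially. r < eta_abs (\<Sum>n\<le>L. a n * v ^ (CARD('k) ^ n))"
      by (intro always_eventually allI) (rule less_le_trans[OF _ av_nonneg])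
  next
    fix r :: real assume "r > 0"
    then have "eventually (\<lambda>n. eta_abs (a n) * B ^ (CARD('k) ^ n) < r) sequentially"
      using a by (auto elim!: order_tendstoD)
    then obtain n0 where n0: "\<And>n. n \<ge> n0 \<Longrightarrow> eta_abs (a n) * B ^ (CARD('k) ^ n) < r"
      by (auto simp: eventually_sequentially)
    have "eventually (\<lambda>L. \<forall>n\<in>{..<n0}. eta_abs (a n * (v - u (L - n)) ^ (CARD('k) ^ n)) < r) sequentially"
    proof (rule eventually_ball_finite)
      show "\<forall>n\<in>{..<n0}. eventually (\<lambda>L. eta_abs (a n * (v - u (L - n)) ^ (CARD('k) ^ n)) < r) sequentially"
      proof
        fix n
        have "(\<lambda>L. u (L - n)) \<longlonglongrightarrow> v"
          by (rule LIMSEQ_offset[of _ n]) (use u(1) in simp)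
        from LIMSEQ_cmult[OF LIMSEQ_frob[OF LIMSEQ_diff[OF tendsto_const[of v] this]], of "a n" n]
        have "(\<lambda>L. a n * (v - u (L - n)) ^ (CARD('k) ^ n)) \<longlonglongrightarrow> 0"
          by simp
        then have "(\<lambda>L. eta_abs (a n * (v - u (L - n)) ^ (CARD('k) ^ n))) \<longlonglongrightarrow> 0"
          unfolding LIMSEQ_av by simp
        then show "eventually (\<lambda>L. eta_abs (a n * (v - u (L - n)) ^ (CARD('k) ^ n)) < r) sequentially"
          using \<open>r > 0\<close> by (auto elim!: order_tendstoD)
      qed
    qed simp
    moreover have "eventually (\<lambda>L. L \<ge> L0) sequentially"
      by (rule eventually_ge_at_top)
    ultimately show "eventually (\<lambda>L. eta_abs (\<Sum>n\<le>L. a n * v ^ (CARD('k) ^ n)) < r) sequentially"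
    proof eventually_elim
      case (elim L)
      \<comment> \<open>Subtracts the vanishing truncated sum; Frobenius is additive, so the error
        again consists of pure \<open>q ^ n\<close>-th powers.\<close>
      have "(\<Sum>n\<le>L. a n * v ^ (CARD('k) ^ n)) = (\<Sum>n\<le>L. a n * (v - u (L - n)) ^ (CARD('k) ^ n))"
        using zero[OF elim(2)] by (simp add: frob_diff right_diff_distrib sum_subtractf)
      moreover have "eta_abs (\<Sum>n\<le>L. a n * (v - u (L - n)) ^ (CARD('k) ^ n)) < r"
      proof (rule av_sum_less[OF \<open>r > 0\<close>])
        fix n
        show "eta_abs (a n * (v - u (L - n)) ^ (CARD('k) ^ n)) < r"
        proof (cases "n < n0")
          case False
          have "eta_abs (v - u (L - n)) \<le> B"
            using av_diff_le[of v "u (L - n)"] v u(2)[of "L - n"] by simp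
          then have "eta_abs (a n * (v - u (L - n)) ^ (CARD('k) ^ n)) \<le> eta_abs (a n) * B ^ (CARD('k) ^ n)"
            by (auto simp: av_mult av_power intro!: mult_left_mono power_mono)
          also have "\<dots> < r"
            using n0 False by simp
          finally show ?thesis .
        qed (use elim(1) in simp)
      qed
      ultimately show ?case
        by simp
    qed
  qed
  then show ?thesis
    unfolding sums_def by (subst filterlim_sequentially_Suc[symmetric]) (simp add: lessThan_Suc_atMost)
qed

text \<open>Both sides are the product of \<open>g\<close> over \<open>{1..<n + k}\<close>, cut at
  \<open>k\<close> and at \<open>n + 1\<close> respectively.\<close>

lemma prod_shift_exchange:
  fixes g :: "nat \<Rightarrow> 'c"
  assumes "k > 0"
  shows "(\<Prod>l<n. g (l + k)) * (\<Prod>i\<in>{1..<k}. g i) = (\<Prod>i\<in>{1..n}. g i) * (\<Prod>i\<in>{1..<k}. g (i + n))"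
proof -
  have "(\<Prod>l<n. g (l + k)) = (\<Prod>i\<in>{k..<n + k}. g i)"
    using prod.shift_bounds_nat_ivl[of g 0 k n] by (simp add: lessThan_atLeast0)
  then have "(\<Prod>l<n. g (l + k)) * (\<Prod>i\<in>{1..<k}. g i) = (\<Prod>i\<in>{1..<n + k}. g i)"
    using assms prod.atLeastLessThan_concat[of 1 k "n + k" g] by (simp add: mult.commute)
  also have "\<dots> = (\<Prod>i\<in>{1..<1 + n}. g i) * (\<Prod>i\<in>{1 + n..<k + n}. g i)"
    using assms prod.atLeastLessThan_concat[of 1 "1 + n" "n + k" g] by (simp add: add.commute)
  also have "(\<Prod>i\<in>{1 + n..<k + n}. g i) = (\<Prod>i\<in>{1..<k}. g (i + n))"
    by (rule prod.shift_bounds_nat_ivl)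
  also have "{1..<1 + n} = {1..n}"
    by auto
  finally show ?thesis .
qed

text \<open>The period without its infinite product. The latter has absolute value 1, so this finite
  part determines the size of the period.\<close>

definition period_lead :: "'c \<Rightarrow> nat \<Rightarrow> 'c" where
  "period_lead w k = w * (\<Prod>i\<in>{1..<k}. 1 / (\<theta> - etaF i))"

context
  fixes w :: 'c and k j :: nat
  assumes k_def: "k = j + 2"
    and w_root: "w ^ (CARD('k) - 1) = - (1 / (\<theta> - etaF k))"
begin

section \<open>Residues of the truncated products\<close>

lemma w_nz: "w \<noteq> 0"
  using w_root theta_etaF_nz[of k] q_ge_2 by (auto simp: power_0_left split: if_splits)

lemma w_frob: "w ^ (CARD('k) ^ n) = w * (\<Prod>l<n. - (1 / (thetaF l - etaF (l + k))))"
proof (induction n)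
  case (Suc n)
  have "CARD('k) ^ Suc n = CARD('k) ^ n + (CARD('k) - 1) * CARD('k) ^ n"
    using q_ge_2 by (simp add: algebra_simps)
  then have "w ^ (CARD('k) ^ Suc n) = w ^ (CARD('k) ^ n) * (w ^ (CARD('k) - 1)) ^ (CARD('k) ^ n)"
    by (simp only: power_add power_mult)
  also have "(w ^ (CARD('k) - 1)) ^ (CARD('k) ^ n) = - (1 / (thetaF n - etaF (n + k)))"
    unfolding w_root by (simp add: frob_minus power_divide frob_diff thetaF_def add.commute flip: etaF_add)
  finally show ?case
    using Suc by simp
qed simp

lemma period_lead_nz: "period_lead w k \<noteq> 0"
  using w_nz theta_etaF_nz by (auto simp: period_lead_def)

text \<open>The factors \<open>x_l - eta_(l+k)\<close> and the signs in \<open>w ^ q ^ n\<close>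
  cancel against \<open>exp_denom\<close>, leaving a product over shifted conjugates which
  \<open>prod_shift_exchange\<close> realigns. The extra product on the left keeps the identity
  uniform, whichever of \<open>n\<close> and \<open>k\<close> is larger.\<close>

lemma period_lead_frob:
  "period_lead w k ^ (CARD('k) ^ n) / exp_denom k n * (\<Prod>i\<in>{1..<k}. thetaF n - etaF i) =
    w * (\<Prod>i\<in>{1..n}. thetaF n - etaF i) / (\<Prod>i<n. thetaF n - thetaF i)"
proof -
  let ?g = "\<lambda>i. thetaF n - etaF i"
  have nz: "(\<Prod>i\<in>{1..<k}. ?g (i + n)) \<noteq> 0"
    using thetaF_etaF_nz by auto
  have quot: "(\<Prod>l<n. - (1 / (thetaF l - etaF (l + k)))) / exp_denom k n =
      (\<Prod>l<n. ?g (l + k)) / (\<Prod>l<n. thetaF n - thetaF l)"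
    unfolding exp_denom_def prod_dividef[symmetric]
  proof (rule prod.cong)
    fix l assume "l \<in> {..<n}"
    then have "thetaF n - thetaF l \<noteq> 0" "thetaF l - thetaF n \<noteq> 0"
      using thetaF_inj by auto
    then show "- (1 / (thetaF l - etaF (l + k))) / shtuka_value k l n = ?g (l + k) / (thetaF n - thetaF l)"
      using thetaF_etaF_nz[of n "l + k"] thetaF_etaF_nz[of l "l + k"]
      by (simp add: shtuka_value_eq divide_simps) (simp add: algebra_simps)
  qed simp
  have lead: "period_lead w k ^ (CARD('k) ^ n) = w ^ (CARD('k) ^ n) / (\<Prod>i\<in>{1..<k}. ?g (i + n))"
  proof -
    have *: "(1 / (\<theta> - etaF i)) ^ (CARD('k) ^ n) = 1 / ?g (i + n)" for i
      by (simp add: power_divide frob_diff etaF_add) (simp add: thetaF_def)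
    show ?thesis
      unfolding period_lead_def power_mult_distrib prod_power_distrib * by (simp add: prod_dividef)
  qed
  have "period_lead w k ^ (CARD('k) ^ n) / exp_denom k n =
      w * ((\<Prod>l<n. - (1 / (thetaF l - etaF (l + k)))) / exp_denom k n) / (\<Prod>i\<in>{1..<k}. ?g (i + n))"
    unfolding lead w_frob by (simp add: mult.commute)
  then have "period_lead w k ^ (CARD('k) ^ n) / exp_denom k n =
      w * ((\<Prod>l<n. ?g (l + k)) / (\<Prod>l<n. thetaF n - thetaF l)) / (\<Prod>i\<in>{1..<k}. ?g (i + n))"
    by (simp only: quot)
  then have "period_lead w k ^ (CARD('k) ^ n) / exp_denom k n * (\<Prod>i\<in>{1..<k}. ?g i) =
      w * ((\<Prod>l<n. ?g (l + k)) * (\<Prod>i\<in>{1..<k}. ?g i)) / (\<Prod>l<n. thetaF n - thetaF l) / (\<Prod>i\<in>{1..<k}. ?g (i + n))"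
    by simp
  also have "(\<Prod>l<n. ?g (l + k)) * (\<Prod>i\<in>{1..<k}. ?g i) = (\<Prod>i\<in>{1..n}. ?g i) * (\<Prod>i\<in>{1..<k}. ?g (i + n))"
    by (rule prod_shift_exchange) (simp add: k_def)
  finally show ?thesis
    using nz by simp
qed

lemma partial_period_frob:
  assumes "n \<le> L"
  shows "partial_period (L - n) ^ (CARD('k) ^ n) =
    (\<Prod>i\<in>{n<..L}. (thetaF n - etaF i) / (thetaF n - thetaF i))"
proof -
  have "partial_period (L - n) ^ (CARD('k) ^ n) =
      (\<Prod>i<L - n. (thetaF n - etaF (i + Suc n)) / (thetaF n - thetaF (i + Suc n)))"
    unfolding partial_period_def prod_power_distrib
  proof (rule prod.cong)
    fix i
    have "period_factor \<iota> \<eta> \<sigma> (Suc i) ^ (CARD('k) ^ n) =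
        (thetaF 0 ^ (CARD('k) ^ n) - etaF (Suc i) ^ (CARD('k) ^ n)) /
        (thetaF 0 ^ (CARD('k) ^ n) - thetaF (Suc i) ^ (CARD('k) ^ n))"
      by (simp add: period_factor_eq power_divide frob_diff)
    also have "\<dots> = (thetaF (0 + n) - etaF (Suc i + n)) / (thetaF (0 + n) - thetaF (Suc i + n))"
      by (simp only: etaF_add thetaF_add)
    finally show "period_factor \<iota> \<eta> \<sigma> (Suc i) ^ (CARD('k) ^ n) =
        (thetaF n - etaF (i + Suc n)) / (thetaF n - thetaF (i + Suc n))"
      by simp
  qed simp
  also have "\<dots> = (\<Prod>i\<in>{0 + Suc n..<(L - n) + Suc n}. (thetaF n - etaF i) / (thetaF n - thetaF i))"
    unfolding prod.shift_bounds_nat_ivl by (simp add: lessThan_atLeast0)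
  also have "{0 + Suc n..<(L - n) + Suc n} = {n<..L}"
    using assms by auto
  finally show ?thesis .
qed

text \<open>The right-hand side is the residue at \<open>t = \<theta> ^ q ^ n\<close> of the truncated product for \<open>\<omega>\<close>.\<close>

lemma truncated_residue:
  assumes "n \<le> L" "L + 1 \<ge> k"
  shows "(period_lead w k * partial_period (L - n)) ^ (CARD('k) ^ n) / exp_denom k n =
    w * (\<Prod>i\<in>{k..L}. thetaF n - etaF i) / (\<Prod>i\<in>{..L} - {n}. thetaF n - thetaF i)"
proof -
  let ?g = "\<lambda>i. thetaF n - etaF i" and ?h = "\<lambda>i. thetaF n - thetaF i"
  let ?C = "\<Prod>i\<in>{1..<k}. ?g i"
  have C: "?C \<noteq> 0"
    using thetaF_etaF_nz by auto
  have "(period_lead w k * partial_period (L - n)) ^ (CARD('k) ^ n) / exp_denom k n * ?C =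
      (period_lead w k ^ (CARD('k) ^ n) / exp_denom k n * ?C) * partial_period (L - n) ^ (CARD('k) ^ n)"
    by (simp add: power_mult_distrib)
  also have "\<dots> = w * ((\<Prod>i\<in>{1..n}. ?g i) * (\<Prod>i\<in>{n<..L}. ?g i)) / ((\<Prod>i<n. ?h i) * (\<Prod>i\<in>{n<..L}. ?h i))"
    unfolding period_lead_frob partial_period_frob[OF assms(1)] by (simp add: prod_dividef)
  also have "(\<Prod>i\<in>{1..n}. ?g i) * (\<Prod>i\<in>{n<..L}. ?g i) = (\<Prod>i\<in>{1..L}. ?g i)"
    using assms(1) by (subst prod.union_disjoint[symmetric]) (auto intro!: prod.cong)
  also have "(\<Prod>i<n. ?h i) * (\<Prod>i\<in>{n<..L}. ?h i) = (\<Prod>i\<in>{..L} - {n}. ?h i)"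
    using assms(1) by (subst prod.union_disjoint[symmetric]) (auto intro!: prod.cong)
  \<comment> \<open>The splitting at \<open>k\<close> needs \<open>L + 1 \<ge> k\<close>; the second
    piece is then the auxiliary factor to be cancelled.\<close>
  also have "(\<Prod>i\<in>{1..L}. ?g i) = (\<Prod>i\<in>{k..L}. ?g i) * ?C"
    using assms(2) k_def by (subst prod.union_disjoint[symmetric]) (auto intro!: prod.cong)
  finally have "(period_lead w k * partial_period (L - n)) ^ (CARD('k) ^ n) / exp_denom k n * ?C =
      w * (\<Prod>i\<in>{k..L}. ?g i) / (\<Prod>i\<in>{..L} - {n}. ?h i) * ?C"
    by simp
  then show ?thesis
    by (rule iffD1[OF mult_right_cancel[OF C]])
qed

text \<open>The sum of the residues of \<open>t ^ e\<close> times the truncated product is \<open>0\<close>, because the product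
  has a zero of order \<open>k\<close> at infinity.\<close>

lemma sum_truncated_residues:
  assumes "e \<le> j" "L + 1 \<ge> k"
  shows "(\<Sum>n\<le>L. (1 / exp_denom k n) * (period_lead w k * \<theta> ^ e * partial_period (L - n)) ^ (CARD('k) ^ n)) = 0"
proof -
  define G where "G = monom 1 e * (\<Prod>i\<in>{k..L}. [:- etaF i, 1:])"
  \<comment> \<open>The degree is at most \<open>j + (L + 1 - k) = L - 1\<close>, one less than
    needed for a nonzero interpolation sum over \<open>L + 1\<close> nodes. This is where
    \<open>e \<le> k - 2\<close> enters.\<close>
  have "degree G \<le> e + (\<Sum>i\<in>{k..L}. 1)"
    unfolding G_def
    by (rule order.trans[OF degree_mult_le]) (simp add: degree_monom_eq degree_prod_eq_sum_degree)
  then have deg: "degree G < L"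
    using assms k_def by simp
  have inj: "inj_on thetaF {..L}"
    by (auto simp: inj_on_def thetaF_inj)
  then have card: "card (thetaF ` {..L}) = L + 1"
    by (simp add: card_image)
  have "(\<Sum>n\<le>L. (1 / exp_denom k n) * (period_lead w k * \<theta> ^ e * partial_period (L - n)) ^ (CARD('k) ^ n)) =
      w * (\<Sum>n\<le>L. poly G (thetaF n) / (\<Prod>u\<in>thetaF ` {..L} - {thetaF n}. thetaF n - u))"
    unfolding sum_distrib_left
  proof (rule sum.cong)
    fix n assume n: "n \<in> {..L}"
    have "thetaF ` {..L} - {thetaF n} = thetaF ` ({..L} - {n})"
      using thetaF_inj by auto
    then have "(\<Prod>u\<in>thetaF ` {..L} - {thetaF n}. thetaF n - u) = (\<Prod>i\<in>{..L} - {n}. thetaF n - thetaF i)"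
      using inj by (simp add: prod.reindex inj_on_diff)
    moreover have "poly G (thetaF n) = thetaF n ^ e * (\<Prod>i\<in>{k..L}. thetaF n - etaF i)"
      by (simp add: G_def poly_monom poly_prod)
    moreover have "(1 / exp_denom k n) * (period_lead w k * \<theta> ^ e * partial_period (L - n)) ^ (CARD('k) ^ n) =
        thetaF n ^ e * ((period_lead w k * partial_period (L - n)) ^ (CARD('k) ^ n) / exp_denom k n)"
    proof -
      have "(\<theta> ^ e) ^ (CARD('k) ^ n) = thetaF n ^ e"
        by (simp add: thetaF_def mult.commute flip: power_mult)
      then show ?thesis
        by (simp add: power_mult_distrib)
    qed
    moreover have "(period_lead w k * partial_period (L - n)) ^ (CARD('k) ^ n) / exp_denom k n =
        w * (\<Prod>i\<in>{k..L}. thetaF n - etaF i) / (\<Prod>i\<in>{..L} - {n}. thetaF n - thetaF i)"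
      using n assms(2) by (intro truncated_residue) auto
    ultimately show "(1 / exp_denom k n) * (period_lead w k * \<theta> ^ e * partial_period (L - n)) ^ (CARD('k) ^ n) =
        w * (poly G (thetaF n) / (\<Prod>u\<in>thetaF ` {..L} - {thetaF n}. thetaF n - u))"
      by (simp only:) (simp add: mult_ac)
  qed simp
  also have "(\<Sum>n\<le>L. poly G (thetaF n) / (\<Prod>u\<in>thetaF ` {..L} - {thetaF n}. thetaF n - u)) =
      (\<Sum>v\<in>thetaF ` {..L}. poly G v / (\<Prod>u\<in>thetaF ` {..L} - {v}. v - u))"
    by (simp add: sum.reindex[OF inj])
  also have "\<dots> = coeff G (card (thetaF ` {..L}) - 1)"
    by (rule sum_lagrange_eq_coeff) (use card deg in auto)
  also have "\<dots> = 0"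
    using card deg by (simp add: coeff_eq_0)
  finally show ?thesis
    by simp
qed

text \<open>The size of the \<open>n\<close>-th term of the exponential at the period, that is, of
  the residue of \<open>\<omega>\<close> at \<open>x_n\<close>. On the circle of radius
  \<open>|period| q ^ m\<close> the term is larger by the factor
  \<open>(q ^ m) ^ q ^ n\<close>.\<close>

definition residue_abs :: "nat \<Rightarrow> real" where
  "residue_abs n = eta_abs (period_lead w k) ^ (CARD('k) ^ n) / eta_abs (exp_denom k n)"

text \<open>Truncation at \<open>L = n\<close> makes the partial product empty, and a factor
  \<open>x_n - eta_i\<close> of the numerator is small exactly when \<open>i\<close> is congruent to
  \<open>n\<close> modulo \<open>N\<close>.\<close>

lemma residue_abs_eq:
  assumes "n + 1 \<ge> k"
  shows "residue_abs n = eta_abs w * ((1 / real CARD('k)) ^ (CARD('k) ^ n)) ^ card {i \<in> {k..n}. N dvd n - i} /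
    (\<Prod>i<n. eta_abs (thetaF n - thetaF i))"
proof -
  have "(period_lead w k) ^ (CARD('k) ^ n) / exp_denom k n =
      w * (\<Prod>i\<in>{k..n}. thetaF n - etaF i) / (\<Prod>i\<in>{..n} - {n}. thetaF n - thetaF i)"
    using truncated_residue[of n n] assms by (simp add: partial_period_def)
  also have "{..n} - {n} = {..<n}"
    by auto
  finally have "residue_abs n = eta_abs w * (\<Prod>i\<in>{k..n}. eta_abs (thetaF n - etaF i)) / (\<Prod>i<n. eta_abs (thetaF n - thetaF i))"
    unfolding residue_abs_def by (metis av_divide av_mult av_power av_prod)
  also have "(\<Prod>i\<in>{k..n}. eta_abs (thetaF n - etaF i)) =
      (\<Prod>i\<in>{k..n}. if N dvd n - i then (1 / real CARD('k)) ^ (CARD('k) ^ n) else 1)"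
    by (rule prod.cong) (auto simp: eta_abs_thetaF_etaF)
  also have "\<dots> = ((1 / real CARD('k)) ^ (CARD('k) ^ n)) ^ card {i \<in> {k..n}. N dvd n - i}"
    by (subst prod.inter_filter[symmetric]) auto
  finally show ?thesis .
qed

lemma q_powers_cancel: "((1 / real CARD('k)) ^ (CARD('k) ^ n)) ^ m * (real CARD('k) ^ m) ^ (CARD('k) ^ n) = 1"
proof -
  have "((1 / real CARD('k)) ^ (CARD('k) ^ n)) ^ m * (real CARD('k) ^ m) ^ (CARD('k) ^ n) =
      (1 / real CARD('k) * real CARD('k)) ^ (m * CARD('k) ^ n)"
    unfolding power_mult_distrib by (simp only: mult.commute flip: power_mult)
  then show ?thesis
    by simp
qed

text \<open>The indices \<open>n, n - N, ..., n - m N\<close> all lie in \<open>{k..n}\<close> and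
  give \<open>m + 1\<close> small factors. Of these, \<open>m\<close> compensate the radius, and the
  remaining \<open>q ^ (- q ^ n)\<close> beats the denominator, which is at least
  \<open>q ^ (- (1 + q + ... + q ^ (n - 1)))\<close>.\<close>

lemma residue_abs_upper:
  assumes "n \<ge> m * N + k"
  shows "residue_abs n * (real CARD('k) ^ m) ^ (CARD('k) ^ n) < eta_abs w"
proof -
  let ?Q = "real CARD('k)" and ?qn = "CARD('k) ^ n"
  have Q: "?Q > 1"
    using q_ge_2 by simp
  have sub: "(\<lambda>i. n - i * N) ` {..m} \<subseteq> {i \<in> {k..n}. N dvd n - i}"
  proof safe
    fix i assume "i \<le> m"
    then have "i * N \<le> m * N"
      by simp
    then have "i * N \<le> n" "k \<le> n - i * N"
      using assms by linarith+
    then show "n - i * N \<in> {k..n}" "N dvd n - (n - i * N)"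
      by simp_all
  qed
  have "inj_on (\<lambda>i. n - i * N) {..m}"
  proof (rule inj_onI)
    fix i i' assume *: "i \<in> {..m}" "i' \<in> {..m}" "n - i * N = n - i' * N"
    then have "i * N \<le> m * N" "i' * N \<le> m * N"
      by simp_all
    then have "i * N = i' * N"
      using * assms by linarith
    then show "i = i'"
      using rho_degree by simp
  qed
  then have "card ((\<lambda>i. n - i * N) ` {..m}) = m + 1"
    by (simp add: card_image)
  then have "m + 1 \<le> card {i \<in> {k..n}. N dvd n - i}"
    using card_mono[OF _ sub] by simp
  then have 1: "((1 / ?Q) ^ ?qn) ^ card {i \<in> {k..n}. N dvd n - i} \<le> ((1 / ?Q) ^ ?qn) ^ (m + 1)"
    using q_inv by (intro power_decreasing) (auto simp: power_le_one)
  have 2: "(\<Prod>i<n. eta_abs (thetaF n - thetaF i)) \<ge> (1 / ?Q) ^ (\<Sum>i<n. CARD('k) ^ i)"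
    unfolding power_sum by (intro prod_mono) (use eta_abs_thetaF_diff_ge in auto)
  have "(\<Sum>i<n. CARD('k) ^ i) < ?qn"
  proof (induction n)
    case (Suc n)
    have "2 * CARD('k) ^ n \<le> CARD('k) ^ Suc n"
      using q_ge_2 by simp
    with Suc show ?case
      unfolding sum.lessThan_Suc by linarith
  qed simp
  then have 3: "(1 / ?Q) ^ ?qn < (1 / ?Q) ^ (\<Sum>i<n. CARD('k) ^ i)"
    using Q by (intro power_strict_decreasing) auto
  let ?P = "\<Prod>i<n. eta_abs (thetaF n - thetaF i)"
  have P: "?P > (1 / ?Q) ^ ?qn"
    using 2 3 by linarith
  then have P0: "?P > 0"
    using q_inv by (meson less_trans zero_less_power)
  have "residue_abs n * (?Q ^ m) ^ ?qn \<le> eta_abs w * ((1 / ?Q) ^ ?qn) ^ (m + 1) / ?P * (?Q ^ m) ^ ?qn"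
    using 1 P0 assms Q by (subst residue_abs_eq) (auto intro!: mult_right_mono divide_right_mono mult_left_mono)
  also have "\<dots> = eta_abs w * ((1 / ?Q) ^ ?qn / ?P) * (((1 / ?Q) ^ ?qn) ^ m * (?Q ^ m) ^ ?qn)"
  proof -
    have "x * u ^ (m + 1) / p * b = x * (u / p) * (u ^ m * b)" for x u p b :: real
      by simp
    then show ?thesis .
  qed
  also have "((1 / ?Q) ^ ?qn) ^ m * (?Q ^ m) ^ ?qn = 1"
    by (rule q_powers_cancel)
  also have "eta_abs w * ((1 / ?Q) ^ ?qn / ?P) * 1 < eta_abs w * 1 * 1"
    using P P0 w_nz by (intro mult_strict_right_mono mult_strict_left_mono) (auto simp: divide_less_eq simp del: power_one_over)
  also have "eta_abs w * 1 * 1 = eta_abs w"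
    by simp
  finally show ?thesis .
qed

text \<open>At this \<open>n\<close> the interval \<open>{k..n}\<close> has length
  \<open>m N\<close>, so at most \<open>m\<close> indices are congruent to \<open>n\<close>; the
  radius compensates them all, and the denominator is at most 1. With
  \<open>residue_abs_upper\<close> this locates the last maximal term, \<open>|w|\<close> being the
  common threshold.\<close>

lemma residue_abs_lower:
  assumes "n + 1 = m * N + k"
  shows "eta_abs w \<le> residue_abs n * (real CARD('k) ^ m) ^ (CARD('k) ^ n)"
proof -
  let ?Q = "real CARD('k)" and ?qn = "CARD('k) ^ n"
  let ?P = "\<Prod>i<n. eta_abs (thetaF n - thetaF i)"
  have Q: "?Q > 1"
    using q_ge_2 by simp
  have "card {i \<in> {k..n}. N dvd n - i} \<le> card {..<m}"
  proof (rule card_inj_on_le)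
    show "inj_on (\<lambda>i. (n - i) div N) {i \<in> {k..n}. N dvd n - i}"
    proof (rule inj_onI)
      fix i i' assume *: "i \<in> {i \<in> {k..n}. N dvd n - i}" "i' \<in> {i \<in> {k..n}. N dvd n - i}"
        "(n - i) div N = (n - i') div N"
      then have "n - i = n - i'"
        by (metis (no_types, lifting) dvd_div_eq_iff mem_Collect_eq)
      then show "i = i'"
        using * by auto
    qed
    show "(\<lambda>i. (n - i) div N) ` {i \<in> {k..n}. N dvd n - i} \<subseteq> {..<m}"
    proof (rule image_subsetI)
      fix i assume "i \<in> {i \<in> {k..n}. N dvd n - i}"
      then have "n - i < m * N"
        using assms by auto
      then show "(n - i) div N \<in> {..<m}"
        by (simp add: less_mult_imp_div_less)
    qed
  qed simp
  then have 1: "((1 / ?Q) ^ ?qn) ^ m \<le> ((1 / ?Q) ^ ?qn) ^ card {i \<in> {k..n}. N dvd n - i}"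
    using q_inv by (intro power_decreasing) (auto simp: power_le_one)
  have P1: "?P \<le> 1"
    by (intro prod_le_1) (use eta_abs_thetaF_diff_ge in auto)
  have P0: "?P > 0"
    by (intro prod_pos) (use thetaF_inj in auto)
  have "eta_abs w \<le> eta_abs w / ?P"
    using P0 P1 by (simp add: le_divide_eq mult_left_le)
  also have "\<dots> = eta_abs w / ?P * (((1 / ?Q) ^ ?qn) ^ m * (?Q ^ m) ^ ?qn)"
    unfolding q_powers_cancel by simp
  also have "\<dots> = eta_abs w * ((1 / ?Q) ^ ?qn) ^ m / ?P * (?Q ^ m) ^ ?qn"
    by (simp only: times_divide_eq_left times_divide_eq_right mult.assoc)
  also have "\<dots> \<le> residue_abs n * (?Q ^ m) ^ ?qn"
    using 1 P0 assms Q by (subst residue_abs_eq) (auto intro!: mult_right_mono divide_right_mono mult_left_mono)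
  finally show ?thesis .
qed

lemma eta_abs_le_period_lead:
  obtains m where "eta_abs z \<le> eta_abs (period_lead w k) * real CARD('k) ^ m"
proof -
  have "real CARD('k) > 1"
    using q_ge_2 by simp
  from real_arch_pow[OF this, of "eta_abs z / eta_abs (period_lead w k)"]
  obtain m where "eta_abs z / eta_abs (period_lead w k) < real CARD('k) ^ m"
    by blast
  moreover have "eta_abs (period_lead w k) > 0"
    using period_lead_nz by simp
  ultimately have "eta_abs z \<le> eta_abs (period_lead w k) * real CARD('k) ^ m"
    by (simp add: field_simps)
  then show ?thesis
    by (rule that)
qed

text \<open>Using \<open>residue_abs_upper\<close> with \<open>Suc m\<close> instead of
  \<open>m\<close> leaves a factor \<open>q ^ (- q ^ n)\<close> to spare. This supplies the
  convergence that the construction of the exponential assumed.\<close>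

lemma exp_terms_LIMSEQ: "(\<lambda>n. eta_abs (z ^ (CARD('k) ^ n) / exp_denom k n)) \<longlonglongrightarrow> 0"
proof -
  let ?Q = "real CARD('k)"
  obtain m where m: "eta_abs z \<le> eta_abs (period_lead w k) * ?Q ^ m"
    by (rule eta_abs_le_period_lead)
  have Q: "?Q > 1"
    using q_ge_2 by simp
  have bound: "eta_abs (z ^ (CARD('k) ^ n) / exp_denom k n) \<le> eta_abs w * (1 / ?Q) ^ n"
    if n: "n \<ge> Suc m * N + k" for n
  proof -
    let ?qn = "CARD('k) ^ n"
    have "eta_abs (z ^ ?qn / exp_denom k n) \<le> (eta_abs (period_lead w k) * ?Q ^ m) ^ ?qn / eta_abs (exp_denom k n)"
      unfolding av_divide av_power using m by (intro divide_right_mono power_mono) auto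
    also have "\<dots> = residue_abs n * (?Q ^ Suc m) ^ ?qn * (1 / ?Q) ^ ?qn"
      using Q by (simp add: residue_abs_def power_mult_distrib power_one_over field_simps)
    also have "\<dots> \<le> eta_abs w * (1 / ?Q) ^ n"
      using residue_abs_upper[OF n] q_power_gt[of n] Q
      by (intro mult_mono power_decreasing) auto
    finally show ?thesis .
  qed
  have "(\<lambda>n. (1 / ?Q) ^ n) \<longlonglongrightarrow> 0"
    by (rule LIMSEQ_power_zero) (use q_inv in auto)
  from tendsto_mult_left[OF this, of "eta_abs w"] have lim: "(\<lambda>n. eta_abs w * (1 / ?Q) ^ n) \<longlonglongrightarrow> 0"
    by simp
  show ?thesis
    by (rule tendsto_sandwich[OF _ _ tendsto_const lim])
       (auto intro: eventually_sequentiallyI[of "Suc m * N + k"] bound)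
qed

section \<open>The zeros of the exponential\<close>

abbreviation "E \<equiv> drinfeld_exp \<iota> \<rho> \<eta> \<sigma> k"
abbreviation "period \<equiv> period_lead w k * (\<Prod>i. period_factor \<iota> \<eta> \<sigma> (Suc i))"

lemma eta_abs_period: "eta_abs period = eta_abs (period_lead w k)"
  by (simp add: av_mult partial_period_LIMSEQ)

lemma period_nz: "period \<noteq> 0"
  using eta_abs_period period_lead_nz by (metis av_eq_0_iff)

lemma E_add: "E (x + y) = E x + E y"
  and E_const_mult: "E (const_emb \<iota> c * x) = const_emb \<iota> c * E x"
  and E_ring_A: "a \<in> ring_A \<rho> \<Longrightarrow> E x = 0 \<Longrightarrow> E (\<iota> a * x) = 0"
proof -
  have E: "is_drinfeld_exp \<iota> \<rho> \<eta> \<sigma> k E"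
    by (intro is_drinfeld_exp_drinfeld_exp exp_terms_LIMSEQ)
  then show "E (x + y) = E x + E y" "E (const_emb \<iota> c * x) = const_emb \<iota> c * E x"
    by (simp_all add: is_drinfeld_exp_def)
  show "E (\<iota> a * x) = 0" if "a \<in> ring_A \<rho>" "E x = 0"
  proof -
    have "E (\<iota> a * x) = tau_apply CARD('k) (drinfeld_Psi_conj \<iota> \<eta> \<sigma> k a) (E x)"
      using E that(1) by (simp add: is_drinfeld_exp_def)
    then show ?thesis
      using that(2) by (simp add: tau_apply_def)
  qed
qed

lemma E_sum_eq_0:
  assumes "\<And>i. i \<in> I \<Longrightarrow> E (f i) = 0"
  shows "E (\<Sum>i\<in>I. f i) = 0"
proof -
  have "E 0 = 0"
    using E_add[of 0 0] by (metis add_0 add_right_cancel)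
  then show ?thesis
    using assms by (induction I rule: infinite_finite_induct) (auto simp: E_add)
qed

text \<open>The limit of \<open>sum_truncated_residues\<close>. Domination holds because
  \<open>|\<theta>| \<le> 1\<close> and the partial products have absolute value 1.\<close>

lemma E_period_theta_power:
  assumes "e \<le> j"
  shows "E (period * \<theta> ^ e) = 0"
proof -
  let ?u = "\<lambda>L. period_lead w k * \<theta> ^ e * partial_period L" and ?B = "eta_abs (period_lead w k)"
  let ?v = "period_lead w k * \<theta> ^ e * (\<Prod>i. period_factor \<iota> \<eta> \<sigma> (Suc i))"
  have "(\<lambda>n. (1 / exp_denom k n) * ?v ^ (CARD('k) ^ n)) sums 0"
  proof (rule dominated_convolution_sums)
    show "(\<lambda>n. eta_abs (1 / exp_denom k n) * ?B ^ (CARD('k) ^ n)) \<longlonglongrightarrow> 0"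
      using exp_terms_LIMSEQ[of "period_lead w k"] by (simp add: av_divide av_power)
    show "?u \<longlonglongrightarrow> ?v"
      by (intro LIMSEQ_cmult partial_period_LIMSEQ)
    show "eta_abs (?u n) \<le> ?B" for n
      using eta_abs_theta_le
      by (simp add: av_mult av_power eta_abs_partial_period mult_left_le power_le_one)
    show "(\<Sum>n\<le>L. (1 / exp_denom k n) * ?u (L - n) ^ (CARD('k) ^ n)) = 0" if "L \<ge> k" for L
      using that by (intro sum_truncated_residues assms) simp
  qed
  moreover have "(\<lambda>n. ?v ^ (CARD('k) ^ n) / exp_denom k n) sums E ?v"
    by (intro drinfeld_exp_sums exp_terms_LIMSEQ)
  ultimately have "E ?v = 0"
    using sums_unique2 by (simp add: divide_inverse mult.commute)
  then show ?thesis
    by (simp add: mult_ac)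
qed

text \<open>Over \<open>\<A>\<close> the space is generated by \<open>1, t, ..., t ^ j\<close>: the
  monomial \<open>t ^ i / \<rho> ^ m\<close> lies in \<open>\<A>\<close> if
  \<open>i \<le> m N\<close>, and otherwise it is \<open>t ^ (m N) / \<rho> ^ m\<close>, an element
  of \<open>\<A>\<close>, times \<open>t ^ (i - m N)\<close> with
  \<open>i - m N \<le> j\<close>.\<close>

lemma E_period_mult:
  assumes "x \<in> pole_space \<rho> (int j)"
  shows "E (period * \<iota> x) = 0"
proof -
  obtain P m where x: "x = Fract P (\<rho> ^ m)" "int (degree P) \<le> int (m * N) + int j"
    using assms by (auto simp: pole_space_def)
  have monomial: "E (period * (\<theta> ^ i / ev \<rho> \<theta> ^ m)) = 0" if i: "i \<le> degree P" for i
  proof (cases "i \<le> m * N")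
    case True
    have "Fract (monom 1 i) (\<rho> ^ m) \<in> ring_A \<rho>"
      unfolding ring_A_eq by (rule pole_spaceI) (use True in \<open>simp add: degree_monom_eq flip: of_nat_mult\<close>)
    from E_ring_A[OF this E_period_theta_power[of 0]] show ?thesis
      by (simp add: iota_Fract ev_monom ev_power mult_ac)
  next
    case False
    have "Fract (monom 1 (m * N)) (\<rho> ^ m) \<in> ring_A \<rho>"
      unfolding ring_A_eq by (rule pole_spaceI) (simp add: degree_monom_eq)
    moreover have "i - m * N \<le> j"
      using x(2) i by linarith
    ultimately have "E (\<iota> (Fract (monom 1 (m * N)) (\<rho> ^ m)) * (period * \<theta> ^ (i - m * N))) = 0"
      by (intro E_ring_A E_period_theta_power)
    moreover have "\<theta> ^ (m * N) * \<theta> ^ (i - m * N) = \<theta> ^ i"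
      using False by (simp flip: power_add)
    then have "\<iota> (Fract (monom 1 (m * N)) (\<rho> ^ m)) * (period * \<theta> ^ (i - m * N)) = period * (\<theta> ^ i / ev \<rho> \<theta> ^ m)"
      by (simp add: iota_Fract ev_monom ev_power mult_ac)
    ultimately show ?thesis
      by simp
  qed
  have "ev P \<theta> = (\<Sum>i\<le>degree P. const_emb \<iota> (coeff P i) * \<theta> ^ i)"
    by (simp add: ev_def poly_altdef coeff_map_poly degree_map_poly)
  then have sum: "period * \<iota> x = (\<Sum>i\<le>degree P. const_emb \<iota> (coeff P i) * (period * (\<theta> ^ i / ev \<rho> \<theta> ^ m)))"
    by (simp add: x iota_Fract ev_power sum_distrib_left sum_divide_distrib mult_ac)
  show ?thesis
    unfolding sum
  proof (rule E_sum_eq_0)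
    fix i assume "i \<in> {..degree P}"
    then show "E (const_emb \<iota> (coeff P i) * (period * (\<theta> ^ i / ev \<rho> \<theta> ^ m))) = 0"
      by (simp only: E_const_mult monomial atMost_iff mult_zero_right)
  qed
qed

text \<open>For \<open>r = |period| q ^ m\<close> the coefficient of index \<open>q ^ M\<close>, \<open>M = m N + k - 1\<close>, dominates all later
  ones, so the \<open>q ^ M\<close> zeros of the form \<open>period * P / \<rho> ^ m\<close> are all zeros of absolute value at
  most \<open>r\<close>.\<close>

theorem kernel_eq: "{z. E z = 0} = (\<lambda>x. period * \<iota> x) ` pole_space \<rho> (int j)"
proof
  show "(\<lambda>x. period * \<iota> x) ` pole_space \<rho> (int j) \<subseteq> {z. E z = 0}"
    using E_period_mult by auto
  show "{z. E z = 0} \<subseteq> (\<lambda>x. period * \<iota> x) ` pole_space \<rho> (int j)"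
  proof
    fix z assume "z \<in> {z. E z = 0}"
    then have z: "E z = 0"
      by simp
    obtain m where m: "eta_abs z \<le> eta_abs (period_lead w k) * real CARD('k) ^ m"
      by (rule eta_abs_le_period_lead)
    define r where "r = eta_abs (period_lead w k) * real CARD('k) ^ m"
    \<comment> \<open>\<open>degree P < M\<close> is the condition
      \<open>degree P \<le> m N + j\<close> of \<open>pole_space\<close>, and
      \<open>M + 1 = m N + k\<close> is the index in \<open>residue_abs_lower\<close>.\<close>
    define M where "M = m * N + j + 1"
    define S where "S = (\<lambda>P. period * \<iota> (Fract P (\<rho> ^ m))) ` {P. degree P < M}"
    have inj: "inj_on (\<lambda>P. period * \<iota> (Fract P (\<rho> ^ m))) {P. degree P < M}"
    proof (rule inj_onI)
      fix P Q assume "period * \<iota> (Fract P (\<rho> ^ m)) = period * \<iota> (Fract Q (\<rho> ^ m))"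
      then have "Fract P (\<rho> ^ m) = Fract Q (\<rho> ^ m)"
        using period_nz iota_inj by (metis mult_cancel_left)
      then show "P = Q"
        using rho_nz by (simp add: eq_fract)
    qed
    have "M > 0"
      by (simp add: M_def)
    note fin = card_degree_less[where 'k = 'k, OF this]
    have card_S: "card S = CARD('k) ^ M" "finite S"
      using card_image[OF inj] fin by (simp_all add: S_def)
    have S_sub: "S \<subseteq> (\<lambda>x. period * \<iota> x) ` pole_space \<rho> (int j)"
    proof
      fix s assume "s \<in> S"
      then obtain P where P: "s = period * \<iota> (Fract P (\<rho> ^ m))" "degree P < M"
        by (auto simp: S_def)
      then have "int (degree P) \<le> int (m * N) + int j"
        unfolding M_def by linarith
      then have "Fract P (\<rho> ^ m) \<in> pole_space \<rho> (int j)"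
        by (rule pole_spaceI)
      then show "s \<in> (\<lambda>x. period * \<iota> x) ` pole_space \<rho> (int j)"
        using P by blast
    qed
    \<comment> \<open>Each division by \<open>\<rho>(\<theta>)\<close>, of absolute value
      \<open>1 / q\<close>, costs a factor \<open>q\<close>, while the numerator has absolute value
      at most 1. This explains the radius \<open>r\<close>.\<close>
    have S_le: "eta_abs s \<le> r" if s: "s \<in> S" for s
    proof -
      obtain P where P: "s = period * \<iota> (Fract P (\<rho> ^ m))"
        using s by (auto simp: S_def)
      have "eta_abs s = eta_abs (period_lead w k) * (eta_abs (ev P \<theta>) * real CARD('k) ^ m)"
        by (simp add: P av_mult eta_abs_period[unfolded av_mult] iota_Fract av_divide ev_power av_power
            eta_abs_ev_rho power_one_over partial_period_LIMSEQ)
      also have "\<dots> \<le> eta_abs (period_lead w k) * (1 * real CARD('k) ^ m)"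
        using eta_abs_ev_theta_le[of P] by (intro mult_left_mono mult_right_mono) auto
      finally show ?thesis
        by (simp add: r_def)
    qed
    \<comment> \<open>\<open>S\<close> already has \<open>q ^ M\<close> elements, so a zero outside
      \<open>S\<close> would exceed Strassmann's bound.\<close>
    have "card (insert z S) \<le> CARD('k) ^ M"
    proof (rule card_zeros_le_dominant_index)
      show "finite (insert z S)"
        using card_S by simp
      show "(\<lambda>n. exp_coeff k n * y ^ n) sums 0" if "y \<in> insert z S" for y
      proof -
        have "E y = 0"
          using that z S_sub E_period_mult by auto
        then show ?thesis
          using drinfeld_exp_series[OF exp_terms_LIMSEQ, of y] by simp
      qed
      show "eta_abs y \<le> r" if "y \<in> insert z S" for y
        using that m S_le by (auto simp: r_def)
      show "r > 0"
        using period_lead_nz q_ge_2 by (simp add: r_def)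
      have co: "eta_abs (exp_coeff k (CARD('k) ^ n)) * r ^ (CARD('k) ^ n) =
          residue_abs n * (real CARD('k) ^ m) ^ (CARD('k) ^ n)" for n
        by (simp add: exp_coeff_q_power av_divide r_def residue_abs_def power_mult_distrib)
      have low: "eta_abs w \<le> eta_abs (exp_coeff k (CARD('k) ^ M)) * r ^ (CARD('k) ^ M)"
        unfolding co by (rule residue_abs_lower) (simp add: M_def k_def)
      show "eta_abs (exp_coeff k i) * r ^ i < eta_abs (exp_coeff k (CARD('k) ^ M)) * r ^ (CARD('k) ^ M)"
        if i: "i > CARD('k) ^ M" for i
      proof (cases "i \<in> range (\<lambda>n. CARD('k) ^ n)")
        case True
        then obtain n where n: "i = CARD('k) ^ n"
          by blast
        then have "n > M"
          using i strict_mono_less[OF strict_mono_q_power] by simp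
        then have "residue_abs n * (real CARD('k) ^ m) ^ (CARD('k) ^ n) < eta_abs w"
          by (intro residue_abs_upper) (simp add: M_def k_def)
        then show ?thesis
          using low unfolding n co[of n] by linarith
      next
        case False
        then have "eta_abs (exp_coeff k i) * r ^ i = 0"
          by (simp add: exp_coeff_def)
        moreover have "eta_abs w > 0"
          using w_nz by simp
        ultimately show ?thesis
          using low by linarith
      qed
    qed
    then have "z \<in> S"
      using card_S by (metis card_insert_disjoint not_less_eq_eq order_refl)
    then show "z \<in> (\<lambda>x. period * \<iota> x) ` pole_space \<rho> (int j)"
      using S_sub by blast
  qed
qed

end

end

theorem theorem3:
  fixes \<iota> :: "'k::{finite, field} poly fract \<Rightarrow> 'c::{field, complete_space}"
    and \<rho> :: "'k poly" and \<eta> w :: 'c and \<sigma> :: "'c \<Rightarrow> 'c"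
  assumes setting: "rho_adic_setting \<iota> \<rho> \<eta> \<sigma>"
    and w_root: "w ^ (CARD('k) - 1) = - Theta_conj \<iota> \<eta> \<sigma> 2"
  shows "convergent_prod (\<lambda>k. period_factor \<iota> \<eta> \<sigma> (Suc k)) \<and>
    (inj_on (\<lambda>a. period_pi \<iota> \<eta> \<sigma> w * \<iota> a) (ring_A \<rho>) \<and>
     ker_exp \<iota> \<rho> \<eta> \<sigma> 2 = (\<lambda>a. period_pi \<iota> \<eta> \<sigma> w * \<iota> a) ` ring_A \<rho>) \<and>
    (\<forall>j r. r ^ (CARD('k) - 1) = Theta_conj \<iota> \<eta> \<sigma> 2 / Theta_conj \<iota> \<eta> \<sigma> (j + 2) \<longrightarrow>
       ker_exp \<iota> \<rho> \<eta> \<sigma> (j + 2) =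
         (\<lambda>x. period_pi \<iota> \<eta> \<sigma> w *
              ((\<Prod>i\<le>j + 1. Theta_conj \<iota> \<eta> \<sigma> i) /
               (r * (Theta_conj \<iota> \<eta> \<sigma> 0 * Theta_conj \<iota> \<eta> \<sigma> 1))) * \<iota> x)
         ` I_inf_neg_power \<rho> j)"
proof -
  interpret rho_adic_setting \<iota> \<rho> \<eta> \<sigma>
    by (rule setting)
  let ?PI = "\<Prod>i. period_factor \<iota> \<eta> \<sigma> (Suc i)"
  have root: "w ^ (CARD('k) - 1) = - (1 / (\<theta> - etaF 2))"
    using w_root by (simp add: Theta_conj_eq)
  have pi_eq: "period_pi \<iota> \<eta> \<sigma> w = period_lead w 2 * ?PI"
    by (simp add: period_pi_def period_lead_def Theta_conj_eq numeral_2_eq_2)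
  have "period_lead w 2 * ?PI \<noteq> 0"
    by (rule period_nz[of 2 0]) (use root in simp_all)
  then have "inj_on (\<lambda>a. period_pi \<iota> \<eta> \<sigma> w * \<iota> a) (ring_A \<rho>)"
    unfolding pi_eq by (intro inj_onI) (use iota_inj in \<open>metis mult_cancel_left\<close>)
  \<comment> \<open>The case \<open>j = 0\<close>, where the space of allowed poles is
    \<open>\<A>\<close> itself.\<close>
  moreover have "ker_exp \<iota> \<rho> \<eta> \<sigma> 2 = (\<lambda>a. period_pi \<iota> \<eta> \<sigma> w * \<iota> a) ` ring_A \<rho>"
    using kernel_eq[of 2 0 w] root by (simp add: ker_exp_def pi_eq ring_A_eq)
  moreover have "ker_exp \<iota> \<rho> \<eta> \<sigma> (j + 2) =
      (\<lambda>x. period_pi \<iota> \<eta> \<sigma> w *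
        ((\<Prod>i\<le>j + 1. Theta_conj \<iota> \<eta> \<sigma> i) /
         (r * (Theta_conj \<iota> \<eta> \<sigma> 0 * Theta_conj \<iota> \<eta> \<sigma> 1))) * \<iota> x) ` I_inf_neg_power \<rho> j"
    if r: "r ^ (CARD('k) - 1) = Theta_conj \<iota> \<eta> \<sigma> 2 / Theta_conj \<iota> \<eta> \<sigma> (j + 2)" for j r
  proof -
    have nz: "Theta_conj \<iota> \<eta> \<sigma> i \<noteq> 0" for i
      using theta_etaF_nz[of i] by (simp add: Theta_conj_eq)
    \<comment> \<open>The quotient of roots is a root of \<open>- \<sigma>^(j+2)(\<Theta>)\<close>,
      so \<open>kernel_eq\<close> applies with \<open>w / r\<close> in place of
      \<open>w\<close>.\<close>
    have "(w / r) ^ (CARD('k) - 1) = - Theta_conj \<iota> \<eta> \<sigma> (j + 2)"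
      unfolding power_divide w_root r using nz[of 2] by simp
    then have root': "(w / r) ^ (CARD('k) - 1) = - (1 / (\<theta> - etaF (j + 2)))"
      by (simp only: Theta_conj_eq)
    have "{..j + 1} = insert 0 {1..<j + 2}"
      by auto
    then have split: "(\<Prod>i\<le>j + 1. Theta_conj \<iota> \<eta> \<sigma> i) =
        Theta_conj \<iota> \<eta> \<sigma> 0 * (\<Prod>i\<in>{1..<j + 2}. Theta_conj \<iota> \<eta> \<sigma> i)"
      by simp
    \<comment> \<open>Here \<open>a\<close> and \<open>b\<close> are \<open>\<Theta>\<close> and its
      first conjugate, \<open>c\<close> is the infinite product and \<open>x\<close> the product of
      the conjugates from 1 to \<open>j + 1\<close>; thus \<open>w * b * c\<close> is
      \<open>period_pi\<close>.\<close>
    have "w * b * c * (a * x / (r * (a * b))) = w / r * x * c" if "a \<noteq> 0" "b \<noteq> 0" for a b c x :: 'c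
      using that by simp
    then have "period_pi \<iota> \<eta> \<sigma> w * ((\<Prod>i\<le>j + 1. Theta_conj \<iota> \<eta> \<sigma> i) /
        (r * (Theta_conj \<iota> \<eta> \<sigma> 0 * Theta_conj \<iota> \<eta> \<sigma> 1))) =
        w / r * (\<Prod>i\<in>{1..<j + 2}. Theta_conj \<iota> \<eta> \<sigma> i) * ?PI"
      unfolding split period_pi_def using nz[of 0] nz[of 1] by blast
    also have "\<dots> = period_lead (w / r) (j + 2) * ?PI"
      by (simp only: period_lead_def Theta_conj_eq)
    finally show ?thesis
      using kernel_eq[OF refl root'] I_inf_neg_power_eq_pole_space[OF rho_irreducible rho_monic]
      by (simp add: ker_exp_def)
  qed
  ultimately show ?thesis
    using partial_period_LIMSEQ(1) by blast
qed

end
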